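(* Let $B\,|\,C$ be a Frobenius extension of rings and let $A=\operatorname{End} B_C$. If $B\,|\,C$ is rD3 (right depth three), then the composite ring extension $A\,|\,C$ is depth two.
   Context: Rings are unital. A ring extension $B\,|\,C$ is a unital ring homomorphism $C\to B$; a tower $A\,|\,B\,|\,C$ is a pair of unital ring homomorphisms $C\to B\to A$, with induced bimodule structures. $B\,|\,C$ is a Frobenius extension if there are a $C$-$C$-bimodule map $E:B\to C$ and elements $x_i,y_i\in B$ (finitely many) with $\sum_i E(bx_i)y_i=b=\sum_i x_iE(y_ib)$ for all $b\in B$. $\operatorname{End}B_C$ is the ring of right $C$-linear endomorphisms of $B$ under composition, and the map $B\to A=\operatorname{End} B_C$ is the left regular map $\lambda$, $\lambda(x)(b)=xb$; the composite $C\to B\to A$ defines $A\,|\,C$. A tower $A\,|\,B\,|\,C$ is right depth three (rD3) if, as $A$-$C$-bimodules, $A\otimes_BA$ is isomorphic to a direct summand of $A^N$ for some positive integer $N$. The ring extension $B\,|\,C$ is called rD3 if the tower $A\,|\,B\,|\,C$ with $A=\operatorname{End}B_C$ is rD3. A ring extension $A\,|\,C$ is right (respectively left) depth two if $A\otimes_CA$ is isomorphic, as an $A$-$C$-bimodule (respectively $C$-$A$-bimodule), to a direct summand of $A^N$ for some positive integer $N$; it is depth two (D2) if it is both left and right depth two. *)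

theory Defs
  imports "HOL-Algebra.RingHom" "HOL-Algebra.Free_Abelian_Groups"
begin

section \<open>Bimodules\<close>

text \<open>As for the library's record \<open>module\<close>, only the additive part of the underlying \<open>ring\<close>
  record is meaningful; the fields \<open>mult\<close> and \<open>one\<close> of a bimodule are never used.\<close>

record ('r, 's, 'm) bimodule = "'m ring" +
  lact :: "'r \<Rightarrow> 'm \<Rightarrow> 'm"
  ract :: "'m \<Rightarrow> 's \<Rightarrow> 'm"

locale bimodule = R: ring R + S: ring S + M: abelian_group M
  for R :: "('r, 'x) ring_scheme" and S :: "('s, 'y) ring_scheme" and M :: "('r, 's, 'm) bimodule" +
  assumes lact_closed: "\<lbrakk>r \<in> carrier R; m \<in> carrier M\<rbrakk> \<Longrightarrow> lact M r m \<in> carrier M"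
    and ract_closed: "\<lbrakk>m \<in> carrier M; s \<in> carrier S\<rbrakk> \<Longrightarrow> ract M m s \<in> carrier M"
    and lact_add: "\<lbrakk>r \<in> carrier R; m \<in> carrier M; m' \<in> carrier M\<rbrakk> \<Longrightarrow>
      lact M r (m \<oplus>\<^bsub>M\<^esub> m') = lact M r m \<oplus>\<^bsub>M\<^esub> lact M r m'"
    and add_lact: "\<lbrakk>r \<in> carrier R; r' \<in> carrier R; m \<in> carrier M\<rbrakk> \<Longrightarrow>
      lact M (r \<oplus>\<^bsub>R\<^esub> r') m = lact M r m \<oplus>\<^bsub>M\<^esub> lact M r' m"
    and mult_lact: "\<lbrakk>r \<in> carrier R; r' \<in> carrier R; m \<in> carrier M\<rbrakk> \<Longrightarrow>
      lact M (r \<otimes>\<^bsub>R\<^esub> r') m = lact M r (lact M r' m)"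
    and one_lact: "m \<in> carrier M \<Longrightarrow> lact M \<one>\<^bsub>R\<^esub> m = m"
    and add_ract: "\<lbrakk>m \<in> carrier M; m' \<in> carrier M; s \<in> carrier S\<rbrakk> \<Longrightarrow>
      ract M (m \<oplus>\<^bsub>M\<^esub> m') s = ract M m s \<oplus>\<^bsub>M\<^esub> ract M m' s"
    and ract_add: "\<lbrakk>m \<in> carrier M; s \<in> carrier S; s' \<in> carrier S\<rbrakk> \<Longrightarrow>
      ract M m (s \<oplus>\<^bsub>S\<^esub> s') = ract M m s \<oplus>\<^bsub>M\<^esub> ract M m s'"
    and ract_mult: "\<lbrakk>m \<in> carrier M; s \<in> carrier S; s' \<in> carrier S\<rbrakk> \<Longrightarrow>
      ract M m (s \<otimes>\<^bsub>S\<^esub> s') = ract M (ract M m s) s'"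
    and ract_one: "m \<in> carrier M \<Longrightarrow> ract M m \<one>\<^bsub>S\<^esub> = m"
    and lact_ract: "\<lbrakk>r \<in> carrier R; m \<in> carrier M; s \<in> carrier S\<rbrakk> \<Longrightarrow>
      ract M (lact M r m) s = lact M r (ract M m s)"

definition bimodule_hom ::
    "('r, 'x) ring_scheme \<Rightarrow> ('s, 'y) ring_scheme \<Rightarrow> ('r, 's, 'm) bimodule \<Rightarrow> ('r, 's, 'n) bimodule
      \<Rightarrow> ('m \<Rightarrow> 'n) set"
  where "bimodule_hom R S M N =
    {\<phi> \<in> carrier M \<rightarrow> carrier N.
      (\<forall>m\<in>carrier M. \<forall>m'\<in>carrier M. \<phi> (m \<oplus>\<^bsub>M\<^esub> m') = \<phi> m \<oplus>\<^bsub>N\<^esub> \<phi> m') \<and>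
      (\<forall>r\<in>carrier R. \<forall>m\<in>carrier M. \<phi> (lact M r m) = lact N r (\<phi> m)) \<and>
      (\<forall>m\<in>carrier M. \<forall>s\<in>carrier S. \<phi> (ract M m s) = ract N (\<phi> m) s)}"

definition bimodule_iso ::
    "('r, 'x) ring_scheme \<Rightarrow> ('s, 'y) ring_scheme \<Rightarrow> ('r, 's, 'm) bimodule \<Rightarrow> ('r, 's, 'n) bimodule
      \<Rightarrow> ('m \<Rightarrow> 'n) set"
  where "bimodule_iso R S M N =
    {\<phi> \<in> bimodule_hom R S M N. bij_betw \<phi> (carrier M) (carrier N)}"

definition sub_bimodule ::
    "('r, 'x) ring_scheme \<Rightarrow> ('s, 'y) ring_scheme \<Rightarrow> 'm set \<Rightarrow> ('r, 's, 'm) bimodule \<Rightarrow> bool"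
  where "sub_bimodule R S P M \<longleftrightarrow>
    additive_subgroup P M \<and>
    (\<forall>r\<in>carrier R. \<forall>m\<in>P. lact M r m \<in> P) \<and>
    (\<forall>m\<in>P. \<forall>s\<in>carrier S. ract M m s \<in> P)"

definition direct_summand ::
    "('r, 'x) ring_scheme \<Rightarrow> ('s, 'y) ring_scheme \<Rightarrow> 'm set \<Rightarrow> ('r, 's, 'm) bimodule \<Rightarrow> bool"
  where "direct_summand R S P M \<longleftrightarrow>
    sub_bimodule R S P M \<and>
    (\<exists>Q. sub_bimodule R S Q M \<and> P <+>\<^bsub>M\<^esub> Q = carrier M \<and> P \<inter> Q = {\<zero>\<^bsub>M\<^esub>})"

definition iso_to_direct_summand ::
    "('r, 'x) ring_scheme \<Rightarrow> ('s, 'y) ring_scheme \<Rightarrow> ('r, 's, 'm) bimodule \<Rightarrow> ('r, 's, 'n) bimodule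
      \<Rightarrow> bool"
  where "iso_to_direct_summand R S M N \<longleftrightarrow>
    (\<exists>P. direct_summand R S P N \<and> (\<exists>\<phi>. \<phi> \<in> bimodule_iso R S M (N\<lparr>carrier := P\<rparr>)))"

definition bimodule_power ::
    "nat \<Rightarrow> ('r, 's, 'm) bimodule \<Rightarrow> ('r, 's, nat \<Rightarrow> 'm) bimodule"
  where "bimodule_power n M =
    \<lparr>carrier = {..<n} \<rightarrow>\<^sub>E carrier M,
     monoid.mult = undefined, monoid.one = undefined,
     ring.zero = (\<lambda>i\<in>{..<n}. \<zero>\<^bsub>M\<^esub>),
     add = (\<lambda>u v. \<lambda>i\<in>{..<n}. u i \<oplus>\<^bsub>M\<^esub> v i),
     lact = (\<lambda>r u. \<lambda>i\<in>{..<n}. lact M r (u i)),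
     ract = (\<lambda>u s. \<lambda>i\<in>{..<n}. ract M (u i) s)\<rparr>"

text \<open>The ring \<open>A\<close> as a bimodule, with left scalars restricted along \<open>g\<close> and right scalars
  restricted along \<open>h\<close>.\<close>

definition regular_bimodule ::
    "('a, 'x) ring_scheme \<Rightarrow> ('r \<Rightarrow> 'a) \<Rightarrow> ('s \<Rightarrow> 'a) \<Rightarrow> ('r, 's, 'a) bimodule"
  where "regular_bimodule A g h =
    \<lparr>carrier = carrier A,
     monoid.mult = undefined, monoid.one = undefined,
     ring.zero = \<zero>\<^bsub>A\<^esub>, add = add A,
     lact = (\<lambda>r a. g r \<otimes>\<^bsub>A\<^esub> a),
     ract = (\<lambda>a s. a \<otimes>\<^bsub>A\<^esub> h s)\<rparr>"


section \<open>Tensor products of bimodules\<close>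

definition tensor_relators ::
    "('s, 'y) ring_scheme \<Rightarrow> ('r, 's, 'm) bimodule \<Rightarrow> ('s, 't, 'n) bimodule
      \<Rightarrow> (('m \<times> 'n) \<Rightarrow>\<^sub>0 int) set"
  where "tensor_relators S M N =
    {frag_of (m \<oplus>\<^bsub>M\<^esub> m', n) - frag_of (m, n) - frag_of (m', n) | m m' n.
       m \<in> carrier M \<and> m' \<in> carrier M \<and> n \<in> carrier N} \<union>
    {frag_of (m, n \<oplus>\<^bsub>N\<^esub> n') - frag_of (m, n) - frag_of (m, n') | m n n'.
       m \<in> carrier M \<and> n \<in> carrier N \<and> n' \<in> carrier N} \<union>
    {frag_of (ract M m s, n) - frag_of (m, lact N s n) | m s n.
       m \<in> carrier M \<and> s \<in> carrier S \<and> n \<in> carrier N}"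

definition tensor_free ::
    "('r, 's, 'm) bimodule \<Rightarrow> ('s, 't, 'n) bimodule \<Rightarrow> (('m \<times> 'n) \<Rightarrow>\<^sub>0 int) monoid"
  where "tensor_free M N = free_Abelian_group (carrier M \<times> carrier N)"

definition tensor_kernel ::
    "('s, 'y) ring_scheme \<Rightarrow> ('r, 's, 'm) bimodule \<Rightarrow> ('s, 't, 'n) bimodule
      \<Rightarrow> (('m \<times> 'n) \<Rightarrow>\<^sub>0 int) set"
  where "tensor_kernel S M N = generate (tensor_free M N) (tensor_relators S M N)"

text \<open>The tensor product of \<open>M\<close> and \<open>N\<close> over \<open>S\<close>: the quotient of the free abelian group on pairs
  by the subgroup generated by the relators. A scalar acts on a coset \<open>X\<close> by acting on the pairs
  in the formal sums belonging to \<open>X\<close>; the image of \<open>X\<close> is contained in a single coset, which is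
  recovered by adding the subgroup.\<close>

definition tensor_product ::
    "('s, 'y) ring_scheme \<Rightarrow> ('r, 's, 'm) bimodule \<Rightarrow> ('s, 't, 'n) bimodule
      \<Rightarrow> ('r, 't, (('m \<times> 'n) \<Rightarrow>\<^sub>0 int) set) bimodule"
  where "tensor_product S M N =
    (let F = tensor_free M N; K = tensor_kernel S M N in
    \<lparr>carrier = carrier (F Mod K),
     monoid.mult = undefined, monoid.one = undefined,
     ring.zero = \<one>\<^bsub>F Mod K\<^esub>,
     add = monoid.mult (F Mod K),
     lact = (\<lambda>r X. K <#>\<^bsub>F\<^esub> frag_extend (\<lambda>(m, n). frag_of (lact M r m, n)) ` X),
     ract = (\<lambda>X t. K <#>\<^bsub>F\<^esub> frag_extend (\<lambda>(m, n). frag_of (m, ract N n t)) ` X)\<rparr>)"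


section \<open>Ring extensions\<close>

text \<open>A ring extension \<open>B | C\<close> with structure map \<open>f\<close> is given by the library locale
  \<open>ring_hom_ring C B f\<close>.\<close>

definition frobenius_extension ::
    "('c, 'x) ring_scheme \<Rightarrow> ('b, 'y) ring_scheme \<Rightarrow> ('c \<Rightarrow> 'b) \<Rightarrow> bool"
  where "frobenius_extension C B f \<longleftrightarrow>
    ring_hom_ring C B f \<and>
    (\<exists>E \<in> bimodule_hom C C (regular_bimodule B f f) (regular_bimodule C id id).
     \<exists>(n::nat). \<exists>x \<in> {..<n} \<rightarrow> carrier B. \<exists>y \<in> {..<n} \<rightarrow> carrier B. \<forall>b\<in>carrier B.
       (\<Oplus>\<^bsub>B\<^esub>i\<in>{..<n}. f (E (b \<otimes>\<^bsub>B\<^esub> x i)) \<otimes>\<^bsub>B\<^esub> y i) = b \<and>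
       (\<Oplus>\<^bsub>B\<^esub>i\<in>{..<n}. x i \<otimes>\<^bsub>B\<^esub> f (E (y i \<otimes>\<^bsub>B\<^esub> b))) = b)"

text \<open>The ring of right \<open>C\<close>-linear endomorphisms of \<open>B\<close>; endomorphisms are extensional, i.e.
  \<open>undefined\<close> outside \<open>carrier B\<close>, so that equality of elements is equality on \<open>carrier B\<close>.\<close>

definition right_End ::
    "('c, 'x) ring_scheme \<Rightarrow> ('b, 'y) ring_scheme \<Rightarrow> ('c \<Rightarrow> 'b) \<Rightarrow> ('b \<Rightarrow> 'b) ring"
  where "right_End C B f =
    \<lparr>carrier = {h \<in> carrier B \<rightarrow>\<^sub>E carrier B.
       (\<forall>b\<in>carrier B. \<forall>b'\<in>carrier B. h (b \<oplus>\<^bsub>B\<^esub> b') = h b \<oplus>\<^bsub>B\<^esub> h b') \<and>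
       (\<forall>b\<in>carrier B. \<forall>c\<in>carrier C. h (b \<otimes>\<^bsub>B\<^esub> f c) = h b \<otimes>\<^bsub>B\<^esub> f c)},
     monoid.mult = compose (carrier B),
     monoid.one = (\<lambda>b\<in>carrier B. b),
     ring.zero = (\<lambda>b\<in>carrier B. \<zero>\<^bsub>B\<^esub>),
     add = (\<lambda>h k. \<lambda>b\<in>carrier B. h b \<oplus>\<^bsub>B\<^esub> k b)\<rparr>"

definition left_regular :: "('b, 'y) ring_scheme \<Rightarrow> 'b \<Rightarrow> ('b \<Rightarrow> 'b)"
  where "left_regular B x = (\<lambda>b\<in>carrier B. x \<otimes>\<^bsub>B\<^esub> b)"

text \<open>For a tower \<open>A | B | C\<close> with structure maps \<open>f\<close> from \<open>C\<close> to \<open>B\<close> and \<open>g\<close> from \<open>B\<close> to \<open>A\<close>.\<close>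

definition tower_rD3 ::
    "('c, 'x) ring_scheme \<Rightarrow> ('b, 'y) ring_scheme \<Rightarrow> ('a, 'z) ring_scheme
      \<Rightarrow> ('c \<Rightarrow> 'b) \<Rightarrow> ('b \<Rightarrow> 'a) \<Rightarrow> bool"
  where "tower_rD3 C B A f g \<longleftrightarrow>
    (\<exists>N>0. iso_to_direct_summand A C
       (tensor_product B (regular_bimodule A id g) (regular_bimodule A g (g \<circ> f)))
       (bimodule_power N (regular_bimodule A id (g \<circ> f))))"

definition extension_rD3 ::
    "('c, 'x) ring_scheme \<Rightarrow> ('b, 'y) ring_scheme \<Rightarrow> ('c \<Rightarrow> 'b) \<Rightarrow> bool"
  where "extension_rD3 C B f \<longleftrightarrow> tower_rD3 C B (right_End C B f) f (left_regular B)"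

definition right_D2 ::
    "('c, 'x) ring_scheme \<Rightarrow> ('a, 'z) ring_scheme \<Rightarrow> ('c \<Rightarrow> 'a) \<Rightarrow> bool"
  where "right_D2 C A h \<longleftrightarrow>
    (\<exists>N>0. iso_to_direct_summand A C
       (tensor_product C (regular_bimodule A id h) (regular_bimodule A h h))
       (bimodule_power N (regular_bimodule A id h)))"

definition left_D2 ::
    "('c, 'x) ring_scheme \<Rightarrow> ('a, 'z) ring_scheme \<Rightarrow> ('c \<Rightarrow> 'a) \<Rightarrow> bool"
  where "left_D2 C A h \<longleftrightarrow>
    (\<exists>N>0. iso_to_direct_summand C A
       (tensor_product C (regular_bimodule A h h) (regular_bimodule A h id))
       (bimodule_power N (regular_bimodule A h id)))"

definition depth_two ::
    "('c, 'x) ring_scheme \<Rightarrow> ('a, 'z) ring_scheme \<Rightarrow> ('c \<Rightarrow> 'a) \<Rightarrow> bool"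
  where "depth_two C A h \<longleftrightarrow> left_D2 C A h \<and> right_D2 C A h"


section \<open>Well-definedness\<close>

text \<open>The constructions above yield rings, ring extensions and bimodules, as intended; in
  particular the scalar actions on the tensor product are well defined.\<close>

lemma bimodule_regular:
  assumes A: "ring A" and g: "ring_hom_ring R A g" and h: "ring_hom_ring S A h"
  shows "bimodule R S (regular_bimodule A g h)"
proof -
  interpret A: ring A by fact
  interpret g: ring_hom_ring R A g by fact
  interpret h: ring_hom_ring S A h by fact
  have ag: "abelian_group (regular_bimodule A g h)"
    by (rule abelian_groupI)
      (auto simp: regular_bimodule_def A.add.m_ac intro: A.add.l_inv_ex)
  show ?thesis
    by (intro bimodule.intro bimodule_axioms.intro ag g.R.ring_axioms h.R.ring_axioms)
      (auto simp: regular_bimodule_def A.l_distr A.r_distr A.m_assoc)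
qed

lemma bimodule_bimodule_power:
  assumes "bimodule R S M"
  shows "bimodule R S (bimodule_power n M)"
proof -
  interpret bimodule R S M by fact
  have ag: "abelian_group (bimodule_power n M)"
  proof (rule abelian_groupI, goal_cases)
    case (6 x)
    then show ?case
      by (intro bexI[of _ "\<lambda>i\<in>{..<n}. \<ominus>\<^bsub>M\<^esub> x i"])
        (auto simp: bimodule_power_def PiE_iff M.l_neg)
  qed (auto simp: bimodule_power_def PiE_iff fun_eq_iff extensional_def restrict_def
      M.add.m_ac)
  show ?thesis
    by (intro bimodule.intro bimodule_axioms.intro ag R.ring_axioms S.ring_axioms)
      (auto simp: bimodule_power_def PiE_iff fun_eq_iff extensional_def restrict_def
        lact_closed ract_closed lact_add add_lact mult_lact one_lact
        add_ract ract_add ract_mult ract_one lact_ract)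
qed

lemma ring_right_End:
  assumes "ring_hom_ring C B f"
  shows "ring (right_End C B f)"
proof -
  interpret ring_hom_ring C B f by fact
  have ag: "abelian_group (right_End C B f)"
  proof (rule abelian_groupI, goal_cases)
    case (6 h)
    have "f c \<in> carrier B" if "c \<in> carrier C" for c using that by simp
    with 6 show ?case
      by (intro bexI[of _ "\<lambda>b\<in>carrier B. \<ominus>\<^bsub>B\<^esub> h b"])
        (auto simp: right_End_def PiE_iff fun_eq_iff restrict_def S.l_neg S.minus_add
          S.l_minus Pi_iff extensional_def)
  next
    case (1 x y)
    then show ?case
      by (auto simp: right_End_def PiE_iff Pi_iff S.l_distr S.add.m_ac)
  qed (auto simp: right_End_def PiE_iff fun_eq_iff extensional_def restrict_def
      S.l_distr S.add.m_ac)
  have m: "monoid (right_End C B f)"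
    by (rule monoidI)
      (auto simp: right_End_def PiE_iff Pi_iff fun_eq_iff compose_def extensional_def)
  show ?thesis
    by (intro ringI ag m)
      (auto simp: right_End_def PiE_iff Pi_iff fun_eq_iff compose_def extensional_def restrict_def)
qed

lemma ring_hom_ring_left_regular:
  assumes "ring_hom_ring C B f"
  shows "ring_hom_ring B (right_End C B f) (left_regular B)"
proof -
  interpret ring_hom_ring C B f by fact
  show ?thesis
    by (intro ring_hom_ringI ring_right_End assms S.ring_axioms)
      (auto simp: right_End_def left_regular_def PiE_iff Pi_iff fun_eq_iff compose_def
        S.l_distr S.r_distr S.m_assoc)
qed

locale tensor_pair = M: bimodule R S M + N: bimodule S T N
  for R :: "('r, 'x) ring_scheme" and S :: "('s, 'y) ring_scheme" and T :: "('t, 'z) ring_scheme"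
    and M :: "('r, 's, 'm) bimodule" and N :: "('s, 't, 'n) bimodule"
begin

abbreviation "F \<equiv> tensor_free M N"
abbreviation "K \<equiv> tensor_kernel S M N"
abbreviation "LA r \<equiv> frag_extend (\<lambda>(m, n). frag_of (lact M r m, n)) :: (('m \<times> 'n) \<Rightarrow>\<^sub>0 int) \<Rightarrow> _"
abbreviation "RA t \<equiv> frag_extend (\<lambda>(m, n). frag_of (m, ract N n t)) :: (('m \<times> 'n) \<Rightarrow>\<^sub>0 int) \<Rightarrow> _"

sublocale F: comm_group F
  unfolding tensor_free_def by (rule abelian_free_Abelian_group)

lemma F_mult [simp]: "x \<otimes>\<^bsub>F\<^esub> y = x + y" and F_one [simp]: "\<one>\<^bsub>F\<^esub> = 0"
  by (simp_all add: tensor_free_def)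

lemma F_carrier: "x \<in> carrier F \<longleftrightarrow> Poly_Mapping.keys x \<subseteq> carrier M \<times> carrier N"
  by (simp add: tensor_free_def)

lemma F_inv: "x \<in> carrier F \<Longrightarrow> inv\<^bsub>F\<^esub> x = - x"
  by (simp add: tensor_free_def)

lemma F_diff: "x \<in> carrier F \<Longrightarrow> y \<in> carrier F \<Longrightarrow> x - y \<in> carrier F"
  using F.m_closed[OF _ F.inv_closed, of x y] by (simp add: F_inv)

lemma F_of: "m \<in> carrier M \<Longrightarrow> n \<in> carrier N \<Longrightarrow> frag_of (m, n) \<in> carrier F"
  by (simp add: tensor_free_def)

lemma relators: "tensor_relators S M N \<subseteq> carrier F"
  by (auto simp: tensor_relators_def intro!: F_diff F_of N.lact_closed M.ract_closed)

lemma sub: "subgroup K F"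
  unfolding tensor_kernel_def by (rule F.generate_is_subgroup[OF relators])

lemma K_carrier: "x \<in> K \<Longrightarrow> x \<in> carrier F"
  using sub subgroup.subset by blast

lemma K_zero: "0 \<in> K"
  using subgroup.one_closed[OF sub] by simp

lemma K_add: "x \<in> K \<Longrightarrow> y \<in> K \<Longrightarrow> x + y \<in> K"
  using subgroup.m_closed[OF sub, of x y] by simp

lemma K_minus: "x \<in> K \<Longrightarrow> - x \<in> K"
  using subgroup.m_inv_closed[OF sub, of x] F_inv[OF K_carrier, of x] by simp

lemma K_diff: "x \<in> K \<Longrightarrow> y \<in> K \<Longrightarrow> x - y \<in> K"
  using K_add[of x "-y"] K_minus by simp

lemma coset_eq:
  assumes "x \<in> carrier F" "y \<in> carrier F" "x - y \<in> K"
  shows "K #>\<^bsub>F\<^esub> x = K #>\<^bsub>F\<^esub> y"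
proof -
  have "x \<in> K #>\<^bsub>F\<^esub> y"
    using assms(3) by (force simp: r_coset_def intro!: exI[of _ "x - y"])
  then show ?thesis using F.repr_independence[OF _ assms(2) sub] by simp
qed

lemma coset_action:
  assumes x: "x \<in> carrier F" and K: "frag_extend b ` K \<subseteq> K"
  shows "K <#>\<^bsub>F\<^esub> frag_extend b ` (K #>\<^bsub>F\<^esub> x) = K #>\<^bsub>F\<^esub> frag_extend b x"
proof -
  have "K <#>\<^bsub>F\<^esub> frag_extend b ` (K #>\<^bsub>F\<^esub> x)
      = (\<Union>k\<in>K. \<Union>k'\<in>K. {k + frag_extend b k' + frag_extend b x})"
    by (auto simp: set_mult_def r_coset_def frag_extend_add add.assoc)
  also have "\<dots> = (\<Union>k\<in>K. {k + frag_extend b x})"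
  proof (intro equalityI subsetI)
    fix z assume "z \<in> (\<Union>k\<in>K. {k + frag_extend b x})"
    then obtain k where "k \<in> K" "z = k + frag_extend b 0 + frag_extend b x" by auto
    then show "z \<in> (\<Union>k\<in>K. \<Union>k'\<in>K. {k + frag_extend b k' + frag_extend b x})"
      using K_zero by blast
  qed (use K K_add in blast)
  finally show ?thesis by (simp add: r_coset_def)
qed

lemma K_image:
  assumes "\<And>x. x \<in> tensor_relators S M N \<Longrightarrow> frag_extend b x \<in> K"
  shows "frag_extend b ` K \<subseteq> K"
proof clarify
  fix x assume "x \<in> K"
  then have "x \<in> generate F (tensor_relators S M N)" by (simp add: tensor_kernel_def)
  then show "frag_extend b x \<in> K"
  proof induction
    case (inv h)
    then show ?case using assms relators by (auto simp: F_inv frag_extend_minus K_minus)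
  qed (auto simp: K_zero assms frag_extend_add K_add)
qed

lemma K_rel1: "m \<in> carrier M \<Longrightarrow> m' \<in> carrier M \<Longrightarrow> n \<in> carrier N \<Longrightarrow>
    frag_of (m \<oplus>\<^bsub>M\<^esub> m', n) - frag_of (m, n) - frag_of (m', n) \<in> K"
  unfolding tensor_kernel_def by (rule generate.incl) (auto simp: tensor_relators_def)

lemma K_rel2: "m \<in> carrier M \<Longrightarrow> n \<in> carrier N \<Longrightarrow> n' \<in> carrier N \<Longrightarrow>
    frag_of (m, n \<oplus>\<^bsub>N\<^esub> n') - frag_of (m, n) - frag_of (m, n') \<in> K"
  unfolding tensor_kernel_def by (rule generate.incl) (auto simp: tensor_relators_def)

lemma K_rel3: "m \<in> carrier M \<Longrightarrow> s \<in> carrier S \<Longrightarrow> n \<in> carrier N \<Longrightarrow>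
    frag_of (ract M m s, n) - frag_of (m, lact N s n) \<in> K"
  unfolding tensor_kernel_def by (rule generate.incl) (auto simp: tensor_relators_def)

lemma LA_K: "r \<in> carrier R \<Longrightarrow> LA r ` K \<subseteq> K"
  by (rule K_image)
    (auto simp: tensor_relators_def frag_extend_diff M.lact_add M.lact_closed M.lact_ract[symmetric]
      K_rel1 K_rel2 K_rel3)

lemma RA_K: "t \<in> carrier T \<Longrightarrow> RA t ` K \<subseteq> K"
  by (rule K_image)
    (auto simp: tensor_relators_def frag_extend_diff N.add_ract N.ract_closed N.lact_ract
      K_rel1 K_rel2 K_rel3)

lemma F_induct:
  assumes "x \<in> carrier F" "P 0" "\<And>m n. m \<in> carrier M \<Longrightarrow> n \<in> carrier N \<Longrightarrow> P (frag_of (m, n))"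
    "\<And>a b. P a \<Longrightarrow> P b \<Longrightarrow> P (a - b)"
  shows "P x"
  using assms(1) unfolding F_carrier by (induction x rule: frag_induction) (use assms in auto)

lemma LA_F: "r \<in> carrier R \<Longrightarrow> x \<in> carrier F \<Longrightarrow> LA r x \<in> carrier F"
  by (erule F_induct) (auto simp: frag_extend_diff F_diff intro!: F_of M.lact_closed, use F.one_closed in simp)

lemma RA_F: "t \<in> carrier T \<Longrightarrow> x \<in> carrier F \<Longrightarrow> RA t x \<in> carrier F"
  by (erule F_induct) (auto simp: frag_extend_diff F_diff intro!: F_of N.ract_closed, use F.one_closed in simp)

abbreviation "q x \<equiv> K #>\<^bsub>F\<^esub> x"

lemma tensor_carrier: "carrier (tensor_product S M N) = q ` carrier F"
  by (simp add: Let_def tensor_product_def carrier_FactGroup)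

lemma tensor_add: "x \<in> carrier F \<Longrightarrow> y \<in> carrier F \<Longrightarrow> q x \<oplus>\<^bsub>tensor_product S M N\<^esub> q y = q (x + y)"
  using normal.rcos_sum[OF F.subgroup_imp_normal[OF sub], of x y]
  by (simp add: Let_def tensor_product_def FactGroup_def)

lemma tensor_lact: "r \<in> carrier R \<Longrightarrow> x \<in> carrier F \<Longrightarrow> lact (tensor_product S M N) r (q x) = q (LA r x)"
  by (simp add: Let_def tensor_product_def Let_def coset_action LA_K)

lemma tensor_ract: "t \<in> carrier T \<Longrightarrow> x \<in> carrier F \<Longrightarrow> ract (tensor_product S M N) (q x) t = q (RA t x)"
  by (simp add: Let_def tensor_product_def Let_def coset_action RA_K)

lemma tensor_zero: "\<zero>\<^bsub>tensor_product S M N\<^esub> = q 0"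
  using F.coset_join2[OF _ sub, of 0] K_zero F.one_closed by (simp add: Let_def tensor_product_def)

lemma F_add: "x \<in> carrier F \<Longrightarrow> y \<in> carrier F \<Longrightarrow> x + y \<in> carrier F"
  using F.m_closed[of x y] by simp

lemma bimodule_tensor_product: "bimodule R T (tensor_product S M N)"
proof -
  let ?P = "tensor_product S M N"
  have F0: "0 \<in> carrier F" using F.one_closed by simp
  have ag: "abelian_group ?P"
  proof (rule abelian_groupI, goal_cases)
    case (6 x)
    then obtain y where y: "x = q y" "y \<in> carrier F" by (auto simp: tensor_carrier)
    have "- y \<in> carrier F" using F_diff[OF F0 y(2)] by simp
    with y show ?case
      by (intro bexI[of _ "q (- y)"]) (auto simp: tensor_add tensor_zero tensor_carrier)
  qed (auto simp: tensor_carrier tensor_add F_add F0 tensor_zero add_ac)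
  have d1: "LA (r \<oplus>\<^bsub>R\<^esub> r') x - (LA r x + LA r' x) \<in> K"
    if "r \<in> carrier R" "r' \<in> carrier R" "x \<in> carrier F" for r r' x
    using that(3)
  proof (rule F_induct)
    fix m n assume "m \<in> carrier M" "n \<in> carrier N"
    then show "LA (r \<oplus>\<^bsub>R\<^esub> r') (frag_of (m, n)) - (LA r (frag_of (m, n)) + LA r' (frag_of (m, n))) \<in> K"
      using K_rel1[of "lact M r m" "lact M r' m" n] that
      by (simp add: M.add_lact M.lact_closed diff_diff_eq)
  next
    fix a b
    assume "LA (r \<oplus>\<^bsub>R\<^esub> r') a - (LA r a + LA r' a) \<in> K" "LA (r \<oplus>\<^bsub>R\<^esub> r') b - (LA r b + LA r' b) \<in> K"
    from K_diff[OF this] show "LA (r \<oplus>\<^bsub>R\<^esub> r') (a - b) - (LA r (a - b) + LA r' (a - b)) \<in> K"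
      by (simp add: frag_extend_diff algebra_simps)
  qed (simp add: K_zero)
  have d2: "RA (r \<oplus>\<^bsub>T\<^esub> r') x - (RA r x + RA r' x) \<in> K"
    if "r \<in> carrier T" "r' \<in> carrier T" "x \<in> carrier F" for r r' x
    using that(3)
  proof (rule F_induct)
    fix m n assume "m \<in> carrier M" "n \<in> carrier N"
    then show "RA (r \<oplus>\<^bsub>T\<^esub> r') (frag_of (m, n)) - (RA r (frag_of (m, n)) + RA r' (frag_of (m, n))) \<in> K"
      using K_rel2[of m "ract N n r" "ract N n r'"] that
      by (simp add: N.ract_add N.ract_closed diff_diff_eq)
  next
    fix a b
    assume "RA (r \<oplus>\<^bsub>T\<^esub> r') a - (RA r a + RA r' a) \<in> K" "RA (r \<oplus>\<^bsub>T\<^esub> r') b - (RA r b + RA r' b) \<in> K"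
    from K_diff[OF this] show "RA (r \<oplus>\<^bsub>T\<^esub> r') (a - b) - (RA r (a - b) + RA r' (a - b)) \<in> K"
      by (simp add: frag_extend_diff algebra_simps)
  qed (simp add: K_zero)
  have e1: "LA (r \<otimes>\<^bsub>R\<^esub> r') x = LA r (LA r' x)"
    if "r \<in> carrier R" "r' \<in> carrier R" "x \<in> carrier F" for r r' x
    using that(3) by (rule F_induct) (auto simp: that M.mult_lact frag_extend_diff)
  have e2: "LA \<one>\<^bsub>R\<^esub> x = x" if "x \<in> carrier F" for x
    using that by (rule F_induct) (auto simp: M.one_lact frag_extend_diff)
  have e3: "RA (r \<otimes>\<^bsub>T\<^esub> r') x = RA r' (RA r x)"
    if "r \<in> carrier T" "r' \<in> carrier T" "x \<in> carrier F" for r r' x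
    using that(3) by (rule F_induct) (auto simp: that N.ract_mult frag_extend_diff)
  have e4: "RA \<one>\<^bsub>T\<^esub> x = x" if "x \<in> carrier F" for x
    using that by (rule F_induct) (auto simp: N.ract_one frag_extend_diff)
  have e5: "RA t (LA r x) = LA r (RA t x)" if "x \<in> carrier F" for x r t
    using that by (rule F_induct) (auto simp: frag_extend_diff)
  have c1: "q (LA (r \<oplus>\<^bsub>R\<^esub> r') x) = q (LA r x + LA r' x)"
    if "r \<in> carrier R" "r' \<in> carrier R" "x \<in> carrier F" for r r' x
    by (rule coset_eq) (auto intro: d1 that LA_F F_add)
  have c2: "q (RA (r \<oplus>\<^bsub>T\<^esub> r') x) = q (RA r x + RA r' x)"
    if "r \<in> carrier T" "r' \<in> carrier T" "x \<in> carrier F" for r r' x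
    by (rule coset_eq) (auto intro: d2 that RA_F F_add)
  show ?thesis
    by (intro bimodule.intro bimodule_axioms.intro ag M.R.ring_axioms N.S.ring_axioms)
      (auto simp: tensor_carrier tensor_lact tensor_ract tensor_add LA_F RA_F F_add
        c1 c2 e1 e2 e3 e4 e5 frag_extend_add)
qed

end

lemma bimodule_tensor_product:
  assumes "bimodule R S M" and "bimodule S T N"
  shows "bimodule R T (tensor_product S M N)"
  by (intro tensor_pair.bimodule_tensor_product tensor_pair.intro assms)

end

theory Submission
  imports Defs
begin

text \<open>
  A bimodule \<open>X\<close> is a summand of \<open>Y\<^sup>N\<close> iff its identity is a sum of \<open>N\<close> endomorphisms that factor
  through \<open>Y\<close> (\<open>iso_to_direct_summand_power_iff\<close>). Bimodule maps between \<open>A \<otimes>\<^sub>B A\<close> and \<open>A\<close> that are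
  linear over \<open>A\<close> on the left are determined by what they do to \<open>1 \<otimes> a\<close> and to \<open>1\<close>. Hence right depth
  three of a tower \<open>A | B | C\<close> is the existence of quasibases: finitely many \<open>B\<close>-\<open>C\<close>-bilinear maps
  \<open>\<gamma>\<^sub>i\<close> from \<open>A\<close> to \<open>A\<close> and elements \<open>u\<^sub>i\<close> of \<open>A \<otimes>\<^sub>B A\<close> commuting with \<open>C\<close> such that
  \<open>1 \<otimes> a = \<Sum>\<^sub>i \<gamma>\<^sub>i(a) u\<^sub>i\<close> for all \<open>a\<close>. Right depth two of \<open>A | C\<close> is the case \<open>B = C\<close>.

  Let \<open>E\<close>, \<open>x\<^sub>j\<close>, \<open>y\<^sub>j\<close> be a Frobenius system of \<open>B | C\<close>, and let \<open>e = f \<circ> E\<close>, an element of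
  \<open>A = End B\<^sub>C\<close>. Every \<open>h\<close> in \<open>A\<close> is \<open>\<Sum>\<^sub>j h(x\<^sub>j) e y\<^sub>j\<close>, so that \<open>x e y \<mapsto> x \<otimes> y\<close> is an isomorphism of
  \<open>B\<close>-\<open>B\<close>-bimodules from \<open>A\<close> to \<open>B \<otimes>\<^sub>C B\<close>. Tensoring with \<open>A\<close> on both sides identifies
  \<open>A \<otimes>\<^sub>B A \<otimes>\<^sub>B A\<close> with \<open>A \<otimes>\<^sub>C A\<close>, where \<open>1 \<otimes> e \<otimes> a\<close> corresponds to \<open>1 \<otimes> a\<close>. Expanding
  \<open>1 \<otimes> e \<otimes> a\<close> with the rD3 quasibases, first in the right pair of factors and then in the left
  pair, gives quasibases for right depth two of \<open>A | C\<close>, with maps \<open>a \<mapsto> \<gamma>\<^sub>j(e \<gamma>\<^sub>i(a))\<close>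
  (\<open>right_D2_if_rD3\<close>).

  For the left-hand condition, \<open>A | C\<close> is again a Frobenius extension: \<open>x e y \<mapsto> E(x y)\<close> is a Frobenius
  homomorphism on \<open>A\<close> (\<open>frobenius_right_End\<close>). For a Frobenius extension, right depth two implies left
  depth two (\<open>left_D2_if_right_D2\<close>): the Frobenius homomorphism \<open>F\<close> turns \<open>1 \<otimes> a = \<Sum>\<^sub>i \<gamma>\<^sub>i(a) u\<^sub>i\<close> into
  an identity \<open>F(a z) = \<Sum>\<^sub>i \<gamma>\<^sub>i(a) \<eta>\<^sub>i(z)\<close> in which \<open>a\<close> and \<open>z\<close> enter symmetrically, and dual bases
  \<open>p\<^sub>k\<close>, \<open>q\<^sub>k\<close> turn it back into \<open>a \<otimes> 1 = \<Sum>\<^sub>k p\<^sub>k \<otimes> F(q\<^sub>k a) = \<Sum>\<^sub>i t\<^sub>i \<eta>\<^sub>i(a)\<close> with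
  \<open>t\<^sub>i = \<Sum>\<^sub>k p\<^sub>k \<otimes> \<gamma>\<^sub>i(q\<^sub>k)\<close>.
\<close>

section \<open>Additive maps and finite sums\<close>

lemma (in abelian_group_hom) hom_finsum:
  assumes "x \<in> I \<rightarrow> carrier G"
  shows "h (\<Oplus>\<^bsub>G\<^esub>i\<in>I. x i) = (\<Oplus>\<^bsub>H\<^esub>i\<in>I. h (x i))"
proof (cases "finite I")
  case True
  then show ?thesis using assms
    by (induction I) (auto simp: Pi_iff)
qed simp

lemma additive_abelian_group_homI:
  assumes "abelian_group G" "abelian_group H"
    and "\<And>x. x \<in> carrier G \<Longrightarrow> h x \<in> carrier H"
    and "\<And>x y. x \<in> carrier G \<Longrightarrow> y \<in> carrier G \<Longrightarrow> h (x \<oplus>\<^bsub>G\<^esub> y) = h x \<oplus>\<^bsub>H\<^esub> h y"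
  shows "abelian_group_hom G H h"
  by (intro abelian_group_homI group_hom.intro group_hom_axioms.intro homI assms abelian_group.a_group)
    (use assms in auto)

lemma (in abelian_monoid) finsum_swap:
  assumes "finite I" "finite J" and x: "\<And>i j. i \<in> I \<Longrightarrow> j \<in> J \<Longrightarrow> x i j \<in> carrier G"
  shows "(\<Oplus>i\<in>I. \<Oplus>j\<in>J. x i j) = (\<Oplus>j\<in>J. \<Oplus>i\<in>I. x i j)"
  using assms(1) x
proof (induction I)
  case (insert i I)
  then have "(\<Oplus>k\<in>insert i I. \<Oplus>j\<in>J. x k j) = (\<Oplus>j\<in>J. x i j) \<oplus> (\<Oplus>j\<in>J. \<Oplus>k\<in>I. x k j)"
    by (subst finsum_insert) (auto simp: Pi_iff)
  also have "\<dots> = (\<Oplus>j\<in>J. x i j \<oplus> (\<Oplus>k\<in>I. x k j))"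
    using insert by (subst finsum_addf) (auto simp: Pi_iff)
  also have "\<dots> = (\<Oplus>j\<in>J. \<Oplus>k\<in>insert i I. x k j)"
    using insert by (intro finsum_cong') (auto simp: Pi_iff)
  finally show ?case .
qed simp

lemma (in abelian_monoid) finsum_product:
  assumes "finite I" "finite J" and x: "\<And>i j. i \<in> I \<Longrightarrow> j \<in> J \<Longrightarrow> x i j \<in> carrier G"
  shows "(\<Oplus>i\<in>I. \<Oplus>j\<in>J. x i j) = (\<Oplus>p\<in>I \<times> J. x (fst p) (snd p))"
  using assms(1) x
proof (induction I)
  case (insert i I)
  have *: "insert i I \<times> J = Pair i ` J \<union> I \<times> J" by auto
  have "(\<Oplus>k\<in>insert i I. \<Oplus>j\<in>J. x k j) = (\<Oplus>j\<in>J. x i j) \<oplus> (\<Oplus>p\<in>I \<times> J. x (fst p) (snd p))"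
    using insert by (subst finsum_insert) (auto simp: Pi_iff)
  also have "(\<Oplus>j\<in>J. x i j) = (\<Oplus>p\<in>Pair i ` J. x (fst p) (snd p))"
    using insert by (subst finsum_reindex) (auto simp: inj_on_def)
  also have "\<dots> \<oplus> (\<Oplus>p\<in>I \<times> J. x (fst p) (snd p)) = (\<Oplus>p\<in>insert i I \<times> J. x (fst p) (snd p))"
    unfolding * using insert assms(2) by (subst finsum_Un_disjoint) auto
  finally show ?case .
qed simp

lemma bimodule_hom_abelian_group_hom:
  assumes "\<phi> \<in> bimodule_hom R S M N" "abelian_group M" "abelian_group N"
  shows "abelian_group_hom M N \<phi>"
  using assms by (intro additive_abelian_group_homI) (auto simp: bimodule_hom_def)

lemma bimodule_hom_comp:
  assumes "\<phi> \<in> bimodule_hom R S L M" "\<psi> \<in> bimodule_hom R S M N"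
  shows "\<psi> \<circ> \<phi> \<in> bimodule_hom R S L N"
  using assms by (simp add: bimodule_hom_def Pi_iff)

context bimodule begin
lemma lact_hom: "r \<in> carrier R \<Longrightarrow> abelian_group_hom M M (lact M r)"
  by (intro additive_abelian_group_homI M.abelian_group_axioms) (auto simp: lact_closed lact_add)

lemma ract_hom: "s \<in> carrier S \<Longrightarrow> abelian_group_hom M M (\<lambda>m. ract M m s)"
  by (intro additive_abelian_group_homI M.abelian_group_axioms) (auto simp: ract_closed add_ract)
end

section \<open>Summands of powers of a bimodule\<close>

text \<open>A summand is a retract: the summand gives the inclusion and the projection along a
  complement; conversely a retract is complemented by the kernel of the retraction.\<close>

lemma iso_to_direct_summand_iff_retract:
  assumes "bimodule R S X" and "bimodule R S Z"
  shows "iso_to_direct_summand R S X Z \<longleftrightarrow>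
    (\<exists>\<phi>\<in>bimodule_hom R S X Z. \<exists>\<psi>\<in>bimodule_hom R S Z X. \<forall>x\<in>carrier X. \<psi> (\<phi> x) = x)"
proof -
  interpret X: bimodule R S X by fact
  interpret Z: bimodule R S Z by fact
  show ?thesis
  proof
    assume "iso_to_direct_summand R S X Z"
    then obtain P Q \<phi> where P: "sub_bimodule R S P Z" and Q: "sub_bimodule R S Q Z"
      and PQ: "P <+>\<^bsub>Z\<^esub> Q = carrier Z" "P \<inter> Q = {\<zero>\<^bsub>Z\<^esub>}"
      and \<phi>: "\<phi> \<in> bimodule_iso R S X (Z\<lparr>carrier := P\<rparr>)"
      unfolding iso_to_direct_summand_def direct_summand_def by blast
    interpret P: additive_subgroup P Z using P by (simp add: sub_bimodule_def)
    interpret Q: additive_subgroup Q Z using Q by (simp add: sub_bimodule_def)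
    have \<phi>P: "\<And>x. x \<in> carrier X \<Longrightarrow> \<phi> x \<in> P" and bij: "bij_betw \<phi> (carrier X) P"
      and \<phi>hom: "\<phi> \<in> bimodule_hom R S X Z"
      using \<phi> P.a_subset by (auto simp: bimodule_iso_def bimodule_hom_def)
    have unique: "p = p'" if "p \<in> P" "p' \<in> P" "q \<in> Q" "q' \<in> Q" "p \<oplus>\<^bsub>Z\<^esub> q = p' \<oplus>\<^bsub>Z\<^esub> q'" for p p' q q'
    proof -
      have c: "p \<in> carrier Z" "p' \<in> carrier Z" "q \<in> carrier Z" "q' \<in> carrier Z"
        using that P.a_subset Q.a_subset by auto
      have "p \<ominus>\<^bsub>Z\<^esub> p' = q' \<ominus>\<^bsub>Z\<^esub> q"
        using c that(5) by (metis Z.M.add.inv_solve_right Z.M.add.inv_solve_left 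
            Z.M.minus_eq Z.M.add.m_assoc Z.M.add.m_comm Z.M.add.inv_closed Z.M.add.m_closed)
      moreover have "p \<ominus>\<^bsub>Z\<^esub> p' \<in> P" "q' \<ominus>\<^bsub>Z\<^esub> q \<in> Q"
        using that by (auto simp: a_minus_def)
      ultimately have "p \<ominus>\<^bsub>Z\<^esub> p' = \<zero>\<^bsub>Z\<^esub>" using PQ(2) by auto
      moreover have "p = (p \<ominus>\<^bsub>Z\<^esub> p') \<oplus>\<^bsub>Z\<^esub> p'"
        using c by (simp add: Z.M.minus_eq Z.M.a_assoc Z.M.l_neg)
      ultimately show ?thesis using c by simp
    qed
    have ex: "\<exists>x\<in>carrier X. \<exists>q\<in>Q. z = \<phi> x \<oplus>\<^bsub>Z\<^esub> q" if "z \<in> carrier Z" for z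
    proof -
      from that PQ(1) obtain p q where "p \<in> P" "q \<in> Q" "z = p \<oplus>\<^bsub>Z\<^esub> q"
        unfolding set_add_def' by blast
      with bij show ?thesis by (auto simp: bij_betw_def)
    qed
    \<comment> \<open>the projection onto \<open>P\<close> along \<open>Q\<close>, followed by the inverse of \<open>\<phi>\<close>\<close>
    define \<psi> where "\<psi> z = (SOME x. x \<in> carrier X \<and> (\<exists>q\<in>Q. z = \<phi> x \<oplus>\<^bsub>Z\<^esub> q))" for z
    have \<psi>: "\<psi> z \<in> carrier X \<and> (\<exists>q\<in>Q. z = \<phi> (\<psi> z) \<oplus>\<^bsub>Z\<^esub> q)" if "z \<in> carrier Z" for z
      unfolding \<psi>_def by (rule someI_ex) (use ex[OF that] in blast)
    have \<psi>I: "\<psi> (\<phi> x \<oplus>\<^bsub>Z\<^esub> q) = x" if "x \<in> carrier X" "q \<in> Q" for x q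
    proof -
      have "\<phi> x \<oplus>\<^bsub>Z\<^esub> q \<in> carrier Z" using that \<phi>P P.a_Hcarr Q.a_Hcarr by blast
      from \<psi>[OF this] unique[of "\<phi> x"] that \<phi>P bij show ?thesis
        by (metis bij_betw_def inj_on_def)
    qed
    have hom: "\<psi> \<in> bimodule_hom R S Z X"
    proof -
      have "\<psi> (z \<oplus>\<^bsub>Z\<^esub> z') = \<psi> z \<oplus>\<^bsub>X\<^esub> \<psi> z'" if z: "z \<in> carrier Z" "z' \<in> carrier Z" for z z'
      proof -
        from \<psi>[OF z(1)] \<psi>[OF z(2)] obtain q q' where q: "q \<in> Q" "q' \<in> Q" "z = \<phi> (\<psi> z) \<oplus>\<^bsub>Z\<^esub> q" "z' = \<phi> (\<psi> z') \<oplus>\<^bsub>Z\<^esub> q'"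
          and c: "\<psi> z \<in> carrier X" "\<psi> z' \<in> carrier X" by blast
        have "z \<oplus>\<^bsub>Z\<^esub> z' = (\<phi> (\<psi> z) \<oplus>\<^bsub>Z\<^esub> q) \<oplus>\<^bsub>Z\<^esub> (\<phi> (\<psi> z') \<oplus>\<^bsub>Z\<^esub> q')" using q by simp
        also have "\<dots> = (\<phi> (\<psi> z) \<oplus>\<^bsub>Z\<^esub> \<phi> (\<psi> z')) \<oplus>\<^bsub>Z\<^esub> (q \<oplus>\<^bsub>Z\<^esub> q')"
          using q(1,2) c \<phi>P P.a_Hcarr Q.a_Hcarr by (simp add: Z.M.a_ac)
        also have "\<dots> = \<phi> (\<psi> z \<oplus>\<^bsub>X\<^esub> \<psi> z') \<oplus>\<^bsub>Z\<^esub> (q \<oplus>\<^bsub>Z\<^esub> q')"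
          using c \<phi>hom by (simp add: bimodule_hom_def)
        finally show ?thesis using \<psi>I c q by simp
      qed
      moreover have "\<psi> (lact Z r z) = lact X r (\<psi> z)" if z: "r \<in> carrier R" "z \<in> carrier Z" for r z
      proof -
        from \<psi>[OF z(2)] obtain q where q: "q \<in> Q" "z = \<phi> (\<psi> z) \<oplus>\<^bsub>Z\<^esub> q" and c: "\<psi> z \<in> carrier X" by blast
        have "lact Z r z = lact Z r (\<phi> (\<psi> z) \<oplus>\<^bsub>Z\<^esub> q)" using q by simp
        also have "\<dots> = \<phi> (lact X r (\<psi> z)) \<oplus>\<^bsub>Z\<^esub> lact Z r q"
          using q(1) c \<phi>P P.a_Hcarr Q.a_Hcarr z \<phi>hom by (simp add: Z.lact_add bimodule_hom_def)
        moreover have "lact Z r q \<in> Q" using Q q z by (simp add: sub_bimodule_def)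
        ultimately show ?thesis using \<psi>I c q z X.lact_closed by simp
      qed
      moreover have "\<psi> (ract Z z s) = ract X (\<psi> z) s" if z: "s \<in> carrier S" "z \<in> carrier Z" for s z
      proof -
        from \<psi>[OF z(2)] obtain q where q: "q \<in> Q" "z = \<phi> (\<psi> z) \<oplus>\<^bsub>Z\<^esub> q" and c: "\<psi> z \<in> carrier X" by blast
        have "ract Z z s = ract Z (\<phi> (\<psi> z) \<oplus>\<^bsub>Z\<^esub> q) s" using q by simp
        also have "\<dots> = \<phi> (ract X (\<psi> z) s) \<oplus>\<^bsub>Z\<^esub> ract Z q s"
          using q(1) c \<phi>P P.a_Hcarr Q.a_Hcarr z \<phi>hom by (simp add: Z.add_ract bimodule_hom_def)
        moreover have "ract Z q s \<in> Q" using Q q z by (simp add: sub_bimodule_def)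
        ultimately show ?thesis using \<psi>I c q z X.ract_closed by simp
      qed
      ultimately show ?thesis using \<psi> by (auto simp: bimodule_hom_def)
    qed
    moreover have "\<psi> (\<phi> x) = x" if "x \<in> carrier X" for x
      using \<psi>I[OF that Q.zero_closed] that \<phi>hom by (simp add: bimodule_hom_def Pi_iff)
    ultimately show "\<exists>\<phi>\<in>bimodule_hom R S X Z. \<exists>\<psi>\<in>bimodule_hom R S Z X. \<forall>x\<in>carrier X. \<psi> (\<phi> x) = x"
      using \<phi>hom by blast
  next
    assume "\<exists>\<phi>\<in>bimodule_hom R S X Z. \<exists>\<psi>\<in>bimodule_hom R S Z X. \<forall>x\<in>carrier X. \<psi> (\<phi> x) = x"
    then obtain \<phi> \<psi> where \<phi>: "\<phi> \<in> bimodule_hom R S X Z" and \<psi>: "\<psi> \<in> bimodule_hom R S Z X"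
      and inv: "\<And>x. x \<in> carrier X \<Longrightarrow> \<psi> (\<phi> x) = x" by blast
    interpret \<phi>: abelian_group_hom X Z \<phi>
      using \<phi> by (rule bimodule_hom_abelian_group_hom) (rule X.M.abelian_group_axioms Z.M.abelian_group_axioms)+
    interpret \<psi>: abelian_group_hom Z X \<psi>
      using \<psi> by (rule bimodule_hom_abelian_group_hom) (rule X.M.abelian_group_axioms Z.M.abelian_group_axioms)+
    let ?P = "\<phi> ` carrier X" and ?Q = "{z \<in> carrier Z. \<psi> z = \<zero>\<^bsub>X\<^esub>}"
    have P: "sub_bimodule R S ?P Z"
      unfolding sub_bimodule_def
    proof (intro conjI ballI additive_subgroupI Z.M.add.subgroupI)
      show "?P \<noteq> {}" using X.M.zero_closed by blast
    next
      fix a assume "a \<in> ?P"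
      then show "\<ominus>\<^bsub>Z\<^esub> a \<in> ?P" by (force simp flip: \<phi>.hom_a_inv)
    next
      fix a b assume "a \<in> ?P" "b \<in> ?P"
      then show "a \<oplus>\<^bsub>Z\<^esub> b \<in> ?P" by (force simp flip: \<phi>.hom_add)
    next
      fix r m assume r: "r \<in> carrier R" "m \<in> ?P"
      then obtain x where "x \<in> carrier X" "m = \<phi> x" by blast
      with r \<phi> have "lact Z r m = \<phi> (lact X r x)" "lact X r x \<in> carrier X"
        by (simp_all add: bimodule_hom_def X.lact_closed)
      then show "lact Z r m \<in> ?P" by blast
    next
      fix r m assume r: "r \<in> carrier S" "m \<in> ?P"
      then obtain x where "x \<in> carrier X" "m = \<phi> x" by blast
      with r \<phi> have "ract Z m r = \<phi> (ract X x r)" "ract X x r \<in> carrier X"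
        by (simp_all add: bimodule_hom_def X.ract_closed)
      then show "ract Z m r \<in> ?P" by blast
    qed auto
    have Q: "sub_bimodule R S ?Q Z"
      unfolding sub_bimodule_def
    proof (intro conjI ballI additive_subgroupI Z.M.add.subgroupI)
      fix r m assume r: "r \<in> carrier R" "m \<in> ?Q"
      interpret l: abelian_group_hom X X "lact X r" using r by (intro X.lact_hom)
      show "lact Z r m \<in> ?Q" using r \<psi> Z.lact_closed l.hom_zero by (auto simp: bimodule_hom_def)
    next
      fix r m assume r: "r \<in> carrier S" "m \<in> ?Q"
      interpret l: abelian_group_hom X X "\<lambda>x. ract X x r" using r by (intro X.ract_hom)
      show "ract Z m r \<in> ?Q" using r \<psi> Z.ract_closed l.hom_zero by (auto simp: bimodule_hom_def)
    qed (auto intro: Z.M.zero_closed)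
    have "z \<in> ?P <+>\<^bsub>Z\<^esub> ?Q" if z: "z \<in> carrier Z" for z
    proof -
      have "z = \<phi> (\<psi> z) \<oplus>\<^bsub>Z\<^esub> (z \<ominus>\<^bsub>Z\<^esub> \<phi> (\<psi> z))"
        using z by (simp add: Z.M.minus_eq Z.M.a_lcomm Z.M.r_neg)
      moreover have "z \<ominus>\<^bsub>Z\<^esub> \<phi> (\<psi> z) \<in> ?Q"
        using z inv by (simp add: Z.M.minus_eq X.M.r_neg)
      ultimately show ?thesis using z \<psi>.hom_closed unfolding set_add_def' by blast
    qed
    then have "?P <+>\<^bsub>Z\<^esub> ?Q = carrier Z" by (auto simp: set_add_def')
    moreover have "?P \<inter> ?Q = {\<zero>\<^bsub>Z\<^esub>}"
    proof (intro equalityI subsetI)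
      fix z assume "z \<in> {\<zero>\<^bsub>Z\<^esub>}"
      then have z: "z = \<phi> \<zero>\<^bsub>X\<^esub>" by simp
      moreover have "\<phi> \<zero>\<^bsub>X\<^esub> \<in> ?P" by blast
      ultimately show "z \<in> ?P \<inter> ?Q" by simp
    qed (use inv in auto)
    ultimately have "direct_summand R S ?P Z" unfolding direct_summand_def using P Q by blast
    moreover have "inj_on \<phi> (carrier X)" using inv by (metis inj_onI)
    then have "\<phi> \<in> bimodule_iso R S X (Z\<lparr>carrier := ?P\<rparr>)"
      using \<phi> by (simp add: bimodule_iso_def bimodule_hom_def bij_betw_def)
    ultimately show "iso_to_direct_summand R S X Z" unfolding iso_to_direct_summand_def by blast
  qed
qed

lemma bimodule_power_simps:
  "carrier (bimodule_power n M) = {..<n} \<rightarrow>\<^sub>E carrier M"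
  "add (bimodule_power n M) u v = (\<lambda>i\<in>{..<n}. u i \<oplus>\<^bsub>M\<^esub> v i)"
  "lact (bimodule_power n M) r u = (\<lambda>i\<in>{..<n}. lact M r (u i))"
  "ract (bimodule_power n M) u s = (\<lambda>i\<in>{..<n}. ract M (u i) s)"
  "\<zero>\<^bsub>bimodule_power n M\<^esub> = (\<lambda>i\<in>{..<n}. \<zero>\<^bsub>M\<^esub>)"
  by (simp_all add: bimodule_power_def)

text \<open>The components of a retraction pair between \<open>X\<close> and a power of \<open>Y\<close> are its compositions with
  the coordinate projections and inclusions, whose composites sum to the identity of the power.\<close>

lemma iso_to_direct_summand_power_iff:
  assumes "bimodule R S X" and "bimodule R S Y"
  shows "iso_to_direct_summand R S X (bimodule_power n Y) \<longleftrightarrow>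
    (\<exists>\<alpha> \<beta>. (\<forall>i<n. \<alpha> i \<in> bimodule_hom R S X Y \<and> \<beta> i \<in> bimodule_hom R S Y X) \<and>
      (\<forall>x\<in>carrier X. (\<Oplus>\<^bsub>X\<^esub>i\<in>{..<n}. \<beta> i (\<alpha> i x)) = x))"
proof -
  interpret X: bimodule R S X by fact
  interpret Y: bimodule R S Y by fact
  interpret Z: bimodule R S "bimodule_power n Y" by (rule bimodule_bimodule_power) fact
  let ?Z = "bimodule_power n Y"
  define \<iota> where "\<iota> i y = (\<lambda>j\<in>{..<n}. if j = i then y else \<zero>\<^bsub>Y\<^esub>)" for i :: nat and y
  have l0: "lact Y r \<zero>\<^bsub>Y\<^esub> = \<zero>\<^bsub>Y\<^esub>" if "r \<in> carrier R" for r
    using abelian_group_hom.hom_zero[OF Y.lact_hom[OF that]] .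
  have r0: "ract Y \<zero>\<^bsub>Y\<^esub> r = \<zero>\<^bsub>Y\<^esub>" if "r \<in> carrier S" for r
    using abelian_group_hom.hom_zero[OF Y.ract_hom[OF that]] .
  have \<iota>: "\<iota> i \<in> bimodule_hom R S Y ?Z" if "i < n" for i
    using that by (auto simp: bimodule_hom_def \<iota>_def bimodule_power_simps fun_eq_iff PiE_iff l0 r0)
  have pr: "(\<lambda>u. u i) \<in> bimodule_hom R S ?Z Y" if "i < n" for i
    using that by (auto simp: bimodule_hom_def bimodule_power_simps)
  have decomp: "(\<Oplus>\<^bsub>?Z\<^esub>i\<in>{..<n}. \<iota> i (u i)) = u" if u: "u \<in> carrier ?Z" for u
  proof (rule PiE_ext[of _ "{..<n}" "\<lambda>_. carrier Y"])
    have c: "(\<lambda>i. \<iota> i (u i)) \<in> {..<n} \<rightarrow> carrier ?Z"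
      using u by (simp add: bimodule_power_simps \<iota>_def PiE_iff Pi_iff)
    show "(\<Oplus>\<^bsub>?Z\<^esub>i\<in>{..<n}. \<iota> i (u i)) \<in> {..<n} \<rightarrow>\<^sub>E carrier Y"
      using Z.M.finsum_closed[OF c] by (simp add: bimodule_power_simps)
    show "u \<in> {..<n} \<rightarrow>\<^sub>E carrier Y" using u by (simp add: bimodule_power_simps)
    have uY: "u i \<in> carrier Y" if "i < n" for i
      using u that by (auto simp: bimodule_power_simps)
    fix j assume j: "j \<in> {..<n}"
    interpret pr: abelian_group_hom ?Z Y "\<lambda>u. u j"
      using pr j by (intro bimodule_hom_abelian_group_hom Z.M.abelian_group_axioms Y.M.abelian_group_axioms) auto
    have "(\<Oplus>\<^bsub>?Z\<^esub>i\<in>{..<n}. \<iota> i (u i)) j = (\<Oplus>\<^bsub>Y\<^esub>i\<in>{..<n}. \<iota> i (u i) j)"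
      using pr.hom_finsum[OF c] .
    also have "\<dots> = (\<Oplus>\<^bsub>Y\<^esub>i\<in>{..<n}. if j = i then u i else \<zero>\<^bsub>Y\<^esub>)"
      using j by (intro Y.M.finsum_cong') (simp_all add: \<iota>_def uY Pi_iff)
    also have "\<dots> = u j"
      using j by (intro Y.M.finsum_singleton) (simp_all add: uY Pi_iff)
    finally show "(\<Oplus>\<^bsub>?Z\<^esub>i\<in>{..<n}. \<iota> i (u i)) j = u j" .
  qed
  show ?thesis
    unfolding iso_to_direct_summand_iff_retract[OF assms(1) Z.bimodule_axioms]
  proof
    assume "\<exists>\<phi>\<in>bimodule_hom R S X ?Z. \<exists>\<psi>\<in>bimodule_hom R S ?Z X. \<forall>x\<in>carrier X. \<psi> (\<phi> x) = x"
    then obtain \<phi> \<psi> where \<phi>: "\<phi> \<in> bimodule_hom R S X ?Z" and \<psi>: "\<psi> \<in> bimodule_hom R S ?Z X"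
      and inv: "\<And>x. x \<in> carrier X \<Longrightarrow> \<psi> (\<phi> x) = x" by blast
    interpret \<psi>: abelian_group_hom ?Z X \<psi>
      using \<psi> by (rule bimodule_hom_abelian_group_hom) (rule X.M.abelian_group_axioms Z.M.abelian_group_axioms)+
    have "(\<Oplus>\<^bsub>X\<^esub>i\<in>{..<n}. (\<psi> \<circ> \<iota> i) (((\<lambda>u. u i) \<circ> \<phi>) x)) = x" if x: "x \<in> carrier X" for x
    proof -
      have \<phi>x: "\<phi> x \<in> carrier ?Z" using \<phi> x by (auto simp: bimodule_hom_def)
      then have "(\<lambda>i. \<iota> i (\<phi> x i)) \<in> {..<n} \<rightarrow> carrier ?Z"
        by (simp add: bimodule_power_simps \<iota>_def PiE_iff Pi_iff)
      from \<psi>.hom_finsum[OF this] show ?thesis using decomp[OF \<phi>x] inv[OF x] by simp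
    qed
    then show "\<exists>\<alpha> \<beta>. (\<forall>i<n. \<alpha> i \<in> bimodule_hom R S X Y \<and> \<beta> i \<in> bimodule_hom R S Y X) \<and>
      (\<forall>x\<in>carrier X. (\<Oplus>\<^bsub>X\<^esub>i\<in>{..<n}. \<beta> i (\<alpha> i x)) = x)"
      using bimodule_hom_comp[OF \<phi> pr] bimodule_hom_comp[OF \<iota> \<psi>]
      by (intro exI[of _ "\<lambda>i. (\<lambda>u. u i) \<circ> \<phi>"] exI[of _ "\<lambda>i. \<psi> \<circ> \<iota> i"]) simp
  next
    assume "\<exists>\<alpha> \<beta>. (\<forall>i<n. \<alpha> i \<in> bimodule_hom R S X Y \<and> \<beta> i \<in> bimodule_hom R S Y X) \<and>
      (\<forall>x\<in>carrier X. (\<Oplus>\<^bsub>X\<^esub>i\<in>{..<n}. \<beta> i (\<alpha> i x)) = x)"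
    then obtain \<alpha> \<beta> where \<alpha>: "\<And>i. i < n \<Longrightarrow> \<alpha> i \<in> bimodule_hom R S X Y"
      and \<beta>: "\<And>i. i < n \<Longrightarrow> \<beta> i \<in> bimodule_hom R S Y X"
      and inv: "\<And>x. x \<in> carrier X \<Longrightarrow> (\<Oplus>\<^bsub>X\<^esub>i\<in>{..<n}. \<beta> i (\<alpha> i x)) = x" by blast
    let ?\<phi> = "\<lambda>x. \<lambda>i\<in>{..<n}. \<alpha> i x" and ?\<psi> = "\<lambda>u. \<Oplus>\<^bsub>X\<^esub>i\<in>{..<n}. \<beta> i (u i)"
    have \<phi>: "?\<phi> \<in> bimodule_hom R S X ?Z"
      using \<alpha> by (auto simp: bimodule_hom_def bimodule_power_simps fun_eq_iff Pi_iff)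
    have \<beta>': "\<beta> i y \<in> carrier X" "y' \<in> carrier Y \<Longrightarrow> \<beta> i (y \<oplus>\<^bsub>Y\<^esub> y') = \<beta> i y \<oplus>\<^bsub>X\<^esub> \<beta> i y'"
      "r \<in> carrier R \<Longrightarrow> \<beta> i (lact Y r y) = lact X r (\<beta> i y)"
      "s \<in> carrier S \<Longrightarrow> \<beta> i (ract Y y s) = ract X (\<beta> i y) s"
      if "i < n" "y \<in> carrier Y" for i y y' r s
      using \<beta>[OF that(1)] that(2) by (auto simp: bimodule_hom_def)
    have c: "(\<lambda>i. \<beta> i (u i)) \<in> {..<n} \<rightarrow> carrier X" if "u \<in> carrier ?Z" for u
      using that by (auto simp: bimodule_power_simps PiE_iff intro: \<beta>')
    have \<psi>: "?\<psi> \<in> bimodule_hom R S ?Z X"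
      unfolding bimodule_hom_def
    proof (intro CollectI conjI ballI)
      show "?\<psi> \<in> carrier ?Z \<rightarrow> carrier X" using c by auto
    next
      fix u v assume uv: "u \<in> carrier ?Z" "v \<in> carrier ?Z"
      have "?\<psi> (u \<oplus>\<^bsub>?Z\<^esub> v) = (\<Oplus>\<^bsub>X\<^esub>i\<in>{..<n}. \<beta> i (u i) \<oplus>\<^bsub>X\<^esub> \<beta> i (v i))"
        using uv by (intro X.M.finsum_cong') (auto simp: bimodule_power_simps PiE_iff \<beta>')
      then show "?\<psi> (u \<oplus>\<^bsub>?Z\<^esub> v) = ?\<psi> u \<oplus>\<^bsub>X\<^esub> ?\<psi> v"
        using c uv by (simp add: X.M.finsum_addf)
    next
      fix r u assume r: "r \<in> carrier R" and u: "u \<in> carrier ?Z"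
      have "?\<psi> (lact ?Z r u) = (\<Oplus>\<^bsub>X\<^esub>i\<in>{..<n}. lact X r (\<beta> i (u i)))"
        using u r by (intro X.M.finsum_cong') (auto simp: bimodule_power_simps PiE_iff \<beta>' X.lact_closed)
      then show "?\<psi> (lact ?Z r u) = lact X r (?\<psi> u)"
        using c u by (simp add: abelian_group_hom.hom_finsum[OF X.lact_hom[OF r]])
    next
      fix r u assume r: "r \<in> carrier S" and u: "u \<in> carrier ?Z"
      have "?\<psi> (ract ?Z u r) = (\<Oplus>\<^bsub>X\<^esub>i\<in>{..<n}. ract X (\<beta> i (u i)) r)"
        using u r by (intro X.M.finsum_cong') (auto simp: bimodule_power_simps PiE_iff \<beta>' X.ract_closed)
      then show "?\<psi> (ract ?Z u r) = ract X (?\<psi> u) r"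
        using c u by (simp add: abelian_group_hom.hom_finsum[OF X.ract_hom[OF r]])
    qed
    have "?\<psi> (?\<phi> x) = x" if "x \<in> carrier X" for x
    proof -
      have "\<alpha> i x \<in> carrier Y" if "i < n" for i
        using \<alpha>[OF that] \<open>x \<in> carrier X\<close> by (auto simp: bimodule_hom_def)
      then have "?\<psi> (?\<phi> x) = (\<Oplus>\<^bsub>X\<^esub>i\<in>{..<n}. \<beta> i (\<alpha> i x))"
        by (intro X.M.finsum_cong') (simp_all add: \<beta>' Pi_iff)
      with inv[OF that] show ?thesis by simp
    qed
    then show "\<exists>\<phi>\<in>bimodule_hom R S X ?Z. \<exists>\<psi>\<in>bimodule_hom R S ?Z X. \<forall>x\<in>carrier X. \<psi> (\<phi> x) = x"
      by (intro bexI[OF _ \<phi>] bexI[OF _ \<psi>]) simp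
  qed
qed

section \<open>Tensor products of bimodules\<close>

text \<open>Differences in the free abelian group can be avoided because \<open>-(m \<otimes> n) = (-m) \<otimes> n\<close>; so
  it suffices to treat sums of pure tensors.\<close>

lemma (in tensor_pair) tensor_induct:
  assumes x: "x \<in> carrier (tensor_product S M N)"
    and pure: "\<And>m n. m \<in> carrier M \<Longrightarrow> n \<in> carrier N \<Longrightarrow> P (q (frag_of (m, n)))"
    and add: "\<And>x y. x \<in> carrier (tensor_product S M N) \<Longrightarrow> y \<in> carrier (tensor_product S M N) \<Longrightarrow>
      P x \<Longrightarrow> P y \<Longrightarrow> P (x \<oplus>\<^bsub>tensor_product S M N\<^esub> y)"
  shows "P x"
proof -
  have m0: "q (- frag_of (m, n)) = q (frag_of (\<ominus>\<^bsub>M\<^esub> m, n))" if "m \<in> carrier M" "n \<in> carrier N" for m n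
  proof (rule coset_eq)
    have z: "frag_of (\<zero>\<^bsub>M\<^esub>, n) \<in> K"
      using K_minus[OF K_rel1[of "\<zero>\<^bsub>M\<^esub>" "\<zero>\<^bsub>M\<^esub>" n]] that by simp
    have "frag_of (m \<oplus>\<^bsub>M\<^esub> \<ominus>\<^bsub>M\<^esub> m, n) - frag_of (m, n) - frag_of (\<ominus>\<^bsub>M\<^esub> m, n) \<in> K"
      using that by (intro K_rel1) auto
    from K_diff[OF this z] show "- frag_of (m, n) - frag_of (\<ominus>\<^bsub>M\<^esub> m, n) \<in> K"
      using that by (simp add: M.M.r_neg)
    show "- frag_of (m, n) \<in> carrier F"
      using F_diff[OF K_carrier[OF K_zero] F_of[OF that]] by simp
  qed (use that F_of in auto)
  \<comment> \<open>the induction rule of the free group uses differences, so the claim is proved for \<open>a\<close> and \<open>-a\<close>\<close>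
  have "a \<in> carrier F \<and> P (q a) \<and> P (q (- a))" if "a \<in> carrier F" for a
    using that
  proof (rule F_induct)
    have "q (frag_of (\<zero>\<^bsub>M\<^esub>, \<zero>\<^bsub>N\<^esub>)) = q 0"
      using K_minus[OF K_rel1[of "\<zero>\<^bsub>M\<^esub>" "\<zero>\<^bsub>M\<^esub>" "\<zero>\<^bsub>N\<^esub>"]]
      by (intro coset_eq) (auto intro: F_of K_carrier K_zero)
    then have "P (q 0)" using pure[of "\<zero>\<^bsub>M\<^esub>" "\<zero>\<^bsub>N\<^esub>"] by simp
    then show "0 \<in> carrier F \<and> P (q 0) \<and> P (q (- 0))" using K_carrier K_zero by simp
  next
    fix m n assume "m \<in> carrier M" "n \<in> carrier N"
    then show "frag_of (m, n) \<in> carrier F \<and> P (q (frag_of (m, n))) \<and> P (q (- frag_of (m, n)))"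
      by (simp add: m0 pure F_of)
  next
    fix a b assume *: "a \<in> carrier F \<and> P (q a) \<and> P (q (- a))" "b \<in> carrier F \<and> P (q b) \<and> P (q (- b))"
    then have n: "- a \<in> carrier F" "- b \<in> carrier F"
      using F_diff[OF K_carrier[OF K_zero]] by force+
    have "P (q (a - b))" "P (q (b - a))"
      using add[of "q a" "q (- b)"] add[of "q b" "q (- a)"] * n
      by (auto simp: tensor_add tensor_carrier)
    then show "a - b \<in> carrier F \<and> P (q (a - b)) \<and> P (q (- (a - b)))"
      using * F_diff by simp
  qed
  with x show ?thesis by (auto simp: tensor_carrier)
qed

text \<open>The universal property: a biadditive balanced map extends to the free abelian group on pairs,
  and being balanced means that the extension kills the relators.\<close>

lemma (in tensor_pair) tensor_lift:
  assumes G: "abelian_group G"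
    and closed: "\<And>m n. m \<in> carrier M \<Longrightarrow> n \<in> carrier N \<Longrightarrow> b m n \<in> carrier G"
    and addl: "\<And>m m' n. m \<in> carrier M \<Longrightarrow> m' \<in> carrier M \<Longrightarrow> n \<in> carrier N \<Longrightarrow>
      b (m \<oplus>\<^bsub>M\<^esub> m') n = b m n \<oplus>\<^bsub>G\<^esub> b m' n"
    and addr: "\<And>m n n'. m \<in> carrier M \<Longrightarrow> n \<in> carrier N \<Longrightarrow> n' \<in> carrier N \<Longrightarrow>
      b m (n \<oplus>\<^bsub>N\<^esub> n') = b m n \<oplus>\<^bsub>G\<^esub> b m n'"
    and bal: "\<And>m s n. m \<in> carrier M \<Longrightarrow> s \<in> carrier S \<Longrightarrow> n \<in> carrier N \<Longrightarrow>
      b (ract M m s) n = b m (lact N s n)"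
  obtains \<phi> where "abelian_group_hom (tensor_product S M N) G \<phi>"
    and "\<And>m n. m \<in> carrier M \<Longrightarrow> n \<in> carrier N \<Longrightarrow> \<phi> (q (frag_of (m, n))) = b m n"
proof -
  interpret G: abelian_group G by fact
  have "(\<lambda>(m, n). b m n) ` (carrier M \<times> carrier N) \<subseteq> carrier (add_monoid G)"
    using closed by auto
  then obtain h where h: "h \<in> hom F (add_monoid G)"
    and hb: "\<And>p. p \<in> carrier M \<times> carrier N \<Longrightarrow> h (frag_of p) = (\<lambda>(m, n). b m n) p"
    unfolding tensor_free_def by (rule comm_group.free_Abelian_group_universal[OF G.a_comm_group]) blast
  interpret h: group_hom F "add_monoid G" h
    by (intro group_hom.intro group_hom_axioms.intro h F.group_axioms G.a_group)
  have hc: "h x \<in> carrier G" if "x \<in> carrier F" for x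
    using h.hom_closed[OF that] by simp
  have hadd: "h (x + y) = h x \<oplus>\<^bsub>G\<^esub> h y" if "x \<in> carrier F" "y \<in> carrier F" for x y
    using h.hom_mult[OF that] by simp
  have hdiff: "h (x - y) = h x \<ominus>\<^bsub>G\<^esub> h y" if "x \<in> carrier F" "y \<in> carrier F" for x y
  proof -
    have "h x = h (x - y) \<oplus>\<^bsub>G\<^esub> h y" using hadd[OF F_diff[OF that] that(2)] by simp
    then show ?thesis using hc that F_diff by (simp add: G.minus_eq G.a_assoc G.r_neg)
  qed
  have cancel: "u \<oplus>\<^bsub>G\<^esub> (v \<oplus>\<^bsub>G\<^esub> \<ominus>\<^bsub>G\<^esub> (u \<oplus>\<^bsub>G\<^esub> v)) = \<zero>\<^bsub>G\<^esub>" if "u \<in> carrier G" "v \<in> carrier G" for u v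
    using that by (simp add: G.a_assoc[symmetric] G.r_neg)
  have rel: "h x = \<zero>\<^bsub>G\<^esub>" if "x \<in> tensor_relators S M N" for x
    using that unfolding tensor_relators_def
    by (auto simp: hdiff F_of F_diff hb M.ract_closed N.lact_closed addl addr bal closed G.minus_eq G.r_neg
        G.a_ac G.minus_add[symmetric] cancel simp del: G.minus_add)
  have K0: "h x = \<zero>\<^bsub>G\<^esub>" if "x \<in> K" for x
    using that unfolding tensor_kernel_def
  proof induction
    case one
    then show ?case using h.hom_one by simp
  next
    case (incl x)
    then show ?case by (rule rel)
  next
    case (inv x)
    then have "x \<in> carrier F" using relators by blast
    with inv show ?case using hdiff[of 0 x] K_carrier[OF K_zero] rel[of x] h.hom_one
      by (simp add: F_inv G.minus_eq)
  next
    case (eng x y)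
    then have "x \<in> carrier F" "y \<in> carrier F" using K_carrier by (auto simp: tensor_kernel_def)
    with eng show ?case by (simp add: hadd)
  qed
  define \<phi> where "\<phi> X = the_elem (h ` X)" for X
  have \<phi>: "\<phi> (q x) = h x" if x: "x \<in> carrier F" for x
  proof -
    have "h y = h x" if "y \<in> q x" for y
      using that x K0 K_carrier by (auto simp: r_coset_def hadd hc)
    moreover have "x \<in> q x" using x sub F.rcos_self by blast
    ultimately have "h ` q x = {h x}" by blast
    then show ?thesis by (simp add: \<phi>_def)
  qed
  show ?thesis
  proof (rule that[of \<phi>])
    interpret P: bimodule R T "tensor_product S M N" by (rule bimodule_tensor_product)
    show "abelian_group_hom (tensor_product S M N) G \<phi>"
      by (intro additive_abelian_group_homI P.M.abelian_group_axioms G)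
        (auto simp: tensor_carrier \<phi> hc tensor_add F_add hadd)
    show "\<phi> (q (frag_of (m, n))) = b m n" if "m \<in> carrier M" "n \<in> carrier N" for m n
      using that hb[of "(m, n)"] by (simp add: \<phi> F_of)
  qed
qed

section \<open>The tensor square of a ring extension\<close>

text \<open>The tensor square carries the actions of \<open>A\<close> on both sides. The tensor products in the
  definitions of depth two and depth three are obtained from it by restricting one of these actions,
  which changes neither the elements nor the addition.\<close>

definition tensor_square ::
    "('b, 'y) ring_scheme \<Rightarrow> ('a, 'z) ring_scheme \<Rightarrow> ('b \<Rightarrow> 'a)
      \<Rightarrow> ('a, 'a, (('a \<times> 'a) \<Rightarrow>\<^sub>0 int) set) bimodule"
  where "tensor_square B A g =
    tensor_product B (regular_bimodule A id g) (regular_bimodule A g id)"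

definition pure_tensor ::
    "('b, 'y) ring_scheme \<Rightarrow> ('a, 'z) ring_scheme \<Rightarrow> ('b \<Rightarrow> 'a) \<Rightarrow> 'a \<Rightarrow> 'a
      \<Rightarrow> (('a \<times> 'a) \<Rightarrow>\<^sub>0 int) set"
  where "pure_tensor B A g a a' =
    tensor_kernel B (regular_bimodule A id g) (regular_bimodule A g id)
      #>\<^bsub>tensor_free (regular_bimodule A id g) (regular_bimodule A g id)\<^esub> frag_of (a, a')"

lemma regular_bimodule_simps [simp]:
  "carrier (regular_bimodule A g h) = carrier A"
  "\<zero>\<^bsub>regular_bimodule A g h\<^esub> = \<zero>\<^bsub>A\<^esub>"
  "add (regular_bimodule A g h) = add A"
  "lact (regular_bimodule A g h) r a = g r \<otimes>\<^bsub>A\<^esub> a"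
  "ract (regular_bimodule A g h) a s = a \<otimes>\<^bsub>A\<^esub> h s"
  by (simp_all add: regular_bimodule_def)

lemma ring_hom_ring_id: "ring A \<Longrightarrow> ring_hom_ring A A id"
  by (rule ring_hom_ringI) auto

locale ring_extension = A: ring A + g: ring_hom_ring B A g
  for B :: "('b, 'y) ring_scheme" and A :: "('a, 'z) ring_scheme" and g :: "'b \<Rightarrow> 'a"
begin

abbreviation "AA \<equiv> tensor_square B A g"
abbreviation "T \<equiv> pure_tensor B A g"

lemma tensor_pair: "tensor_pair A B A (regular_bimodule A id g) (regular_bimodule A g id)"
  by (intro tensor_pair.intro bimodule_regular ring_hom_ring_id A.ring_axioms g.ring_hom_ring_axioms)

sublocale AA: bimodule A A AA
  unfolding tensor_square_def by (rule tensor_pair.bimodule_tensor_product[OF tensor_pair])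

context
begin
interpretation tp: tensor_pair A B A "regular_bimodule A id g" "regular_bimodule A g id"
  by (rule tensor_pair)

lemma T_closed [simp]: "a \<in> carrier A \<Longrightarrow> a' \<in> carrier A \<Longrightarrow> T a a' \<in> carrier AA"
  using tp.F_of[of a a'] by (auto simp: tensor_square_def pure_tensor_def tp.tensor_carrier)

lemma T_add_left:
  assumes "x \<in> carrier A" "y \<in> carrier A" "a \<in> carrier A"
  shows "T (x \<oplus>\<^bsub>A\<^esub> y) a = T x a \<oplus>\<^bsub>AA\<^esub> T y a"
  using assms tp.K_rel1[of x y a] unfolding tensor_square_def pure_tensor_def
  by (subst tp.tensor_add) (simp_all add: tp.coset_eq tp.F_of tp.F_add diff_diff_eq)

lemma T_add_right:
  assumes "x \<in> carrier A" "y \<in> carrier A" "a \<in> carrier A"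
  shows "T a (x \<oplus>\<^bsub>A\<^esub> y) = T a x \<oplus>\<^bsub>AA\<^esub> T a y"
  using assms tp.K_rel2[of a x y] unfolding tensor_square_def pure_tensor_def
  by (subst tp.tensor_add) (simp_all add: tp.coset_eq tp.F_of tp.F_add diff_diff_eq)

lemma T_middle:
  assumes "a \<in> carrier A" "b \<in> carrier B" "a' \<in> carrier A"
  shows "T (a \<otimes>\<^bsub>A\<^esub> g b) a' = T a (g b \<otimes>\<^bsub>A\<^esub> a')"
  using assms tp.K_rel3[of a b a'] unfolding pure_tensor_def
  by (simp add: tp.coset_eq tp.F_of)

lemma lact_T [simp]:
  assumes "a \<in> carrier A" "x \<in> carrier A" "y \<in> carrier A"
  shows "lact AA a (T x y) = T (a \<otimes>\<^bsub>A\<^esub> x) y"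
  using assms tp.tensor_lact[of a "frag_of (x, y)"] tp.F_of[of x y]
  by (simp add: tensor_square_def pure_tensor_def)

lemma ract_T [simp]:
  assumes "a \<in> carrier A" "x \<in> carrier A" "y \<in> carrier A"
  shows "ract AA (T x y) a = T x (y \<otimes>\<^bsub>A\<^esub> a)"
  using assms tp.tensor_ract[of a "frag_of (x, y)"] tp.F_of[of x y]
  by (simp add: tensor_square_def pure_tensor_def)

lemma AA_induct [consumes 1, case_names pure add]:
  assumes "x \<in> carrier AA"
    and "\<And>a a'. a \<in> carrier A \<Longrightarrow> a' \<in> carrier A \<Longrightarrow> P (T a a')"
    and "\<And>x y. x \<in> carrier AA \<Longrightarrow> y \<in> carrier AA \<Longrightarrow> P x \<Longrightarrow> P y \<Longrightarrow> P (x \<oplus>\<^bsub>AA\<^esub> y)"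
  shows "P x"
  using assms unfolding tensor_square_def pure_tensor_def
  by (rule tp.tensor_induct) simp_all

lemma AA_lift:
  assumes "abelian_group G"
    and "\<And>x y. x \<in> carrier A \<Longrightarrow> y \<in> carrier A \<Longrightarrow> \<beta> x y \<in> carrier G"
    and "\<And>x x' y. x \<in> carrier A \<Longrightarrow> x' \<in> carrier A \<Longrightarrow> y \<in> carrier A \<Longrightarrow>
      \<beta> (x \<oplus>\<^bsub>A\<^esub> x') y = \<beta> x y \<oplus>\<^bsub>G\<^esub> \<beta> x' y"
    and "\<And>x y y'. x \<in> carrier A \<Longrightarrow> y \<in> carrier A \<Longrightarrow> y' \<in> carrier A \<Longrightarrow>
      \<beta> x (y \<oplus>\<^bsub>A\<^esub> y') = \<beta> x y \<oplus>\<^bsub>G\<^esub> \<beta> x y'"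
    and "\<And>x b y. x \<in> carrier A \<Longrightarrow> b \<in> carrier B \<Longrightarrow> y \<in> carrier A \<Longrightarrow>
      \<beta> (x \<otimes>\<^bsub>A\<^esub> g b) y = \<beta> x (g b \<otimes>\<^bsub>A\<^esub> y)"
  obtains \<phi> where "abelian_group_hom AA G \<phi>"
    and "\<And>x y. x \<in> carrier A \<Longrightarrow> y \<in> carrier A \<Longrightarrow> \<phi> (T x y) = \<beta> x y"
proof -
  obtain \<phi> where "abelian_group_hom AA G \<phi>"
    and "\<And>x y. x \<in> carrier A \<Longrightarrow> y \<in> carrier A \<Longrightarrow> \<phi> (T x y) = \<beta> x y"
    unfolding tensor_square_def pure_tensor_def
    by (rule tp.tensor_lift[OF assms(1), of \<beta>]) (use assms in simp_all)
  then show ?thesis by (rule that)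
qed

end

lemma T_hom_left: "a \<in> carrier A \<Longrightarrow> abelian_group_hom A AA (\<lambda>x. T x a)"
  by (intro additive_abelian_group_homI A.abelian_group_axioms AA.M.abelian_group_axioms)
    (simp_all add: T_add_left)

lemma T_hom_right: "a \<in> carrier A \<Longrightarrow> abelian_group_hom A AA (T a)"
  by (intro additive_abelian_group_homI A.abelian_group_axioms AA.M.abelian_group_axioms)
    (simp_all add: T_add_right)

lemma restricted_tensor_square:
  fixes k :: "'r \<Rightarrow> 'a" and l :: "'s \<Rightarrow> 'a"
  defines "X \<equiv> tensor_product B (regular_bimodule A k g) (regular_bimodule A g l)"
  shows "carrier X = carrier AA" and "add X = add AA" and "finsum X = finsum AA"
    and "lact X r = lact AA (k r)" and "ract X x s = ract AA x (l s)"
proof -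
  have *: "tensor_free (regular_bimodule A k g) (regular_bimodule A g l)
      = tensor_free (regular_bimodule A id g) (regular_bimodule A g id)"
    by (simp add: tensor_free_def)
  have **: "tensor_kernel B (regular_bimodule A k g) (regular_bimodule A g l)
      = tensor_kernel B (regular_bimodule A id g) (regular_bimodule A g id)"
    by (simp add: tensor_kernel_def tensor_relators_def *)
  show "carrier X = carrier AA" and "add X = add AA"
    and "lact X r = lact AA (k r)" and "ract X x s = ract AA x (l s)"
    by (simp_all add: X_def tensor_square_def tensor_product_def * ** Let_def)
  \<comment> \<open>the two sums belong to record types with different scalars, so they agree only after unfolding\<close>
  show "finsum X = finsum AA"
    by (simp add: X_def tensor_square_def tensor_product_def * ** Let_def finsum_def finprod_def fun_eq_iff)
qed

lemma bimodule_restricted_tensor_square: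
  assumes "ring_hom_ring R A k" "ring_hom_ring S A l"
  shows "bimodule R S (tensor_product B (regular_bimodule A k g) (regular_bimodule A g l))"
  by (intro bimodule_tensor_product bimodule_regular A.ring_axioms assms g.ring_hom_ring_axioms)

end

section \<open>Quasibases\<close>

lemma iso_to_direct_summand_powerI:
  assumes "bimodule R S X" "bimodule R S Y" and I: "finite I"
    and \<alpha>: "\<And>i. i \<in> I \<Longrightarrow> \<alpha> i \<in> bimodule_hom R S X Y"
    and \<beta>: "\<And>i. i \<in> I \<Longrightarrow> \<beta> i \<in> bimodule_hom R S Y X"
    and sum: "\<And>x. x \<in> carrier X \<Longrightarrow> (\<Oplus>\<^bsub>X\<^esub>i\<in>I. \<beta> i (\<alpha> i x)) = x"
  shows "iso_to_direct_summand R S X (bimodule_power (card I) Y)"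
proof -
  interpret X: bimodule R S X by fact
  obtain e where e: "bij_betw e {..<card I} I"
    using ex_bij_betw_nat_finite[OF I] by (auto simp: lessThan_atLeast0)
  then have eI: "e j \<in> I" if "j < card I" for j
    using that by (auto simp: bij_betw_def)
  have "(\<Oplus>\<^bsub>X\<^esub>j\<in>{..<card I}. \<beta> (e j) (\<alpha> (e j) x)) = x" if x: "x \<in> carrier X" for x
  proof -
    have "\<beta> i (\<alpha> i x) \<in> carrier X" if "i \<in> I" for i
      using \<alpha>[OF that] \<beta>[OF that] x by (auto simp: bimodule_hom_def)
    then have "(\<Oplus>\<^bsub>X\<^esub>j\<in>{..<card I}. \<beta> (e j) (\<alpha> (e j) x)) = (\<Oplus>\<^bsub>X\<^esub>i\<in>I. \<beta> i (\<alpha> i x))"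
      using X.M.finsum_reindex[of "\<lambda>i. \<beta> i (\<alpha> i x)" e "{..<card I}"] e by (auto simp: bij_betw_def)
    with sum[OF x] show ?thesis by simp
  qed
  with \<alpha> \<beta> eI show ?thesis
    unfolding iso_to_direct_summand_power_iff[OF assms(1,2)]
    by (intro exI[of _ "\<lambda>j. \<alpha> (e j)"] exI[of _ "\<lambda>j. \<beta> (e j)"]) simp
qed

text \<open>The centralizer \<open>M\<^sup>C\<close> of \<open>C\<close> in an \<open>A\<close>-\<open>A\<close>-bimodule \<open>M\<close>.\<close>

definition centralizing ::
    "('c, 'x) ring_scheme \<Rightarrow> ('c \<Rightarrow> 'a) \<Rightarrow> ('a, 'a, 'm) bimodule \<Rightarrow> 'm set"
  where "centralizing C h M = {u \<in> carrier M. \<forall>c\<in>carrier C. lact M (h c) u = ract M u (h c)}"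

text \<open>Kadison's right depth-three quasibases of a tower \<open>A | B | C\<close>. For \<open>B = C\<close> and \<open>f = id\<close> they
  are the right depth-two quasibases of \<open>A | C\<close>.\<close>

definition rD3_quasibase ::
    "('c, 'x) ring_scheme \<Rightarrow> ('b, 'y) ring_scheme \<Rightarrow> ('a, 'z) ring_scheme
      \<Rightarrow> ('c \<Rightarrow> 'b) \<Rightarrow> ('b \<Rightarrow> 'a) \<Rightarrow> 'i set \<Rightarrow> ('i \<Rightarrow> 'a \<Rightarrow> 'a)
      \<Rightarrow> ('i \<Rightarrow> (('a \<times> 'a) \<Rightarrow>\<^sub>0 int) set) \<Rightarrow> bool"
  where "rD3_quasibase C B A f g I \<gamma> u \<longleftrightarrow>
    (\<forall>i\<in>I. \<gamma> i \<in> bimodule_hom B C (regular_bimodule A g (g \<circ> f)) (regular_bimodule A g (g \<circ> f))) \<and>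
    (\<forall>i\<in>I. u i \<in> centralizing C (g \<circ> f) (tensor_square B A g)) \<and>
    (\<forall>a\<in>carrier A.
      (\<Oplus>\<^bsub>tensor_square B A g\<^esub>i\<in>I. lact (tensor_square B A g) (\<gamma> i a) (u i))
        = pure_tensor B A g \<one>\<^bsub>A\<^esub> a)"

lemma ring_hom_ring_comp:
  assumes "ring_hom_ring C B f" "ring_hom_ring B A g"
  shows "ring_hom_ring C A (g \<circ> f)"
proof -
  interpret f: ring_hom_ring C B f by fact
  interpret g: ring_hom_ring B A g by fact
  show ?thesis by (rule ring_hom_ringI) (auto simp: f.R.ring_axioms g.S.ring_axioms)
qed

context ring_extension
begin

text \<open>If the maps \<open>\<alpha>\<^sub>i\<close> and \<open>\<beta>\<^sub>i\<close> decompose the identity of \<open>A \<otimes>\<^sub>B A\<close>, then \<open>\<gamma>\<^sub>i(a) = \<alpha>\<^sub>i(1 \<otimes> a)\<close> and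
  \<open>u\<^sub>i = \<beta>\<^sub>i(1)\<close> are quasibases. That \<open>\<beta>\<^sub>i\<close> respects both actions of \<open>C\<close> makes \<open>u\<^sub>i\<close> commute with \<open>C\<close>.\<close>

lemma rD3_quasibase_exists:
  fixes f :: "'c \<Rightarrow> 'b" and C :: "('c, 'x) ring_scheme"
  assumes f: "ring_hom_ring C B f" and rD3: "tower_rD3 C B A f g"
  obtains N \<gamma> u where "N > 0" and "rD3_quasibase C B A f g {..<N::nat} \<gamma> u"
proof -
  let ?h = "g \<circ> f"
  let ?X = "tensor_product B (regular_bimodule A id g) (regular_bimodule A g ?h)"
  let ?Y = "regular_bimodule A id ?h"
  note h = ring_hom_ring_comp[OF f g.ring_hom_ring_axioms]
  interpret h: ring_hom_ring C A ?h by (rule h)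
  note X = restricted_tensor_square[of id ?h]
  have bX: "bimodule A C ?X" "bimodule A C ?Y"
    by (intro bimodule_restricted_tensor_square bimodule_regular ring_hom_ring_id A.ring_axioms h)+
  obtain N :: nat and \<alpha> \<beta> where N: "N > 0"
    and hom: "\<forall>i<N. \<alpha> i \<in> bimodule_hom A C ?X ?Y \<and> \<beta> i \<in> bimodule_hom A C ?Y ?X"
    and sum: "\<forall>x\<in>carrier ?X. (\<Oplus>\<^bsub>?X\<^esub>i\<in>{..<N}. \<beta> i (\<alpha> i x)) = x"
    using rD3 unfolding tower_rD3_def iso_to_direct_summand_power_iff[OF bX]
    by (elim exE conjE) (rule that; assumption)
  let ?\<gamma> = "\<lambda>i a. \<alpha> i (T \<one>\<^bsub>A\<^esub> a)" and ?u = "\<lambda>i. \<beta> i \<one>\<^bsub>A\<^esub>"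
  have \<alpha>': "\<alpha> i x \<in> carrier A" "y \<in> carrier AA \<Longrightarrow> \<alpha> i (x \<oplus>\<^bsub>AA\<^esub> y) = \<alpha> i x \<oplus>\<^bsub>A\<^esub> \<alpha> i y"
    "a \<in> carrier A \<Longrightarrow> \<alpha> i (lact AA a x) = a \<otimes>\<^bsub>A\<^esub> \<alpha> i x"
    "c \<in> carrier C \<Longrightarrow> \<alpha> i (ract AA x (?h c)) = \<alpha> i x \<otimes>\<^bsub>A\<^esub> ?h c"
    if "i < N" "x \<in> carrier AA" for i x y a c
    using hom that by (auto simp: bimodule_hom_def X)
  have \<beta>': "\<beta> i x \<in> carrier AA"
    "a \<in> carrier A \<Longrightarrow> \<beta> i (a \<otimes>\<^bsub>A\<^esub> x) = lact AA a (\<beta> i x)"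
    "c \<in> carrier C \<Longrightarrow> \<beta> i (x \<otimes>\<^bsub>A\<^esub> ?h c) = ract AA (\<beta> i x) (?h c)"
    if "i < N" "x \<in> carrier A" for i x a c
    using hom that by (auto simp: bimodule_hom_def X)
  have u: "?u i \<in> centralizing C ?h AA" if "i < N" for i
    unfolding centralizing_def
  proof (intro CollectI conjI ballI)
    fix c assume c: "c \<in> carrier C"
    then have "?h c \<in> carrier A" by (rule h.hom_closed)
    with \<beta>'(2)[OF that A.one_closed, of "?h c"] \<beta>'(3)[OF that A.one_closed c]
    show "lact AA (?h c) (?u i) = ract AA (?u i) (?h c)" by simp
  qed (use \<beta>'(1)[OF that A.one_closed] in simp)
  have \<gamma>: "?\<gamma> i \<in> bimodule_hom B C (regular_bimodule A g ?h) (regular_bimodule A g ?h)" if i: "i < N" for i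
  proof -
    have "?\<gamma> i (g b \<otimes>\<^bsub>A\<^esub> a) = g b \<otimes>\<^bsub>A\<^esub> ?\<gamma> i a" if "b \<in> carrier B" "a \<in> carrier A" for a b
      using \<alpha>'(3)[OF i, of "T \<one>\<^bsub>A\<^esub> a" "g b"] that T_middle[of "\<one>\<^bsub>A\<^esub>" b a] by simp
    moreover have "?\<gamma> i (a \<otimes>\<^bsub>A\<^esub> ?h c) = ?\<gamma> i a \<otimes>\<^bsub>A\<^esub> ?h c" if "c \<in> carrier C" "a \<in> carrier A" for a c
      using \<alpha>'(4)[OF i, of "T \<one>\<^bsub>A\<^esub> a" c] h.hom_closed[OF that(1)] that by simp
    ultimately show ?thesis using \<alpha>'(1,2)[OF i]
      by (auto simp: bimodule_hom_def T_add_right)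
  qed
  have "(\<Oplus>\<^bsub>AA\<^esub>i\<in>{..<N}. lact AA (?\<gamma> i a) (?u i)) = T \<one>\<^bsub>A\<^esub> a" if a: "a \<in> carrier A" for a
  proof -
    have "(\<Oplus>\<^bsub>AA\<^esub>i\<in>{..<N}. lact AA (?\<gamma> i a) (?u i)) = (\<Oplus>\<^bsub>AA\<^esub>i\<in>{..<N}. \<beta> i (?\<gamma> i a))"
    proof (intro AA.M.finsum_cong' refl)
      fix i assume "i \<in> {..<N}"
      then have i: "i < N" by simp
      have "?\<gamma> i a \<in> carrier A" using \<alpha>'(1)[OF i] a by simp
      then show "lact AA (?\<gamma> i a) (?u i) = \<beta> i (?\<gamma> i a)"
        using \<beta>'(2)[OF i A.one_closed, of "?\<gamma> i a"] by simp
    qed (use \<alpha>' \<beta>' a in auto)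
    also have "\<dots> = T \<one>\<^bsub>A\<^esub> a" using sum a by (simp add: X)
    finally show ?thesis .
  qed
  with u \<gamma> have "rD3_quasibase C B A f g {..<N} ?\<gamma> ?u" by (auto simp: rD3_quasibase_def)
  with N show ?thesis by (rule that)
qed

text \<open>Conversely, quasibases define the maps \<open>x \<otimes> y \<mapsto> x \<gamma>\<^sub>i(y)\<close> and \<open>a \<mapsto> a u\<^sub>i\<close>. The index set is
  arbitrary because quasibases indexed by pairs arise below.\<close>

lemma tower_rD3_if_quasibase:
  fixes f :: "'c \<Rightarrow> 'b" and C :: "('c, 'x) ring_scheme"
  assumes f: "ring_hom_ring C B f" and I: "finite I" "I \<noteq> {}"
    and basis: "rD3_quasibase C B A f g I \<gamma> u"
  shows "tower_rD3 C B A f g"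
proof -
  let ?h = "g \<circ> f"
  let ?X = "tensor_product B (regular_bimodule A id g) (regular_bimodule A g ?h)"
  let ?Y = "regular_bimodule A id ?h"
  note h = ring_hom_ring_comp[OF f g.ring_hom_ring_axioms]
  interpret h: ring_hom_ring C A ?h by (rule h)
  note X = restricted_tensor_square[of id ?h]
  have bX: "bimodule A C ?X" "bimodule A C ?Y"
    by (intro bimodule_restricted_tensor_square bimodule_regular ring_hom_ring_id A.ring_axioms h)+
  have \<gamma>: "\<gamma> i x \<in> carrier A"
    "y \<in> carrier A \<Longrightarrow> \<gamma> i (x \<oplus>\<^bsub>A\<^esub> y) = \<gamma> i x \<oplus>\<^bsub>A\<^esub> \<gamma> i y"
    "b \<in> carrier B \<Longrightarrow> \<gamma> i (g b \<otimes>\<^bsub>A\<^esub> x) = g b \<otimes>\<^bsub>A\<^esub> \<gamma> i x"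
    "c \<in> carrier C \<Longrightarrow> \<gamma> i (x \<otimes>\<^bsub>A\<^esub> ?h c) = \<gamma> i x \<otimes>\<^bsub>A\<^esub> ?h c"
    if "i \<in> I" "x \<in> carrier A" for i x y b c
    using basis that by (auto simp: rD3_quasibase_def bimodule_hom_def)
  have u: "u i \<in> carrier AA" "c \<in> carrier C \<Longrightarrow> lact AA (?h c) (u i) = ract AA (u i) (?h c)"
    if "i \<in> I" for i c
    using basis that by (auto simp: rD3_quasibase_def centralizing_def)
  have "\<forall>i\<in>I. \<exists>\<alpha>. abelian_group_hom AA A \<alpha> \<and>
      (\<forall>x\<in>carrier A. \<forall>y\<in>carrier A. \<alpha> (T x y) = x \<otimes>\<^bsub>A\<^esub> \<gamma> i y)"
  proof
    fix i assume i: "i \<in> I"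
    obtain \<alpha> where "abelian_group_hom AA A \<alpha>"
      "\<And>x y. x \<in> carrier A \<Longrightarrow> y \<in> carrier A \<Longrightarrow> \<alpha> (T x y) = x \<otimes>\<^bsub>A\<^esub> \<gamma> i y"
      by (rule AA_lift[OF A.abelian_group_axioms, of "\<lambda>x y. x \<otimes>\<^bsub>A\<^esub> \<gamma> i y"])
        (use i in \<open>simp_all add: \<gamma> A.l_distr A.r_distr A.m_assoc\<close>)
    then show "\<exists>\<alpha>. abelian_group_hom AA A \<alpha> \<and>
      (\<forall>x\<in>carrier A. \<forall>y\<in>carrier A. \<alpha> (T x y) = x \<otimes>\<^bsub>A\<^esub> \<gamma> i y)" by blast
  qed
  then obtain \<alpha> where \<alpha>: "\<And>i. i \<in> I \<Longrightarrow> abelian_group_hom AA A (\<alpha> i)"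
    and \<alpha>T: "\<And>i x y. i \<in> I \<Longrightarrow> x \<in> carrier A \<Longrightarrow> y \<in> carrier A \<Longrightarrow> \<alpha> i (T x y) = x \<otimes>\<^bsub>A\<^esub> \<gamma> i y"
    by metis
  have \<alpha>hom: "\<alpha> i \<in> bimodule_hom A C ?X ?Y" if i: "i \<in> I" for i
  proof -
    interpret \<alpha>: abelian_group_hom AA A "\<alpha> i" using \<alpha>[OF i] .
    have "\<alpha> i (lact AA a x) = a \<otimes>\<^bsub>A\<^esub> \<alpha> i x" if "a \<in> carrier A" "x \<in> carrier AA" for a x
      using that(2)
      by (induction rule: AA_induct)
        (use that i in \<open>simp_all add: \<alpha>T \<gamma> A.m_assoc A.r_distr AA.lact_add AA.lact_closed\<close>)
    moreover have "\<alpha> i (ract AA x (?h c)) = \<alpha> i x \<otimes>\<^bsub>A\<^esub> ?h c" if "c \<in> carrier C" "x \<in> carrier AA" for c x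
      using that(2)
    proof (induction rule: AA_induct)
      case (pure x y)
      with i that h.hom_closed[of c] \<gamma>(4)[OF i, of y c] show ?case
        by (simp add: \<alpha>T \<gamma> A.m_assoc)
    next
      case (add x y)
      with i that h.hom_closed[of c] show ?case
        by (simp add: A.l_distr AA.add_ract AA.ract_closed)
    qed
    ultimately show ?thesis by (simp add: bimodule_hom_def X)
  qed
  have \<beta>hom: "(\<lambda>a. lact AA a (u i)) \<in> bimodule_hom A C ?Y ?X" if i: "i \<in> I" for i
    using u[OF i] h.hom_closed
    by (auto simp: bimodule_hom_def X AA.lact_closed AA.add_lact AA.mult_lact AA.lact_ract)
  have "(\<Oplus>\<^bsub>AA\<^esub>i\<in>I. lact AA (\<alpha> i x) (u i)) = x" if "x \<in> carrier AA" for x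
    using that
  proof (induction rule: AA_induct)
    case (pure x y)
    then have c: "(\<lambda>i. lact AA (\<gamma> i y) (u i)) \<in> I \<rightarrow> carrier AA"
      by (simp add: \<gamma> u AA.lact_closed)
    have "(\<Oplus>\<^bsub>AA\<^esub>i\<in>I. lact AA (\<alpha> i (T x y)) (u i)) = (\<Oplus>\<^bsub>AA\<^esub>i\<in>I. lact AA x (lact AA (\<gamma> i y) (u i)))"
      using pure by (intro AA.M.finsum_cong') (auto simp: \<alpha>T \<gamma> u AA.lact_closed AA.mult_lact)
    also have "\<dots> = lact AA x (T \<one>\<^bsub>A\<^esub> y)"
      using abelian_group_hom.hom_finsum[OF AA.lact_hom[OF pure(1)] c] basis pure
      by (simp add: rD3_quasibase_def)
    finally show ?case using pure by simp
  next
    case (add x y)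
    have \<alpha>c: "\<alpha> i z \<in> carrier A" if "i \<in> I" "z \<in> carrier AA" for i z
      using abelian_group_hom.hom_closed[OF \<alpha>] that by blast
    have "(\<Oplus>\<^bsub>AA\<^esub>i\<in>I. lact AA (\<alpha> i (x \<oplus>\<^bsub>AA\<^esub> y)) (u i))
        = (\<Oplus>\<^bsub>AA\<^esub>i\<in>I. lact AA (\<alpha> i x) (u i) \<oplus>\<^bsub>AA\<^esub> lact AA (\<alpha> i y) (u i))"
      using add abelian_group_hom.hom_add[OF \<alpha>]
      by (intro AA.M.finsum_cong') (auto simp: \<alpha>c u AA.add_lact AA.lact_closed)
    with add show ?case
      by (simp add: AA.M.finsum_addf \<alpha>c u AA.lact_closed)
  qed
  then have "iso_to_direct_summand A C ?X (bimodule_power (card I) ?Y)"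
    by (intro iso_to_direct_summand_powerI[OF bX I(1) \<alpha>hom \<beta>hom]) (simp_all add: X)
  moreover have "card I > 0" using I by (simp add: card_gt_0_iff)
  ultimately show ?thesis unfolding tower_rD3_def by blast
qed

lemma right_D2_eq_tower_rD3: "right_D2 B A g = tower_rD3 B B A id g"
  by (simp add: right_D2_def tower_rD3_def)

text \<open>The mirror image for left depth two uses the maps \<open>x \<otimes> y \<mapsto> \<eta>\<^sub>i(x) y\<close> and \<open>a \<mapsto> t\<^sub>i a\<close>.\<close>

lemma left_D2_if_quasibase:
  assumes I: "finite I" "I \<noteq> {}"
    and \<eta>: "\<And>i. i \<in> I \<Longrightarrow> \<eta> i \<in> bimodule_hom B B (regular_bimodule A g g) (regular_bimodule A g g)"
    and t: "\<And>i. i \<in> I \<Longrightarrow> t i \<in> centralizing B g AA"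
    and sum: "\<And>a. a \<in> carrier A \<Longrightarrow> (\<Oplus>\<^bsub>AA\<^esub>i\<in>I. ract AA (t i) (\<eta> i a)) = T a \<one>\<^bsub>A\<^esub>"
  shows "left_D2 B A g"
proof -
  let ?X = "tensor_product B (regular_bimodule A g g) (regular_bimodule A g id)"
  let ?Y = "regular_bimodule A g id"
  note X = restricted_tensor_square[of g id]
  have bX: "bimodule B A ?X" "bimodule B A ?Y"
    by (intro bimodule_restricted_tensor_square bimodule_regular ring_hom_ring_id A.ring_axioms
        g.ring_hom_ring_axioms)+
  have \<eta>': "\<eta> i x \<in> carrier A"
    "y \<in> carrier A \<Longrightarrow> \<eta> i (x \<oplus>\<^bsub>A\<^esub> y) = \<eta> i x \<oplus>\<^bsub>A\<^esub> \<eta> i y"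
    "b \<in> carrier B \<Longrightarrow> \<eta> i (g b \<otimes>\<^bsub>A\<^esub> x) = g b \<otimes>\<^bsub>A\<^esub> \<eta> i x"
    "b \<in> carrier B \<Longrightarrow> \<eta> i (x \<otimes>\<^bsub>A\<^esub> g b) = \<eta> i x \<otimes>\<^bsub>A\<^esub> g b"
    if "i \<in> I" "x \<in> carrier A" for i x y b
    using \<eta>[OF that(1)] that(2) by (auto simp: bimodule_hom_def)
  have t': "t i \<in> carrier AA" "b \<in> carrier B \<Longrightarrow> lact AA (g b) (t i) = ract AA (t i) (g b)"
    if "i \<in> I" for i b
    using t[OF that] by (auto simp: centralizing_def)
  have "\<forall>i\<in>I. \<exists>\<alpha>. abelian_group_hom AA A \<alpha> \<and>
      (\<forall>x\<in>carrier A. \<forall>y\<in>carrier A. \<alpha> (T x y) = \<eta> i x \<otimes>\<^bsub>A\<^esub> y)"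
  proof
    fix i assume i: "i \<in> I"
    obtain \<alpha> where "abelian_group_hom AA A \<alpha>"
      "\<And>x y. x \<in> carrier A \<Longrightarrow> y \<in> carrier A \<Longrightarrow> \<alpha> (T x y) = \<eta> i x \<otimes>\<^bsub>A\<^esub> y"
      by (rule AA_lift[OF A.abelian_group_axioms, of "\<lambda>x y. \<eta> i x \<otimes>\<^bsub>A\<^esub> y"])
        (use i in \<open>simp_all add: \<eta>' A.l_distr A.r_distr A.m_assoc\<close>)
    then show "\<exists>\<alpha>. abelian_group_hom AA A \<alpha> \<and>
      (\<forall>x\<in>carrier A. \<forall>y\<in>carrier A. \<alpha> (T x y) = \<eta> i x \<otimes>\<^bsub>A\<^esub> y)" by blast
  qed
  then obtain \<alpha> where \<alpha>: "\<And>i. i \<in> I \<Longrightarrow> abelian_group_hom AA A (\<alpha> i)"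
    and \<alpha>T: "\<And>i x y. i \<in> I \<Longrightarrow> x \<in> carrier A \<Longrightarrow> y \<in> carrier A \<Longrightarrow> \<alpha> i (T x y) = \<eta> i x \<otimes>\<^bsub>A\<^esub> y"
    by metis
  have \<alpha>hom: "\<alpha> i \<in> bimodule_hom B A ?X ?Y" if i: "i \<in> I" for i
  proof -
    interpret \<alpha>: abelian_group_hom AA A "\<alpha> i" using \<alpha>[OF i] .
    have "\<alpha> i (lact AA (g b) x) = g b \<otimes>\<^bsub>A\<^esub> \<alpha> i x" if "b \<in> carrier B" "x \<in> carrier AA" for b x
      using that(2)
      by (induction rule: AA_induct)
        (use that i in \<open>simp_all add: \<alpha>T \<eta>' A.m_assoc A.r_distr AA.lact_add AA.lact_closed\<close>)
    moreover have "\<alpha> i (ract AA x a) = \<alpha> i x \<otimes>\<^bsub>A\<^esub> a" if "a \<in> carrier A" "x \<in> carrier AA" for a x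
      using that(2)
      by (induction rule: AA_induct)
        (use that i in \<open>simp_all add: \<alpha>T \<eta>' A.m_assoc A.l_distr AA.add_ract AA.ract_closed\<close>)
    ultimately show ?thesis by (simp add: bimodule_hom_def X)
  qed
  have \<beta>hom: "(\<lambda>a. ract AA (t i) a) \<in> bimodule_hom B A ?Y ?X" if i: "i \<in> I" for i
    using t'[OF i]
    by (auto simp: bimodule_hom_def X AA.ract_closed AA.ract_add AA.ract_mult AA.lact_ract[symmetric])
  have "(\<Oplus>\<^bsub>AA\<^esub>i\<in>I. ract AA (t i) (\<alpha> i x)) = x" if "x \<in> carrier AA" for x
    using that
  proof (induction rule: AA_induct)
    case (pure x y)
    then have c: "(\<lambda>i. ract AA (t i) (\<eta> i x)) \<in> I \<rightarrow> carrier AA"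
      by (simp add: \<eta>' t' AA.ract_closed)
    have "(\<Oplus>\<^bsub>AA\<^esub>i\<in>I. ract AA (t i) (\<alpha> i (T x y))) = (\<Oplus>\<^bsub>AA\<^esub>i\<in>I. ract AA (ract AA (t i) (\<eta> i x)) y)"
      using pure by (intro AA.M.finsum_cong') (auto simp: \<alpha>T \<eta>' t' AA.ract_closed AA.ract_mult)
    also have "\<dots> = ract AA (T x \<one>\<^bsub>A\<^esub>) y"
      using abelian_group_hom.hom_finsum[OF AA.ract_hom[OF pure(2)] c] sum[OF pure(1)] by simp
    finally show ?case using pure by simp
  next
    case (add x y)
    have \<alpha>c: "\<alpha> i z \<in> carrier A" if "i \<in> I" "z \<in> carrier AA" for i z
      using abelian_group_hom.hom_closed[OF \<alpha>] that by blast
    have "(\<Oplus>\<^bsub>AA\<^esub>i\<in>I. ract AA (t i) (\<alpha> i (x \<oplus>\<^bsub>AA\<^esub> y)))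
        = (\<Oplus>\<^bsub>AA\<^esub>i\<in>I. ract AA (t i) (\<alpha> i x) \<oplus>\<^bsub>AA\<^esub> ract AA (t i) (\<alpha> i y))"
      using add abelian_group_hom.hom_add[OF \<alpha>]
      by (intro AA.M.finsum_cong') (auto simp: \<alpha>c t' AA.ract_add AA.ract_closed)
    with add show ?case
      by (simp add: AA.M.finsum_addf \<alpha>c t' AA.ract_closed)
  qed
  then have "iso_to_direct_summand B A ?X (bimodule_power (card I) ?Y)"
    by (intro iso_to_direct_summand_powerI[OF bX I(1) \<alpha>hom \<beta>hom]) (simp_all add: X)
  moreover have "card I > 0" using I by (simp add: card_gt_0_iff)
  ultimately show ?thesis unfolding left_D2_def by blast
qed

end

section \<open>Frobenius extensions: right depth two implies left depth two\<close>

locale frobenius_system = B: ring B + f: ring_hom_ring C B f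
  for C :: "('c, 'x) ring_scheme" and B :: "('b, 'y) ring_scheme" and f :: "'c \<Rightarrow> 'b" +
  fixes E :: "'b \<Rightarrow> 'c" and n :: nat and x y :: "nat \<Rightarrow> 'b"
  assumes E: "E \<in> bimodule_hom C C (regular_bimodule B f f) (regular_bimodule C id id)"
    and x: "x \<in> {..<n} \<rightarrow> carrier B" and y: "y \<in> {..<n} \<rightarrow> carrier B"
    and sum_E_y: "b \<in> carrier B \<Longrightarrow> (\<Oplus>\<^bsub>B\<^esub>i\<in>{..<n}. f (E (b \<otimes>\<^bsub>B\<^esub> x i)) \<otimes>\<^bsub>B\<^esub> y i) = b"
    and sum_x_E: "b \<in> carrier B \<Longrightarrow> (\<Oplus>\<^bsub>B\<^esub>i\<in>{..<n}. x i \<otimes>\<^bsub>B\<^esub> f (E (y i \<otimes>\<^bsub>B\<^esub> b))) = b"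
begin

lemma x_closed [simp]: "i < n \<Longrightarrow> x i \<in> carrier B" and y_closed [simp]: "i < n \<Longrightarrow> y i \<in> carrier B"
  using x y by auto

lemma E_closed [simp]: "b \<in> carrier B \<Longrightarrow> E b \<in> carrier C"
  and E_add: "b \<in> carrier B \<Longrightarrow> b' \<in> carrier B \<Longrightarrow> E (b \<oplus>\<^bsub>B\<^esub> b') = E b \<oplus>\<^bsub>C\<^esub> E b'"
  and E_left: "c \<in> carrier C \<Longrightarrow> b \<in> carrier B \<Longrightarrow> E (f c \<otimes>\<^bsub>B\<^esub> b) = c \<otimes>\<^bsub>C\<^esub> E b"
  and E_right: "c \<in> carrier C \<Longrightarrow> b \<in> carrier B \<Longrightarrow> E (b \<otimes>\<^bsub>B\<^esub> f c) = E b \<otimes>\<^bsub>C\<^esub> c"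
  using E by (auto simp: bimodule_hom_def)

text \<open>The Casimir element \<open>\<Sum>\<^sub>k x\<^sub>k \<otimes> y\<^sub>k\<close> of \<open>B \<otimes>\<^sub>C B\<close> commutes with \<open>B\<close>. This is stated as an
  identity of values of balanced maps, so that the tensor product need not be formed: expand
  \<open>b x\<^sub>k\<close> in the \<open>x\<^sub>l\<close>, move the coefficients in \<open>C\<close> to the other argument, and contract the sum
  over \<open>k\<close> to \<open>y\<^sub>l b\<close>.\<close>

lemma casimir:
  assumes G: "abelian_group G"
    and closed: "\<And>b b'. b \<in> carrier B \<Longrightarrow> b' \<in> carrier B \<Longrightarrow> \<beta> b b' \<in> carrier G"
    and addl: "\<And>b b' d. b \<in> carrier B \<Longrightarrow> b' \<in> carrier B \<Longrightarrow> d \<in> carrier B \<Longrightarrow>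
      \<beta> (b \<oplus>\<^bsub>B\<^esub> b') d = \<beta> b d \<oplus>\<^bsub>G\<^esub> \<beta> b' d"
    and addr: "\<And>b d d'. b \<in> carrier B \<Longrightarrow> d \<in> carrier B \<Longrightarrow> d' \<in> carrier B \<Longrightarrow>
      \<beta> b (d \<oplus>\<^bsub>B\<^esub> d') = \<beta> b d \<oplus>\<^bsub>G\<^esub> \<beta> b d'"
    and bal: "\<And>b c d. b \<in> carrier B \<Longrightarrow> c \<in> carrier C \<Longrightarrow> d \<in> carrier B \<Longrightarrow>
      \<beta> (b \<otimes>\<^bsub>B\<^esub> f c) d = \<beta> b (f c \<otimes>\<^bsub>B\<^esub> d)"
    and b: "b \<in> carrier B"
  shows "(\<Oplus>\<^bsub>G\<^esub>k\<in>{..<n}. \<beta> (b \<otimes>\<^bsub>B\<^esub> x k) (y k)) = (\<Oplus>\<^bsub>G\<^esub>l\<in>{..<n}. \<beta> (x l) (y l \<otimes>\<^bsub>B\<^esub> b))"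
proof -
  interpret G: abelian_group G by fact
  let ?e = "\<lambda>l k. f (E (y l \<otimes>\<^bsub>B\<^esub> b \<otimes>\<^bsub>B\<^esub> x k))"
  have e: "?e l k \<in> carrier B" if "l < n" "k < n" for l k
    using that b by simp
  have homl: "abelian_group_hom B G (\<lambda>b. \<beta> b d)" and homr: "abelian_group_hom B G (\<beta> d)"
    if "d \<in> carrier B" for d
    using that by (auto intro!: additive_abelian_group_homI B.abelian_group_axioms G simp: closed addl addr)
  have "(\<Oplus>\<^bsub>G\<^esub>k\<in>{..<n}. \<beta> (b \<otimes>\<^bsub>B\<^esub> x k) (y k))
      = (\<Oplus>\<^bsub>G\<^esub>k\<in>{..<n}. \<Oplus>\<^bsub>G\<^esub>l\<in>{..<n}. \<beta> (x l) (?e l k \<otimes>\<^bsub>B\<^esub> y k))"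
  proof (intro G.finsum_cong' refl)
    fix k assume "k \<in> {..<n}"
    then have k: "k < n" by simp
    have "(\<Oplus>\<^bsub>B\<^esub>l\<in>{..<n}. x l \<otimes>\<^bsub>B\<^esub> ?e l k) = (\<Oplus>\<^bsub>B\<^esub>l\<in>{..<n}. x l \<otimes>\<^bsub>B\<^esub> f (E (y l \<otimes>\<^bsub>B\<^esub> (b \<otimes>\<^bsub>B\<^esub> x k))))"
      using k b by (intro B.finsum_cong') (auto simp: B.m_assoc)
    then have "b \<otimes>\<^bsub>B\<^esub> x k = (\<Oplus>\<^bsub>B\<^esub>l\<in>{..<n}. x l \<otimes>\<^bsub>B\<^esub> ?e l k)"
      using sum_x_E[of "b \<otimes>\<^bsub>B\<^esub> x k"] b k by simp
    then have "\<beta> (b \<otimes>\<^bsub>B\<^esub> x k) (y k) = (\<Oplus>\<^bsub>G\<^esub>l\<in>{..<n}. \<beta> (x l \<otimes>\<^bsub>B\<^esub> ?e l k) (y k))"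
      using abelian_group_hom.hom_finsum[OF homl[OF y_closed[OF k]], of "\<lambda>l. x l \<otimes>\<^bsub>B\<^esub> ?e l k" "{..<n}"] k e
      by simp
    also have "\<dots> = (\<Oplus>\<^bsub>G\<^esub>l\<in>{..<n}. \<beta> (x l) (?e l k \<otimes>\<^bsub>B\<^esub> y k))"
      using k b by (intro G.finsum_cong') (auto simp: bal closed)
    finally show "\<beta> (b \<otimes>\<^bsub>B\<^esub> x k) (y k) = (\<Oplus>\<^bsub>G\<^esub>l\<in>{..<n}. \<beta> (x l) (?e l k \<otimes>\<^bsub>B\<^esub> y k))" .
  qed (use b in \<open>auto simp: closed intro!: G.finsum_closed\<close>)
  also have "\<dots> = (\<Oplus>\<^bsub>G\<^esub>l\<in>{..<n}. \<Oplus>\<^bsub>G\<^esub>k\<in>{..<n}. \<beta> (x l) (?e l k \<otimes>\<^bsub>B\<^esub> y k))"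
    using b by (intro G.finsum_swap) (auto simp: closed)
  also have "\<dots> = (\<Oplus>\<^bsub>G\<^esub>l\<in>{..<n}. \<beta> (x l) (y l \<otimes>\<^bsub>B\<^esub> b))"
  proof (intro G.finsum_cong' refl)
    fix l assume "l \<in> {..<n}"
    then have l: "l < n" by simp
    show "(\<Oplus>\<^bsub>G\<^esub>k\<in>{..<n}. \<beta> (x l) (?e l k \<otimes>\<^bsub>B\<^esub> y k)) = \<beta> (x l) (y l \<otimes>\<^bsub>B\<^esub> b)"
      using abelian_group_hom.hom_finsum[OF homr[OF x_closed[OF l]], of "\<lambda>k. ?e l k \<otimes>\<^bsub>B\<^esub> y k" "{..<n}"]
        sum_E_y[of "y l \<otimes>\<^bsub>B\<^esub> b"] l b by (simp add: Pi_def)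
  qed (use b in \<open>auto simp: closed\<close>)
  finally show ?thesis .
qed

end

lemma frobenius_extension_iff_system:
  "frobenius_extension C B f \<longleftrightarrow> (\<exists>E n x y. frobenius_system C B f E n x y)"
proof
  assume "frobenius_extension C B f"
  then obtain E and n :: nat and x y where "ring_hom_ring C B f"
    "E \<in> bimodule_hom C C (regular_bimodule B f f) (regular_bimodule C id id)"
    "x \<in> {..<n} \<rightarrow> carrier B" "y \<in> {..<n} \<rightarrow> carrier B"
    "\<forall>b\<in>carrier B. (\<Oplus>\<^bsub>B\<^esub>i\<in>{..<n}. f (E (b \<otimes>\<^bsub>B\<^esub> x i)) \<otimes>\<^bsub>B\<^esub> y i) = b \<and>
       (\<Oplus>\<^bsub>B\<^esub>i\<in>{..<n}. x i \<otimes>\<^bsub>B\<^esub> f (E (y i \<otimes>\<^bsub>B\<^esub> b))) = b"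
    unfolding frobenius_extension_def by blast
  then have "frobenius_system C B f E n x y"
    by (simp add: frobenius_system_def frobenius_system_axioms_def ring_hom_ring_def)
  then show "\<exists>E n x y. frobenius_system C B f E n x y" by blast
next
  assume "\<exists>E n x y. frobenius_system C B f E n x y"
  then obtain E n x y where "frobenius_system C B f E n x y" by blast
  then interpret frobenius_system C B f E n x y .
  show "frobenius_extension C B f"
    unfolding frobenius_extension_def using E x y sum_E_y sum_x_E f.ring_hom_ring_axioms by blast
qed

text \<open>In an extension with Frobenius homomorphism \<open>F\<close>, an element \<open>z\<close> of \<open>A\<close> defines a contraction
  \<open>\<Phi>\<^sub>z(x \<otimes> y) = x F(y z)\<close> of the tensor square. Contracting \<open>1 \<otimes> a = \<Sum>\<^sub>i \<gamma>\<^sub>i(a) u\<^sub>i\<close> gives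
  \<open>F(a z) = \<Sum>\<^sub>i \<gamma>\<^sub>i(a) \<eta>\<^sub>i(z)\<close> with \<open>\<eta>\<^sub>i(z) = \<Phi>\<^sub>z(u\<^sub>i)\<close>, and the maps \<open>\<eta>\<^sub>i\<close> are \<open>C\<close>-\<open>C\<close>-bilinear because
  the \<open>u\<^sub>i\<close> commute with \<open>C\<close>. The left quasibases are the \<open>\<eta>\<^sub>i\<close> together with the images
  \<open>t\<^sub>i = \<Sum>\<^sub>k p\<^sub>k \<otimes> \<gamma>\<^sub>i(q\<^sub>k)\<close> of the Casimir element, which commute with \<open>C\<close> since that element does.\<close>

lemma left_D2_if_right_D2:
  assumes frob: "frobenius_extension C A h" and D2: "right_D2 C A h"
  shows "left_D2 C A h"
proof -
  from frob have "ring_hom_ring C A h" by (simp add: frobenius_extension_def)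
  then interpret ring_extension C A h by (simp add: ring_extension_def ring_hom_ring_def)
  from frob obtain F n p q where "frobenius_system C A h F n p q"
    unfolding frobenius_extension_iff_system by blast
  then interpret F: frobenius_system C A h F n p q .
  note pq = F.x_closed F.y_closed and F' = F.E_closed F.E_add F.E_left F.E_right
  obtain N \<gamma> u where N: "N > 0" and basis: "rD3_quasibase C C A id h {..<N::nat} \<gamma> u"
    by (rule rD3_quasibase_exists[of C id])
      (use D2 in \<open>simp_all add: ring_hom_ring_id g.R.ring_axioms right_D2_eq_tower_rD3\<close>)
  have \<gamma>: "\<gamma> i x \<in> carrier A" "y \<in> carrier A \<Longrightarrow> \<gamma> i (x \<oplus>\<^bsub>A\<^esub> y) = \<gamma> i x \<oplus>\<^bsub>A\<^esub> \<gamma> i y"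
    "c \<in> carrier C \<Longrightarrow> \<gamma> i (h c \<otimes>\<^bsub>A\<^esub> x) = h c \<otimes>\<^bsub>A\<^esub> \<gamma> i x"
    "c \<in> carrier C \<Longrightarrow> \<gamma> i (x \<otimes>\<^bsub>A\<^esub> h c) = \<gamma> i x \<otimes>\<^bsub>A\<^esub> h c"
    if "i < N" "x \<in> carrier A" for i x y c
    using basis that by (auto simp: rD3_quasibase_def bimodule_hom_def)
  have u: "u i \<in> carrier AA" "c \<in> carrier C \<Longrightarrow> lact AA (h c) (u i) = ract AA (u i) (h c)"
    if "i < N" for i c
    using basis that by (auto simp: rD3_quasibase_def centralizing_def)
  have sum: "(\<Oplus>\<^bsub>AA\<^esub>i\<in>{..<N}. lact AA (\<gamma> i a) (u i)) = T \<one>\<^bsub>A\<^esub> a" if "a \<in> carrier A" for a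
    using basis that by (simp add: rD3_quasibase_def)

  have "\<forall>z\<in>carrier A. \<exists>\<phi>. abelian_group_hom AA A \<phi> \<and>
      (\<forall>x\<in>carrier A. \<forall>y\<in>carrier A. \<phi> (T x y) = x \<otimes>\<^bsub>A\<^esub> h (F (y \<otimes>\<^bsub>A\<^esub> z)))"
  proof
    fix z assume z: "z \<in> carrier A"
    obtain \<phi> where "abelian_group_hom AA A \<phi>"
      "\<And>x y. x \<in> carrier A \<Longrightarrow> y \<in> carrier A \<Longrightarrow> \<phi> (T x y) = x \<otimes>\<^bsub>A\<^esub> h (F (y \<otimes>\<^bsub>A\<^esub> z))"
      by (rule AA_lift[OF A.abelian_group_axioms, of "\<lambda>x y. x \<otimes>\<^bsub>A\<^esub> h (F (y \<otimes>\<^bsub>A\<^esub> z))"])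
        (use z in \<open>simp_all add: F' A.l_distr A.r_distr A.m_assoc\<close>)
    then show "\<exists>\<phi>. abelian_group_hom AA A \<phi> \<and>
      (\<forall>x\<in>carrier A. \<forall>y\<in>carrier A. \<phi> (T x y) = x \<otimes>\<^bsub>A\<^esub> h (F (y \<otimes>\<^bsub>A\<^esub> z)))" by blast
  qed
  then obtain \<Phi> where \<Phi>: "\<And>z. z \<in> carrier A \<Longrightarrow> abelian_group_hom AA A (\<Phi> z)"
    and \<Phi>T: "\<And>z x y. z \<in> carrier A \<Longrightarrow> x \<in> carrier A \<Longrightarrow> y \<in> carrier A \<Longrightarrow>
      \<Phi> z (T x y) = x \<otimes>\<^bsub>A\<^esub> h (F (y \<otimes>\<^bsub>A\<^esub> z))"
    by metis
  note \<Phi>c = abelian_group_hom.hom_closed[OF \<Phi>] and \<Phi>a = abelian_group_hom.hom_add[OF \<Phi>]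
  have \<Phi>_add: "\<Phi> (z \<oplus>\<^bsub>A\<^esub> z') x = \<Phi> z x \<oplus>\<^bsub>A\<^esub> \<Phi> z' x"
    if "z \<in> carrier A" "z' \<in> carrier A" "x \<in> carrier AA" for z z' x
    using that(3)
    by (induction rule: AA_induct)
      (use that in \<open>simp_all add: \<Phi>T \<Phi>a \<Phi>c F' A.r_distr A.a_ac\<close>)
  have \<Phi>_lact: "\<Phi> z (lact AA a x) = a \<otimes>\<^bsub>A\<^esub> \<Phi> z x"
    if "z \<in> carrier A" "a \<in> carrier A" "x \<in> carrier AA" for z a x
    using that(3)
    by (induction rule: AA_induct)
      (use that in \<open>simp_all add: \<Phi>T \<Phi>a \<Phi>c F' A.r_distr A.m_assoc AA.lact_add AA.lact_closed\<close>)
  have \<Phi>_ract: "\<Phi> (a \<otimes>\<^bsub>A\<^esub> z) x = \<Phi> z (ract AA x a)"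
    if "z \<in> carrier A" "a \<in> carrier A" "x \<in> carrier AA" for z a x
    using that(3)
    by (induction rule: AA_induct)
      (use that in \<open>simp_all add: \<Phi>T \<Phi>a \<Phi>c F' A.m_assoc AA.add_ract AA.ract_closed\<close>)
  have \<Phi>_right: "\<Phi> (z \<otimes>\<^bsub>A\<^esub> h c) x = \<Phi> z x \<otimes>\<^bsub>A\<^esub> h c"
    if "z \<in> carrier A" "c \<in> carrier C" "x \<in> carrier AA" for z c x
    using that(3)
  proof (induction rule: AA_induct)
    case (pure x y)
    then show ?case using that F.E_right[of c "y \<otimes>\<^bsub>A\<^esub> z"] by (simp add: \<Phi>T F' A.m_assoc)
  qed (use that in \<open>simp_all add: \<Phi>a \<Phi>c A.l_distr\<close>)

  define \<eta> where "\<eta> i z = \<Phi> z (u i)" for i z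
  have \<eta>c: "\<eta> i z \<in> carrier A" if "i < N" "z \<in> carrier A" for i z
    using that \<Phi>c u by (simp add: \<eta>_def)
  have \<eta>: "\<eta> i \<in> bimodule_hom C C (regular_bimodule A h h) (regular_bimodule A h h)" if i: "i < N" for i
  proof -
    have "\<eta> i (h c \<otimes>\<^bsub>A\<^esub> z) = h c \<otimes>\<^bsub>A\<^esub> \<eta> i z" if "c \<in> carrier C" "z \<in> carrier A" for c z
      using that u[OF i] by (simp add: \<eta>_def \<Phi>_ract \<Phi>_lact flip: u(2)[OF i])
    then show ?thesis
      using u[OF i] \<eta>c[OF i] by (simp add: bimodule_hom_def \<eta>_def \<Phi>_add \<Phi>_right)
  qed
  have \<gamma>\<eta>: "(\<Oplus>\<^bsub>A\<^esub>i\<in>{..<N}. \<gamma> i a \<otimes>\<^bsub>A\<^esub> \<eta> i z) = h (F (a \<otimes>\<^bsub>A\<^esub> z))"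
    if az: "a \<in> carrier A" "z \<in> carrier A" for a z
  proof -
    have c: "(\<lambda>i. lact AA (\<gamma> i a) (u i)) \<in> {..<N} \<rightarrow> carrier AA"
      using az by (simp add: \<gamma> u AA.lact_closed)
    have "(\<Oplus>\<^bsub>A\<^esub>i\<in>{..<N}. \<gamma> i a \<otimes>\<^bsub>A\<^esub> \<eta> i z) = (\<Oplus>\<^bsub>A\<^esub>i\<in>{..<N}. \<Phi> z (lact AA (\<gamma> i a) (u i)))"
      using az by (intro A.finsum_cong') (auto simp: \<Phi>_lact \<gamma> u \<eta>_def \<Phi>c)
    also have "\<dots> = \<Phi> z (T \<one>\<^bsub>A\<^esub> a)"
      using abelian_group_hom.hom_finsum[OF \<Phi>[OF az(2)] c] sum az by simp
    finally show ?thesis using az by (simp add: \<Phi>T F')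
  qed

  define t where "t i = (\<Oplus>\<^bsub>AA\<^esub>k\<in>{..<n}. T (p k) (\<gamma> i (q k)))" for i
  have tc: "t i \<in> carrier AA" if "i < N" for i
    using that by (auto simp: t_def pq \<gamma> intro!: AA.M.finsum_closed)
  have Tpq: "(\<lambda>k. T (p k) (\<gamma> i (q k))) \<in> {..<n} \<rightarrow> carrier AA" if "i < N" for i
    using that by (simp add: pq \<gamma>)
  have t: "t i \<in> centralizing C h AA" if i: "i < N" for i
    unfolding centralizing_def
  proof (intro CollectI conjI ballI)
    fix c assume c: "c \<in> carrier C"
    have "lact AA (h c) (t i) = (\<Oplus>\<^bsub>AA\<^esub>k\<in>{..<n}. T (h c \<otimes>\<^bsub>A\<^esub> p k) (\<gamma> i (q k)))"
      unfolding t_def abelian_group_hom.hom_finsum[OF AA.lact_hom[OF g.hom_closed[OF c]] Tpq[OF i]]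
      using c i by (intro AA.M.finsum_cong') (auto simp: pq \<gamma>)
    also have "\<dots> = (\<Oplus>\<^bsub>AA\<^esub>l\<in>{..<n}. T (p l) (\<gamma> i (q l \<otimes>\<^bsub>A\<^esub> h c)))"
      using c i by (intro F.casimir[of AA "\<lambda>a a'. T a (\<gamma> i a')"] AA.M.abelian_group_axioms)
        (simp_all add: \<gamma> T_add_left T_add_right T_middle)
    also have "\<dots> = ract AA (t i) (h c)"
      unfolding t_def abelian_group_hom.hom_finsum[OF AA.ract_hom[OF g.hom_closed[OF c]] Tpq[OF i]]
      using c i by (intro AA.M.finsum_cong') (auto simp: pq \<gamma>)
    finally show "lact AA (h c) (t i) = ract AA (t i) (h c)" .
  qed (rule tc[OF i])
  have "(\<Oplus>\<^bsub>AA\<^esub>i\<in>{..<N}. ract AA (t i) (\<eta> i a)) = T a \<one>\<^bsub>A\<^esub>" if a: "a \<in> carrier A" for a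
  proof -
    have "(\<Oplus>\<^bsub>AA\<^esub>i\<in>{..<N}. ract AA (t i) (\<eta> i a))
        = (\<Oplus>\<^bsub>AA\<^esub>i\<in>{..<N}. \<Oplus>\<^bsub>AA\<^esub>k\<in>{..<n}. T (p k) (\<gamma> i (q k) \<otimes>\<^bsub>A\<^esub> \<eta> i a))"
    proof (intro AA.M.finsum_cong' refl)
      fix i assume "i \<in> {..<N}"
      then have i: "i < N" by simp
      show "ract AA (t i) (\<eta> i a) = (\<Oplus>\<^bsub>AA\<^esub>k\<in>{..<n}. T (p k) (\<gamma> i (q k) \<otimes>\<^bsub>A\<^esub> \<eta> i a))"
        unfolding t_def abelian_group_hom.hom_finsum[OF AA.ract_hom[OF \<eta>c[OF i a]] Tpq[OF i]]
        using i a by (intro AA.M.finsum_cong') (auto simp: pq \<gamma> \<eta>c)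
    qed (use a in \<open>auto simp: pq \<gamma> \<eta>c intro!: AA.M.finsum_closed\<close>)
    also have "\<dots> = (\<Oplus>\<^bsub>AA\<^esub>k\<in>{..<n}. \<Oplus>\<^bsub>AA\<^esub>i\<in>{..<N}. T (p k) (\<gamma> i (q k) \<otimes>\<^bsub>A\<^esub> \<eta> i a))"
      using a by (intro AA.M.finsum_swap) (auto simp: pq \<gamma> \<eta>c)
    also have "\<dots> = (\<Oplus>\<^bsub>AA\<^esub>k\<in>{..<n}. T (p k \<otimes>\<^bsub>A\<^esub> h (F (q k \<otimes>\<^bsub>A\<^esub> a))) \<one>\<^bsub>A\<^esub>)"
    proof (intro AA.M.finsum_cong' refl)
      fix k assume "k \<in> {..<n}"
      then have k: "k < n" by simp
      have "(\<Oplus>\<^bsub>AA\<^esub>i\<in>{..<N}. T (p k) (\<gamma> i (q k) \<otimes>\<^bsub>A\<^esub> \<eta> i a)) = T (p k) (h (F (q k \<otimes>\<^bsub>A\<^esub> a)))"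
        unfolding \<gamma>\<eta>[OF pq(2)[OF k] a, symmetric]
        using k a by (intro abelian_group_hom.hom_finsum[OF T_hom_right, symmetric]) (auto simp: pq \<gamma> \<eta>c)
      then show "(\<Oplus>\<^bsub>AA\<^esub>i\<in>{..<N}. T (p k) (\<gamma> i (q k) \<otimes>\<^bsub>A\<^esub> \<eta> i a))
          = T (p k \<otimes>\<^bsub>A\<^esub> h (F (q k \<otimes>\<^bsub>A\<^esub> a))) \<one>\<^bsub>A\<^esub>"
        using k a by (simp add: T_middle pq F')
    qed (use a in \<open>auto simp: pq F'\<close>)
    also have "\<dots> = T (\<Oplus>\<^bsub>A\<^esub>k\<in>{..<n}. p k \<otimes>\<^bsub>A\<^esub> h (F (q k \<otimes>\<^bsub>A\<^esub> a))) \<one>\<^bsub>A\<^esub>"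
      using a by (intro abelian_group_hom.hom_finsum[OF T_hom_left, symmetric]) (auto simp: pq F')
    finally show ?thesis using F.sum_x_E a by simp
  qed
  with \<eta> t N show ?thesis by (intro left_D2_if_quasibase[of "{..<N}" \<eta> t]) auto
qed

section \<open>The endomorphism ring of a Frobenius extension\<close>

context frobenius_system
begin

abbreviation "A \<equiv> right_End C B f"
abbreviation "\<Lambda> \<equiv> left_regular B"

sublocale A: ring A
  by (rule ring_right_End[OF f.ring_hom_ring_axioms])

sublocale BA: ring_extension B A \<Lambda>
  using ring_hom_ring_left_regular[OF f.ring_hom_ring_axioms]
  by (simp add: ring_extension_def ring_hom_ring_def)

sublocale CA: ring_extension C A "\<Lambda> \<circ> f"
  using ring_hom_ring_comp[OF f.ring_hom_ring_axioms ring_hom_ring_left_regular[OF f.ring_hom_ring_axioms]]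
  by (simp add: ring_extension_def ring_hom_ring_def)

lemma End_closed [simp]: "h \<in> carrier A \<Longrightarrow> b \<in> carrier B \<Longrightarrow> h b \<in> carrier B"
  and End_add: "h \<in> carrier A \<Longrightarrow> b \<in> carrier B \<Longrightarrow> b' \<in> carrier B \<Longrightarrow> h (b \<oplus>\<^bsub>B\<^esub> b') = h b \<oplus>\<^bsub>B\<^esub> h b'"
  and End_right: "h \<in> carrier A \<Longrightarrow> b \<in> carrier B \<Longrightarrow> c \<in> carrier C \<Longrightarrow> h (b \<otimes>\<^bsub>B\<^esub> f c) = h b \<otimes>\<^bsub>B\<^esub> f c"
  by (auto simp: right_End_def)

lemma End_apply [simp]:
  "b \<in> carrier B \<Longrightarrow> (h \<otimes>\<^bsub>A\<^esub> k) b = h (k b)"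
  "b \<in> carrier B \<Longrightarrow> (h \<oplus>\<^bsub>A\<^esub> k) b = h b \<oplus>\<^bsub>B\<^esub> k b"
  "b \<in> carrier B \<Longrightarrow> \<one>\<^bsub>A\<^esub> b = b"
  "b \<in> carrier B \<Longrightarrow> \<Lambda> d b = d \<otimes>\<^bsub>B\<^esub> b"
  by (simp_all add: right_End_def compose_def left_regular_def)

lemma End_eqI:
  assumes "h \<in> carrier A" "k \<in> carrier A" "\<And>b. b \<in> carrier B \<Longrightarrow> h b = k b"
  shows "h = k"
  using assms by (auto simp: right_End_def intro: PiE_ext)

lemma End_hom: "h \<in> carrier A \<Longrightarrow> abelian_group_hom B B h"
  by (intro additive_abelian_group_homI B.abelian_group_axioms) (simp_all add: End_add)

lemma End_finsum_apply:
  assumes "h \<in> I \<rightarrow> carrier A" "b \<in> carrier B"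
  shows "(\<Oplus>\<^bsub>A\<^esub>i\<in>I. h i) b = (\<Oplus>\<^bsub>B\<^esub>i\<in>I. h i b)"
proof -
  have "abelian_group_hom A B (\<lambda>h. h b)"
    using assms(2) by (intro additive_abelian_group_homI A.abelian_group_axioms B.abelian_group_axioms) simp_all
  from abelian_group_hom.hom_finsum[OF this assms(1)] show ?thesis .
qed

text \<open>The Frobenius homomorphism as an element of the endomorphism ring; it plays the role of the
  Jones projection, with \<open>e b e = e E(b)\<close>.\<close>

definition e :: "'b \<Rightarrow> 'b"
  where "e = (\<lambda>b\<in>carrier B. f (E b))"

lemma e_apply [simp]: "b \<in> carrier B \<Longrightarrow> e b = f (E b)"
  by (simp add: e_def)

lemma e_closed [simp]: "e \<in> carrier A"
  by (auto simp: right_End_def e_def E_add E_right)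

lemma \<Lambda>_closed [simp]: "b \<in> carrier B \<Longrightarrow> \<Lambda> b \<in> carrier A"
  by (rule BA.g.hom_closed)

lemma \<Lambda>_mult: "b \<in> carrier B \<Longrightarrow> b' \<in> carrier B \<Longrightarrow> \<Lambda> (b \<otimes>\<^bsub>B\<^esub> b') = \<Lambda> b \<otimes>\<^bsub>A\<^esub> \<Lambda> b'"
  by (rule BA.g.hom_mult)

lemma e_commutes: "c \<in> carrier C \<Longrightarrow> e \<otimes>\<^bsub>A\<^esub> \<Lambda> (f c) = \<Lambda> (f c) \<otimes>\<^bsub>A\<^esub> e"
  by (rule End_eqI) (simp_all add: E_left)

lemma e_\<Lambda>_e: "b \<in> carrier B \<Longrightarrow> e \<otimes>\<^bsub>A\<^esub> \<Lambda> b \<otimes>\<^bsub>A\<^esub> e = e \<otimes>\<^bsub>A\<^esub> \<Lambda> (f (E b))"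
  by (rule End_eqI) (simp_all add: E_left E_right)

text \<open>Right \<open>C\<close>-linearity lets \<open>h\<close> pass through the dual basis expansion of its argument:
  \<open>h(b) = h(\<Sum>\<^sub>j x\<^sub>j E(y\<^sub>j b)) = \<Sum>\<^sub>j h(x\<^sub>j) E(y\<^sub>j b)\<close>. In particular \<open>A\<close> is spanned by
  the elements \<open>x e y\<close> with \<open>x\<close> and \<open>y\<close> in \<open>B\<close>.\<close>

lemma End_decomposition:
  assumes h: "h \<in> carrier A"
  shows "(\<Oplus>\<^bsub>A\<^esub>j\<in>{..<n}. \<Lambda> (h (x j)) \<otimes>\<^bsub>A\<^esub> e \<otimes>\<^bsub>A\<^esub> \<Lambda> (y j)) = h"
proof (rule End_eqI)
  fix b assume b: "b \<in> carrier B"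
  have "(\<Oplus>\<^bsub>A\<^esub>j\<in>{..<n}. \<Lambda> (h (x j)) \<otimes>\<^bsub>A\<^esub> e \<otimes>\<^bsub>A\<^esub> \<Lambda> (y j)) b
      = (\<Oplus>\<^bsub>B\<^esub>j\<in>{..<n}. (\<Lambda> (h (x j)) \<otimes>\<^bsub>A\<^esub> e \<otimes>\<^bsub>A\<^esub> \<Lambda> (y j)) b)"
    using h b by (intro End_finsum_apply) auto
  also have "\<dots> = (\<Oplus>\<^bsub>B\<^esub>j\<in>{..<n}. h (x j \<otimes>\<^bsub>B\<^esub> f (E (y j \<otimes>\<^bsub>B\<^esub> b))))"
    using h b by (intro B.finsum_cong') (auto simp: End_right)
  also have "\<dots> = h (\<Oplus>\<^bsub>B\<^esub>j\<in>{..<n}. x j \<otimes>\<^bsub>B\<^esub> f (E (y j \<otimes>\<^bsub>B\<^esub> b)))"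
    using h b by (intro abelian_group_hom.hom_finsum[OF End_hom, symmetric]) auto
  finally show "(\<Oplus>\<^bsub>A\<^esub>j\<in>{..<n}. \<Lambda> (h (x j)) \<otimes>\<^bsub>A\<^esub> e \<otimes>\<^bsub>A\<^esub> \<Lambda> (y j)) b = h b"
    using b by (simp add: sum_x_E)
qed (use h in \<open>auto intro!: A.finsum_closed\<close>)

text \<open>The Frobenius homomorphism of \<open>A | B\<close>, which sends \<open>x e y\<close> to \<open>x y\<close>.\<close>

definition E_A :: "('b \<Rightarrow> 'b) \<Rightarrow> 'b"
  where "E_A h = (\<Oplus>\<^bsub>B\<^esub>l\<in>{..<n}. h (x l) \<otimes>\<^bsub>B\<^esub> y l)"

lemma E_A_closed [simp]: "h \<in> carrier A \<Longrightarrow> E_A h \<in> carrier B"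
  by (auto simp: E_A_def intro!: B.finsum_closed)

lemma E_A_add: 
  assumes "h \<in> carrier A" "k \<in> carrier A"
  shows "E_A (h \<oplus>\<^bsub>A\<^esub> k) = E_A h \<oplus>\<^bsub>B\<^esub> E_A k"
proof -
  have "E_A (h \<oplus>\<^bsub>A\<^esub> k) = (\<Oplus>\<^bsub>B\<^esub>l\<in>{..<n}. h (x l) \<otimes>\<^bsub>B\<^esub> y l \<oplus>\<^bsub>B\<^esub> k (x l) \<otimes>\<^bsub>B\<^esub> y l)"
    unfolding E_A_def using assms by (intro B.finsum_cong') (auto simp: B.l_distr)
  then show ?thesis
    using assms by (simp add: E_A_def B.finsum_addf Pi_def)
qed

lemma E_A_left:
  assumes "h \<in> carrier A" "b \<in> carrier B"
  shows "E_A (\<Lambda> b \<otimes>\<^bsub>A\<^esub> h) = b \<otimes>\<^bsub>B\<^esub> E_A h"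
proof -
  have "E_A (\<Lambda> b \<otimes>\<^bsub>A\<^esub> h) = (\<Oplus>\<^bsub>B\<^esub>l\<in>{..<n}. b \<otimes>\<^bsub>B\<^esub> (h (x l) \<otimes>\<^bsub>B\<^esub> y l))"
    unfolding E_A_def using assms by (intro B.finsum_cong') (auto simp: B.m_assoc)
  then show ?thesis
    using assms by (simp add: E_A_def B.finsum_rdistr Pi_def)
qed

text \<open>Linearity on the right is not visible termwise; it expresses that the Casimir element commutes
  with \<open>b\<close>.\<close>

lemma E_A_right:
  assumes "h \<in> carrier A" "b \<in> carrier B"
  shows "E_A (h \<otimes>\<^bsub>A\<^esub> \<Lambda> b) = E_A h \<otimes>\<^bsub>B\<^esub> b"
proof -
  have "E_A (h \<otimes>\<^bsub>A\<^esub> \<Lambda> b) = (\<Oplus>\<^bsub>B\<^esub>l\<in>{..<n}. h (b \<otimes>\<^bsub>B\<^esub> x l) \<otimes>\<^bsub>B\<^esub> y l)"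
    unfolding E_A_def using assms by (intro B.finsum_cong') auto
  also have "\<dots> = (\<Oplus>\<^bsub>B\<^esub>l\<in>{..<n}. h (x l) \<otimes>\<^bsub>B\<^esub> (y l \<otimes>\<^bsub>B\<^esub> b))"
    using assms by (intro casimir[of B "\<lambda>b d. h b \<otimes>\<^bsub>B\<^esub> d"] B.abelian_group_axioms)
      (simp_all add: End_add End_right B.l_distr B.r_distr B.m_assoc)
  also have "\<dots> = (\<Oplus>\<^bsub>B\<^esub>l\<in>{..<n}. (h (x l) \<otimes>\<^bsub>B\<^esub> y l) \<otimes>\<^bsub>B\<^esub> b)"
    using assms by (intro B.finsum_cong') (auto simp: B.m_assoc)
  finally show ?thesis
    using assms by (simp add: E_A_def B.finsum_ldistr Pi_def)
qed

lemma E_A_e: 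
  assumes "h \<in> carrier A"
  shows "E_A (h \<otimes>\<^bsub>A\<^esub> e) = h \<one>\<^bsub>B\<^esub>"
proof -
  have "E_A (h \<otimes>\<^bsub>A\<^esub> e) = (\<Oplus>\<^bsub>B\<^esub>l\<in>{..<n}. h \<one>\<^bsub>B\<^esub> \<otimes>\<^bsub>B\<^esub> (f (E (\<one>\<^bsub>B\<^esub> \<otimes>\<^bsub>B\<^esub> x l)) \<otimes>\<^bsub>B\<^esub> y l))"
    unfolding E_A_def
  proof (intro B.finsum_cong' refl)
    fix l assume "l \<in> {..<n}"
    then have l: "l < n" by simp
    then have "h (f (E (x l))) = h \<one>\<^bsub>B\<^esub> \<otimes>\<^bsub>B\<^esub> f (E (x l))"
      using End_right[OF assms, of "\<one>\<^bsub>B\<^esub>" "E (x l)"] by simp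
    then show "(h \<otimes>\<^bsub>A\<^esub> e) (x l) \<otimes>\<^bsub>B\<^esub> y l = h \<one>\<^bsub>B\<^esub> \<otimes>\<^bsub>B\<^esub> (f (E (\<one>\<^bsub>B\<^esub> \<otimes>\<^bsub>B\<^esub> x l)) \<otimes>\<^bsub>B\<^esub> y l)"
      using l assms by (simp add: B.m_assoc)
  qed (use assms in auto)
  also have "\<dots> = h \<one>\<^bsub>B\<^esub> \<otimes>\<^bsub>B\<^esub> (\<Oplus>\<^bsub>B\<^esub>l\<in>{..<n}. f (E (\<one>\<^bsub>B\<^esub> \<otimes>\<^bsub>B\<^esub> x l)) \<otimes>\<^bsub>B\<^esub> y l)"
    using assms by (intro B.finsum_rdistr[symmetric]) auto
  finally show ?thesis using assms sum_E_y[of "\<one>\<^bsub>B\<^esub>"] by simp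
qed

text \<open>The dual bases of \<open>A | B\<close> are \<open>x\<^sub>j e\<close> and \<open>e y\<^sub>j\<close>; this is the part of the dual basis property
  that concerns a single \<open>j\<close>. It follows from \<open>e b e = e E(b)\<close>, applied to each term of the
  decomposition of \<open>h\<close>.\<close>

lemma e_E_A:
  assumes h: "h \<in> carrier A"
  shows "e \<otimes>\<^bsub>A\<^esub> \<Lambda> (E_A (e \<otimes>\<^bsub>A\<^esub> h)) = e \<otimes>\<^bsub>A\<^esub> h"
proof -
  have hom: "abelian_group_hom B A (\<lambda>b. e \<otimes>\<^bsub>A\<^esub> \<Lambda> b)"
    by (intro additive_abelian_group_homI B.abelian_group_axioms A.abelian_group_axioms)
      (simp_all add: A.r_distr BA.g.hom_add)
  have "e \<otimes>\<^bsub>A\<^esub> \<Lambda> (E_A (e \<otimes>\<^bsub>A\<^esub> h))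
      = (\<Oplus>\<^bsub>A\<^esub>l\<in>{..<n}. e \<otimes>\<^bsub>A\<^esub> \<Lambda> (f (E (h (x l))) \<otimes>\<^bsub>B\<^esub> y l))"
    unfolding E_A_def using h
    by (subst abelian_group_hom.hom_finsum[OF hom]) (auto intro!: A.finsum_cong')
  also have "\<dots> = (\<Oplus>\<^bsub>A\<^esub>l\<in>{..<n}. e \<otimes>\<^bsub>A\<^esub> (\<Lambda> (h (x l)) \<otimes>\<^bsub>A\<^esub> e \<otimes>\<^bsub>A\<^esub> \<Lambda> (y l)))"
  proof (intro A.finsum_cong' refl)
    fix l assume "l \<in> {..<n}"
    then have l: "l < n" by simp
    have "e \<otimes>\<^bsub>A\<^esub> \<Lambda> (f (E (h (x l))) \<otimes>\<^bsub>B\<^esub> y l) = e \<otimes>\<^bsub>A\<^esub> \<Lambda> (f (E (h (x l)))) \<otimes>\<^bsub>A\<^esub> \<Lambda> (y l)"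
      using l h by (simp add: \<Lambda>_mult A.m_assoc)
    also have "\<dots> = e \<otimes>\<^bsub>A\<^esub> \<Lambda> (h (x l)) \<otimes>\<^bsub>A\<^esub> e \<otimes>\<^bsub>A\<^esub> \<Lambda> (y l)"
      using l h by (simp add: e_\<Lambda>_e)
    finally show "e \<otimes>\<^bsub>A\<^esub> \<Lambda> (f (E (h (x l))) \<otimes>\<^bsub>B\<^esub> y l) = e \<otimes>\<^bsub>A\<^esub> (\<Lambda> (h (x l)) \<otimes>\<^bsub>A\<^esub> e \<otimes>\<^bsub>A\<^esub> \<Lambda> (y l))"
      using l h by (simp add: A.m_assoc)
  qed (use h in auto)
  also have "\<dots> = e \<otimes>\<^bsub>A\<^esub> (\<Oplus>\<^bsub>A\<^esub>l\<in>{..<n}. \<Lambda> (h (x l)) \<otimes>\<^bsub>A\<^esub> e \<otimes>\<^bsub>A\<^esub> \<Lambda> (y l))"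
    using h by (intro A.finsum_rdistr[symmetric]) auto
  finally show ?thesis using End_decomposition[OF h] by simp
qed

text \<open>Both \<open>A | B\<close> and \<open>B | C\<close> are Frobenius extensions, and these compose: the homomorphism
  is \<open>E \<circ> E\<^sub>A\<close>, and the dual bases are the products \<open>x\<^sub>j e x\<^sub>k\<close> and \<open>y\<^sub>k e y\<^sub>j\<close> of those of \<open>A | B\<close> and \<open>B | C\<close>.\<close>

lemma frobenius_right_End: "frobenius_extension C A (\<Lambda> \<circ> f)"
proof -
  let ?I = "{..<n} \<times> {..<n}"
  define F where "F h = E (E_A h)" for h
  have F: "F \<in> bimodule_hom C C (regular_bimodule A (\<Lambda> \<circ> f) (\<Lambda> \<circ> f)) (regular_bimodule C id id)"
    by (auto simp: bimodule_hom_def F_def E_A_add E_add E_A_left E_A_right E_left E_right)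
  have F_closed [simp]: "F h \<in> carrier C" if "h \<in> carrier A" for h
    using that by (simp add: F_def)
  \<comment> \<open>a Frobenius system is indexed by an initial segment of the naturals, the products by pairs\<close>
  obtain i where i: "bij_betw i {..<n * n} ?I"
    using ex_bij_betw_nat_finite[of ?I] by (auto simp: lessThan_atLeast0)
  then have i_less: "fst (i m) < n" "snd (i m) < n" if "m < n * n" for m
    using bij_betw_apply[OF i, of m] that by (auto simp: mem_Times_iff)
  have reindex: "(\<Oplus>\<^bsub>A\<^esub>m\<in>{..<n * n}. z (fst (i m)) (snd (i m))) = (\<Oplus>\<^bsub>A\<^esub>j\<in>{..<n}. \<Oplus>\<^bsub>A\<^esub>k\<in>{..<n}. z j k)"
    if "\<And>j k. j < n \<Longrightarrow> k < n \<Longrightarrow> z j k \<in> carrier A" for z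
  proof -
    have "(\<lambda>p. z (fst p) (snd p)) \<in> ?I \<rightarrow> carrier A" using that by auto
    with A.finsum_reindex[of "\<lambda>p. z (fst p) (snd p)" i "{..<n * n}"] i
    show ?thesis using that by (subst A.finsum_product) (simp_all add: bij_betw_def)
  qed
  let ?p = "\<lambda>j k. \<Lambda> (x j) \<otimes>\<^bsub>A\<^esub> e \<otimes>\<^bsub>A\<^esub> \<Lambda> (x k)" and ?q = "\<lambda>j k. \<Lambda> (y k) \<otimes>\<^bsub>A\<^esub> (e \<otimes>\<^bsub>A\<^esub> \<Lambda> (y j))"
  have pq: "?p j k \<in> carrier A" "?q j k \<in> carrier A" if "j < n" "k < n" for j k
    using that by simp_all
  have first: "(\<Oplus>\<^bsub>A\<^esub>j\<in>{..<n}. \<Oplus>\<^bsub>A\<^esub>k\<in>{..<n}. (\<Lambda> \<circ> f) (F (h \<otimes>\<^bsub>A\<^esub> ?p j k)) \<otimes>\<^bsub>A\<^esub> ?q j k) = h"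
    if h: "h \<in> carrier A" for h
  proof -
    have "(\<Oplus>\<^bsub>A\<^esub>j\<in>{..<n}. \<Oplus>\<^bsub>A\<^esub>k\<in>{..<n}. (\<Lambda> \<circ> f) (F (h \<otimes>\<^bsub>A\<^esub> ?p j k)) \<otimes>\<^bsub>A\<^esub> ?q j k)
        = (\<Oplus>\<^bsub>A\<^esub>j\<in>{..<n}. \<Lambda> (h (x j)) \<otimes>\<^bsub>A\<^esub> e \<otimes>\<^bsub>A\<^esub> \<Lambda> (y j))"
    proof (intro A.finsum_cong' refl)
      fix j assume "j \<in> {..<n}"
      then have j: "j < n" by simp
      have hom: "abelian_group_hom B A (\<lambda>b. \<Lambda> b \<otimes>\<^bsub>A\<^esub> (e \<otimes>\<^bsub>A\<^esub> \<Lambda> (y j)))"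
        using j by (intro additive_abelian_group_homI B.abelian_group_axioms A.abelian_group_axioms)
          (simp_all add: A.l_distr BA.g.hom_add)
      have "F (h \<otimes>\<^bsub>A\<^esub> ?p j k) = E (h (x j) \<otimes>\<^bsub>B\<^esub> x k)" if k: "k < n" for k
      proof -
        have "h \<otimes>\<^bsub>A\<^esub> ?p j k = h \<otimes>\<^bsub>A\<^esub> \<Lambda> (x j) \<otimes>\<^bsub>A\<^esub> e \<otimes>\<^bsub>A\<^esub> \<Lambda> (x k)"
          using h j k by (simp add: A.m_assoc)
        then show ?thesis using h j k by (simp add: F_def E_A_right E_A_e)
      qed
      then have "(\<Oplus>\<^bsub>A\<^esub>k\<in>{..<n}. (\<Lambda> \<circ> f) (F (h \<otimes>\<^bsub>A\<^esub> ?p j k)) \<otimes>\<^bsub>A\<^esub> ?q j k)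
          = (\<Oplus>\<^bsub>A\<^esub>k\<in>{..<n}. \<Lambda> (f (E (h (x j) \<otimes>\<^bsub>B\<^esub> x k)) \<otimes>\<^bsub>B\<^esub> y k) \<otimes>\<^bsub>A\<^esub> (e \<otimes>\<^bsub>A\<^esub> \<Lambda> (y j)))"
        using h j by (intro A.finsum_cong') (auto simp: \<Lambda>_mult A.m_assoc)
      also have "\<dots> = \<Lambda> (h (x j)) \<otimes>\<^bsub>A\<^esub> (e \<otimes>\<^bsub>A\<^esub> \<Lambda> (y j))"
        using h j sum_E_y[of "h (x j)"]
          abelian_group_hom.hom_finsum[OF hom, of "\<lambda>k. f (E (h (x j) \<otimes>\<^bsub>B\<^esub> x k)) \<otimes>\<^bsub>B\<^esub> y k" "{..<n}"]
        by (simp add: Pi_def)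
      finally show "(\<Oplus>\<^bsub>A\<^esub>k\<in>{..<n}. (\<Lambda> \<circ> f) (F (h \<otimes>\<^bsub>A\<^esub> ?p j k)) \<otimes>\<^bsub>A\<^esub> ?q j k)
          = \<Lambda> (h (x j)) \<otimes>\<^bsub>A\<^esub> e \<otimes>\<^bsub>A\<^esub> \<Lambda> (y j)"
        using h j by (simp add: A.m_assoc)
    qed (use h in auto)
    then show ?thesis using End_decomposition[OF h] by simp
  qed
  have second: "(\<Oplus>\<^bsub>A\<^esub>j\<in>{..<n}. \<Oplus>\<^bsub>A\<^esub>k\<in>{..<n}. ?p j k \<otimes>\<^bsub>A\<^esub> (\<Lambda> \<circ> f) (F (?q j k \<otimes>\<^bsub>A\<^esub> h))) = h"
    if h: "h \<in> carrier A" for h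
  proof -
    have "(\<Oplus>\<^bsub>A\<^esub>j\<in>{..<n}. \<Oplus>\<^bsub>A\<^esub>k\<in>{..<n}. ?p j k \<otimes>\<^bsub>A\<^esub> (\<Lambda> \<circ> f) (F (?q j k \<otimes>\<^bsub>A\<^esub> h)))
        = (\<Oplus>\<^bsub>A\<^esub>j\<in>{..<n}. \<Lambda> (\<one>\<^bsub>A\<^esub> (x j)) \<otimes>\<^bsub>A\<^esub> e \<otimes>\<^bsub>A\<^esub> \<Lambda> (y j) \<otimes>\<^bsub>A\<^esub> h)"
    proof (intro A.finsum_cong' refl)
      fix j assume "j \<in> {..<n}"
      then have j: "j < n" by simp
      have hom: "abelian_group_hom B A (\<lambda>b. \<Lambda> (x j) \<otimes>\<^bsub>A\<^esub> e \<otimes>\<^bsub>A\<^esub> \<Lambda> b)"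
        using j by (intro additive_abelian_group_homI B.abelian_group_axioms A.abelian_group_axioms)
          (simp_all add: A.r_distr BA.g.hom_add)
      let ?b = "E_A (e \<otimes>\<^bsub>A\<^esub> (\<Lambda> (y j) \<otimes>\<^bsub>A\<^esub> h))"
      have "F (?q j k \<otimes>\<^bsub>A\<^esub> h) = E (y k \<otimes>\<^bsub>B\<^esub> ?b)" if k: "k < n" for k
        using h j k by (simp add: F_def A.m_assoc E_A_left)
      then have "(\<Oplus>\<^bsub>A\<^esub>k\<in>{..<n}. ?p j k \<otimes>\<^bsub>A\<^esub> (\<Lambda> \<circ> f) (F (?q j k \<otimes>\<^bsub>A\<^esub> h)))
          = (\<Oplus>\<^bsub>A\<^esub>k\<in>{..<n}. \<Lambda> (x j) \<otimes>\<^bsub>A\<^esub> e \<otimes>\<^bsub>A\<^esub> \<Lambda> (x k \<otimes>\<^bsub>B\<^esub> f (E (y k \<otimes>\<^bsub>B\<^esub> ?b))))"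
        using h j by (intro A.finsum_cong') (auto simp: \<Lambda>_mult A.m_assoc)
      also have "\<dots> = \<Lambda> (x j) \<otimes>\<^bsub>A\<^esub> e \<otimes>\<^bsub>A\<^esub> \<Lambda> ?b"
        using h j sum_x_E[of ?b]
          abelian_group_hom.hom_finsum[OF hom, of "\<lambda>k. x k \<otimes>\<^bsub>B\<^esub> f (E (y k \<otimes>\<^bsub>B\<^esub> ?b))" "{..<n}"]
        by (simp add: Pi_def)
      also have "\<dots> = \<Lambda> (x j) \<otimes>\<^bsub>A\<^esub> (e \<otimes>\<^bsub>A\<^esub> \<Lambda> ?b)"
        using h j by (simp add: A.m_assoc)
      also have "\<dots> = \<Lambda> (x j) \<otimes>\<^bsub>A\<^esub> (e \<otimes>\<^bsub>A\<^esub> (\<Lambda> (y j) \<otimes>\<^bsub>A\<^esub> h))"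
        using h j by (simp add: e_E_A)
      finally show "(\<Oplus>\<^bsub>A\<^esub>k\<in>{..<n}. ?p j k \<otimes>\<^bsub>A\<^esub> (\<Lambda> \<circ> f) (F (?q j k \<otimes>\<^bsub>A\<^esub> h)))
          = \<Lambda> (\<one>\<^bsub>A\<^esub> (x j)) \<otimes>\<^bsub>A\<^esub> e \<otimes>\<^bsub>A\<^esub> \<Lambda> (y j) \<otimes>\<^bsub>A\<^esub> h"
        using h j by (simp add: A.m_assoc)
    qed (use h in auto)
    also have "\<dots> = (\<Oplus>\<^bsub>A\<^esub>j\<in>{..<n}. \<Lambda> (\<one>\<^bsub>A\<^esub> (x j)) \<otimes>\<^bsub>A\<^esub> e \<otimes>\<^bsub>A\<^esub> \<Lambda> (y j)) \<otimes>\<^bsub>A\<^esub> h"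
      using h by (intro A.finsum_ldistr[symmetric]) auto
    finally show ?thesis using End_decomposition[OF A.one_closed] h by simp
  qed
  have "frobenius_system C A (\<Lambda> \<circ> f) F (n * n) (\<lambda>m. ?p (fst (i m)) (snd (i m))) (\<lambda>m. ?q (fst (i m)) (snd (i m)))"
  proof (intro frobenius_system.intro frobenius_system_axioms.intro F A.ring_axioms CA.g.ring_hom_ring_axioms)
    fix h assume h: "h \<in> carrier A"
    show "(\<Oplus>\<^bsub>A\<^esub>m\<in>{..<n * n}. (\<Lambda> \<circ> f) (F (h \<otimes>\<^bsub>A\<^esub> ?p (fst (i m)) (snd (i m)))) \<otimes>\<^bsub>A\<^esub> ?q (fst (i m)) (snd (i m))) = h"
      using first[OF h] reindex[of "\<lambda>j k. (\<Lambda> \<circ> f) (F (h \<otimes>\<^bsub>A\<^esub> ?p j k)) \<otimes>\<^bsub>A\<^esub> ?q j k"] h by simp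
    show "(\<Oplus>\<^bsub>A\<^esub>m\<in>{..<n * n}. ?p (fst (i m)) (snd (i m)) \<otimes>\<^bsub>A\<^esub> (\<Lambda> \<circ> f) (F (?q (fst (i m)) (snd (i m)) \<otimes>\<^bsub>A\<^esub> h))) = h"
      using second[OF h] reindex[of "\<lambda>j k. ?p j k \<otimes>\<^bsub>A\<^esub> (\<Lambda> \<circ> f) (F (?q j k \<otimes>\<^bsub>A\<^esub> h))"] h by simp
  qed (use i_less pq in auto)
  then show ?thesis unfolding frobenius_extension_iff_system by blast
qed

end

section \<open>Right depth three of \<open>B | C\<close> implies right depth two of \<open>A | C\<close>\<close>

context frobenius_system
begin

text \<open>The \<open>B\<close>-\<open>B\<close>-bimodule map from \<open>A\<close> to \<open>A \<otimes>\<^sub>C A\<close> with \<open>x e y \<mapsto> x \<otimes> y\<close>.\<close>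

definition tensor_of_End :: "('b \<Rightarrow> 'b) \<Rightarrow> ((('b \<Rightarrow> 'b) \<times> ('b \<Rightarrow> 'b)) \<Rightarrow>\<^sub>0 int) set"
  where "tensor_of_End h = (\<Oplus>\<^bsub>CA.AA\<^esub>j\<in>{..<n}. CA.T (\<Lambda> (h (x j))) (\<Lambda> (y j)))"

lemma tensor_of_End_closed [simp]: "h \<in> carrier A \<Longrightarrow> tensor_of_End h \<in> carrier CA.AA"
  by (auto simp: tensor_of_End_def intro!: CA.AA.M.finsum_closed)

lemma tensor_of_End_add:
  assumes "h \<in> carrier A" "k \<in> carrier A"
  shows "tensor_of_End (h \<oplus>\<^bsub>A\<^esub> k) = tensor_of_End h \<oplus>\<^bsub>CA.AA\<^esub> tensor_of_End k"
proof -
  have "tensor_of_End (h \<oplus>\<^bsub>A\<^esub> k) = (\<Oplus>\<^bsub>CA.AA\<^esub>j\<in>{..<n}. CA.T (\<Lambda> (h (x j))) (\<Lambda> (y j)) \<oplus>\<^bsub>CA.AA\<^esub> CA.T (\<Lambda> (k (x j))) (\<Lambda> (y j)))"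
    unfolding tensor_of_End_def using assms
    by (intro CA.AA.M.finsum_cong') (auto simp: BA.g.hom_add CA.T_add_left)
  then show ?thesis
    using assms by (simp add: tensor_of_End_def CA.AA.M.finsum_addf Pi_def)
qed

lemma tensor_of_End_left:
  assumes "h \<in> carrier A" "b \<in> carrier B"
  shows "tensor_of_End (\<Lambda> b \<otimes>\<^bsub>A\<^esub> h) = lact CA.AA (\<Lambda> b) (tensor_of_End h)"
proof -
  have "lact CA.AA (\<Lambda> b) (tensor_of_End h) = (\<Oplus>\<^bsub>CA.AA\<^esub>j\<in>{..<n}. lact CA.AA (\<Lambda> b) (CA.T (\<Lambda> (h (x j))) (\<Lambda> (y j))))"
    unfolding tensor_of_End_def using assms
    by (intro abelian_group_hom.hom_finsum[OF CA.AA.lact_hom]) auto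
  also have "\<dots> = tensor_of_End (\<Lambda> b \<otimes>\<^bsub>A\<^esub> h)"
    unfolding tensor_of_End_def using assms by (intro CA.AA.M.finsum_cong') (auto simp: \<Lambda>_mult)
  finally show ?thesis by simp
qed

lemma tensor_of_End_right:
  assumes "h \<in> carrier A" "b \<in> carrier B"
  shows "tensor_of_End (h \<otimes>\<^bsub>A\<^esub> \<Lambda> b) = ract CA.AA (tensor_of_End h) (\<Lambda> b)"
proof -
  have "tensor_of_End (h \<otimes>\<^bsub>A\<^esub> \<Lambda> b) = (\<Oplus>\<^bsub>CA.AA\<^esub>j\<in>{..<n}. CA.T (\<Lambda> (h (b \<otimes>\<^bsub>B\<^esub> x j))) (\<Lambda> (y j)))"
    unfolding tensor_of_End_def using assms by (intro CA.AA.M.finsum_cong') auto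
  also have "\<dots> = (\<Oplus>\<^bsub>CA.AA\<^esub>j\<in>{..<n}. CA.T (\<Lambda> (h (x j))) (\<Lambda> (y j \<otimes>\<^bsub>B\<^esub> b)))"
  proof (intro casimir[of CA.AA "\<lambda>u v. CA.T (\<Lambda> (h u)) (\<Lambda> v)"] CA.AA.M.abelian_group_axioms)
    fix u c v assume "u \<in> carrier B" "c \<in> carrier C" "v \<in> carrier B"
    then show "CA.T (\<Lambda> (h (u \<otimes>\<^bsub>B\<^esub> f c))) (\<Lambda> v) = CA.T (\<Lambda> (h u)) (\<Lambda> (f c \<otimes>\<^bsub>B\<^esub> v))"
      using CA.T_middle[of "\<Lambda> (h u)" c "\<Lambda> v"] assms by (simp add: End_right \<Lambda>_mult)
  qed (use assms in \<open>simp_all add: End_add BA.g.hom_add CA.T_add_left CA.T_add_right\<close>)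
  also have "\<dots> = (\<Oplus>\<^bsub>CA.AA\<^esub>j\<in>{..<n}. ract CA.AA (CA.T (\<Lambda> (h (x j))) (\<Lambda> (y j))) (\<Lambda> b))"
    using assms by (intro CA.AA.M.finsum_cong') (auto simp: \<Lambda>_mult)
  also have "\<dots> = ract CA.AA (tensor_of_End h) (\<Lambda> b)"
    unfolding tensor_of_End_def using assms
    by (intro abelian_group_hom.hom_finsum[OF CA.AA.ract_hom, symmetric]) auto
  finally show ?thesis .
qed

lemma tensor_of_End_e: "tensor_of_End e = CA.T \<one>\<^bsub>A\<^esub> \<one>\<^bsub>A\<^esub>"
proof -
  have "tensor_of_End e = (\<Oplus>\<^bsub>CA.AA\<^esub>j\<in>{..<n}. CA.T \<one>\<^bsub>A\<^esub> (\<Lambda> (f (E (\<one>\<^bsub>B\<^esub> \<otimes>\<^bsub>B\<^esub> x j)) \<otimes>\<^bsub>B\<^esub> y j)))"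
    unfolding tensor_of_End_def
  proof (intro CA.AA.M.finsum_cong' refl)
    fix j assume "j \<in> {..<n}"
    then show "CA.T (\<Lambda> (e (x j))) (\<Lambda> (y j)) = CA.T \<one>\<^bsub>A\<^esub> (\<Lambda> (f (E (\<one>\<^bsub>B\<^esub> \<otimes>\<^bsub>B\<^esub> x j)) \<otimes>\<^bsub>B\<^esub> y j))"
      using CA.T_middle[of "\<one>\<^bsub>A\<^esub>" "E (x j)" "\<Lambda> (y j)"] by (simp add: \<Lambda>_mult)
  qed auto
  also have "\<dots> = CA.T \<one>\<^bsub>A\<^esub> (\<Lambda> (\<Oplus>\<^bsub>B\<^esub>j\<in>{..<n}. f (E (\<one>\<^bsub>B\<^esub> \<otimes>\<^bsub>B\<^esub> x j)) \<otimes>\<^bsub>B\<^esub> y j))"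
  proof (intro abelian_group_hom.hom_finsum[symmetric])
    show "abelian_group_hom B CA.AA (\<lambda>b. CA.T \<one>\<^bsub>A\<^esub> (\<Lambda> b))"
      by (intro additive_abelian_group_homI B.abelian_group_axioms CA.AA.M.abelian_group_axioms)
        (simp_all add: BA.g.hom_add CA.T_add_right)
  qed auto
  finally show ?thesis using sum_E_y[of "\<one>\<^bsub>B\<^esub>"] BA.g.hom_one by simp
qed

text \<open>Since the map \<open>x e y \<mapsto> x \<otimes> y\<close> is right \<open>B\<close>-linear, it extends to \<open>A \<otimes>\<^sub>B A\<close> by letting the
  second factor act.\<close>

lemma contraction:
  obtains \<sigma> where "abelian_group_hom BA.AA CA.AA \<sigma>"
    and "\<And>h a. h \<in> carrier A \<Longrightarrow> a \<in> carrier A \<Longrightarrow> \<sigma> (BA.T h a) = ract CA.AA (tensor_of_End h) a"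
proof (rule BA.AA_lift[of CA.AA "\<lambda>h a. ract CA.AA (tensor_of_End h) a"])
  show "abelian_group CA.AA" by (rule CA.AA.M.abelian_group_axioms)
qed (auto simp: tensor_of_End_add tensor_of_End_right CA.AA.ract_closed CA.AA.add_ract CA.AA.ract_add CA.AA.ract_mult)

text \<open>The map \<open>\<tau>\<close> is \<open>z \<mapsto> z \<otimes>\<^sub>A u\<close> from \<open>A \<otimes>\<^sub>B A\<close> to
  \<open>(A \<otimes>\<^sub>B A) \<otimes>\<^sub>A (A \<otimes>\<^sub>B A) = A \<otimes>\<^sub>B A \<otimes>\<^sub>B A\<close>, followed by the identification of the last module with
  \<open>A \<otimes>\<^sub>C A\<close>. It is balanced over \<open>B\<close> because \<open>\<sigma>\<close> is left \<open>B\<close>-linear. If \<open>u\<close> commutes with \<open>C\<close>, then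
  \<open>\<tau>\<close> respects the right action of \<open>C\<close>, since an element of \<open>C\<close> acting on \<open>z\<close> from the right can be
  moved past \<open>u\<close>.\<close>

lemma insertion:
  fixes \<sigma>
  assumes \<sigma>: "abelian_group_hom BA.AA CA.AA \<sigma>"
    and \<sigma>T: "\<And>h a. h \<in> carrier A \<Longrightarrow> a \<in> carrier A \<Longrightarrow> \<sigma> (BA.T h a) = ract CA.AA (tensor_of_End h) a"
    and u: "u \<in> centralizing C (\<Lambda> \<circ> f) BA.AA"
  obtains \<tau> where "abelian_group_hom BA.AA CA.AA \<tau>"
    and "\<And>a h. a \<in> carrier A \<Longrightarrow> h \<in> carrier A \<Longrightarrow> \<tau> (BA.T a h) = lact CA.AA a (\<sigma> (lact BA.AA h u))"
    and "\<And>a z. a \<in> carrier A \<Longrightarrow> z \<in> carrier BA.AA \<Longrightarrow> \<tau> (lact BA.AA a z) = lact CA.AA a (\<tau> z)"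
    and "\<And>z. z \<in> centralizing C (\<Lambda> \<circ> f) BA.AA \<Longrightarrow> \<tau> z \<in> centralizing C (\<Lambda> \<circ> f) CA.AA"
proof -
  interpret \<sigma>: abelian_group_hom BA.AA CA.AA \<sigma> by fact
  have u': "u \<in> carrier BA.AA" "\<And>c. c \<in> carrier C \<Longrightarrow> lact BA.AA (\<Lambda> (f c)) u = ract BA.AA u (\<Lambda> (f c))"
    using u by (auto simp: centralizing_def)
  \<comment> \<open>rewriting with \<open>o_apply\<close> would also change the structure map \<open>\<Lambda> \<circ> f\<close> inside the tensor square\<close>
  have \<sigma>_left: "\<sigma> (lact BA.AA (\<Lambda> b) z) = lact CA.AA (\<Lambda> b) (\<sigma> z)"
    if "b \<in> carrier B" "z \<in> carrier BA.AA" for b z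
    using that(2)
  proof (induction rule: BA.AA_induct)
    case (pure h a)
    then show ?case using that by (simp add: \<sigma>T tensor_of_End_left CA.AA.lact_ract del: o_apply)
  qed (use that in \<open>simp add: BA.AA.lact_add CA.AA.lact_add BA.AA.lact_closed del: o_apply\<close>)
  have \<sigma>_right: "\<sigma> (ract BA.AA z a) = ract CA.AA (\<sigma> z) a"
    if "a \<in> carrier A" "z \<in> carrier BA.AA" for a z
    using that(2)
  proof (induction rule: BA.AA_induct)
    case (pure h a')
    then show ?case using that by (simp add: \<sigma>T CA.AA.ract_mult del: o_apply)
  qed (use that in \<open>simp add: BA.AA.add_ract CA.AA.add_ract BA.AA.ract_closed del: o_apply\<close>)
  obtain \<tau> where \<tau>: "abelian_group_hom BA.AA CA.AA \<tau>"
    and \<tau>T: "\<And>a h. a \<in> carrier A \<Longrightarrow> h \<in> carrier A \<Longrightarrow> \<tau> (BA.T a h) = lact CA.AA a (\<sigma> (lact BA.AA h u))"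
  proof (rule BA.AA_lift[of CA.AA "\<lambda>a h. lact CA.AA a (\<sigma> (lact BA.AA h u))"])
    show "abelian_group CA.AA" by (rule CA.AA.M.abelian_group_axioms)
  qed (auto simp: u' CA.AA.lact_closed BA.AA.lact_closed CA.AA.add_lact CA.AA.lact_add
      BA.AA.add_lact CA.AA.mult_lact BA.AA.mult_lact \<sigma>_left)
  interpret \<tau>: abelian_group_hom BA.AA CA.AA \<tau> by fact
  have \<tau>_left: "\<tau> (lact BA.AA a z) = lact CA.AA a (\<tau> z)"
    if "a \<in> carrier A" "z \<in> carrier BA.AA" for a z
    using that(2)
  proof (induction rule: BA.AA_induct)
    case (pure h a')
    then show ?case using that
      by (simp add: \<tau>T CA.AA.mult_lact BA.AA.lact_closed u' del: o_apply)
  qed (use that in \<open>simp add: BA.AA.lact_add CA.AA.lact_add BA.AA.lact_closed del: o_apply\<close>)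
  have \<tau>_right: "\<tau> (ract BA.AA z (\<Lambda> (f c))) = ract CA.AA (\<tau> z) (\<Lambda> (f c))"
    if "c \<in> carrier C" "z \<in> carrier BA.AA" for c z
    using that(2)
  proof (induction rule: BA.AA_induct)
    case (pure a h)
    have "lact BA.AA (h \<otimes>\<^bsub>A\<^esub> \<Lambda> (f c)) u = ract BA.AA (lact BA.AA h u) (\<Lambda> (f c))"
      using that pure u' by (simp add: BA.AA.mult_lact BA.AA.lact_ract)
    then show ?case using that pure u'
      by (simp add: \<tau>T \<sigma>_right BA.AA.lact_closed CA.AA.lact_ract del: o_apply)
  qed (use that in \<open>simp add: BA.AA.add_ract CA.AA.add_ract BA.AA.ract_closed del: o_apply\<close>)
  show ?thesis
  proof (rule that[OF \<tau> \<tau>T \<tau>_left])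
    fix z assume "z \<in> centralizing C (\<Lambda> \<circ> f) BA.AA"
    then show "\<tau> z \<in> centralizing C (\<Lambda> \<circ> f) CA.AA"
      by (auto simp: centralizing_def simp flip: \<tau>_left \<tau>_right)
  qed
qed

text \<open>Under the identification of \<open>A \<otimes>\<^sub>B A \<otimes>\<^sub>B A\<close> with \<open>A \<otimes>\<^sub>C A\<close>, the element \<open>1 \<otimes> a\<close> is
  \<open>1 \<otimes> e \<otimes> a = \<Sum>\<^sub>i 1 \<otimes> e \<gamma>\<^sub>i(a) u\<^sub>i = \<Sum>\<^sub>i\<^sub>j \<gamma>\<^sub>j(e \<gamma>\<^sub>i(a)) (u\<^sub>j \<otimes>\<^sub>A u\<^sub>i)\<close>. The maps
  \<open>a \<mapsto> \<gamma>\<^sub>j(e \<gamma>\<^sub>i(a))\<close> are \<open>C\<close>-\<open>C\<close>-bilinear because \<open>e\<close> commutes with \<open>C\<close>.\<close>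

lemma right_D2_if_rD3:
  assumes "extension_rD3 C B f"
  shows "right_D2 C A (\<Lambda> \<circ> f)"
proof -
  obtain N \<gamma> u where N: "N > 0" and basis: "rD3_quasibase C B A f \<Lambda> {..<N::nat} \<gamma> u"
    using assms unfolding extension_rD3_def
    by (rule BA.rD3_quasibase_exists[OF f.ring_hom_ring_axioms])
  have \<gamma>: "\<gamma> i a \<in> carrier A" "a' \<in> carrier A \<Longrightarrow> \<gamma> i (a \<oplus>\<^bsub>A\<^esub> a') = \<gamma> i a \<oplus>\<^bsub>A\<^esub> \<gamma> i a'"
    "b \<in> carrier B \<Longrightarrow> \<gamma> i (\<Lambda> b \<otimes>\<^bsub>A\<^esub> a) = \<Lambda> b \<otimes>\<^bsub>A\<^esub> \<gamma> i a"
    "c \<in> carrier C \<Longrightarrow> \<gamma> i (a \<otimes>\<^bsub>A\<^esub> \<Lambda> (f c)) = \<gamma> i a \<otimes>\<^bsub>A\<^esub> \<Lambda> (f c)"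
    if "i < N" "a \<in> carrier A" for i a a' b c
    using basis that by (auto simp: rD3_quasibase_def bimodule_hom_def)
  have u: "u i \<in> centralizing C (\<Lambda> \<circ> f) BA.AA" "u i \<in> carrier BA.AA" if "i < N" for i
    using basis that by (auto simp: rD3_quasibase_def centralizing_def)
  have sum: "(\<Oplus>\<^bsub>BA.AA\<^esub>i\<in>{..<N}. lact BA.AA (\<gamma> i a) (u i)) = BA.T \<one>\<^bsub>A\<^esub> a" if "a \<in> carrier A" for a
    using basis that by (simp add: rD3_quasibase_def)
  obtain \<sigma> where \<sigma>: "abelian_group_hom BA.AA CA.AA \<sigma>"
    and \<sigma>T: "\<And>h a. h \<in> carrier A \<Longrightarrow> a \<in> carrier A \<Longrightarrow> \<sigma> (BA.T h a) = ract CA.AA (tensor_of_End h) a"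
    by (rule contraction) blast
  interpret \<sigma>: abelian_group_hom BA.AA CA.AA \<sigma> by fact
  have "\<forall>i<N. \<exists>\<tau>. abelian_group_hom BA.AA CA.AA \<tau> \<and>
    (\<forall>a\<in>carrier A. \<forall>h\<in>carrier A. \<tau> (BA.T a h) = lact CA.AA a (\<sigma> (lact BA.AA h (u i)))) \<and>
    (\<forall>a\<in>carrier A. \<forall>z\<in>carrier BA.AA. \<tau> (lact BA.AA a z) = lact CA.AA a (\<tau> z)) \<and>
    (\<forall>z\<in>centralizing C (\<Lambda> \<circ> f) BA.AA. \<tau> z \<in> centralizing C (\<Lambda> \<circ> f) CA.AA)"
    (is "\<forall>i<N. \<exists>\<tau>. ?P i \<tau>")
  proof (intro allI impI)
    fix i assume i: "i < N"
    obtain \<tau> where "abelian_group_hom BA.AA CA.AA \<tau>"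
      "\<And>a h. a \<in> carrier A \<Longrightarrow> h \<in> carrier A \<Longrightarrow> \<tau> (BA.T a h) = lact CA.AA a (\<sigma> (lact BA.AA h (u i)))"
      "\<And>a z. a \<in> carrier A \<Longrightarrow> z \<in> carrier BA.AA \<Longrightarrow> \<tau> (lact BA.AA a z) = lact CA.AA a (\<tau> z)"
      "\<And>z. z \<in> centralizing C (\<Lambda> \<circ> f) BA.AA \<Longrightarrow> \<tau> z \<in> centralizing C (\<Lambda> \<circ> f) CA.AA"
      using insertion[OF \<sigma> \<sigma>T u(1)[OF i]] by blast
    then show "\<exists>\<tau>. ?P i \<tau>" by blast
  qed
  then obtain \<tau> where \<tau>: "\<And>i. i < N \<Longrightarrow> ?P i (\<tau> i)" by metis
  \<comment> \<open>in a pair \<open>p = (i, j)\<close>, the index \<open>i\<close> belongs to the right pair of factors, which is expanded first\<close>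
  define \<Gamma> where "\<Gamma> p a = \<gamma> (snd p) (e \<otimes>\<^bsub>A\<^esub> \<gamma> (fst p) a)" for p a
  define W where "W p = \<tau> (fst p) (u (snd p))" for p
  have e\<gamma>: "e \<otimes>\<^bsub>A\<^esub> \<gamma> i a \<in> carrier A" if "i < N" "a \<in> carrier A" for i a
    using that by (simp add: \<gamma>)
  have \<Gamma>: "\<Gamma> p \<in> bimodule_hom C C (regular_bimodule A (\<Lambda> \<circ> f) (\<Lambda> \<circ> f)) (regular_bimodule A (\<Lambda> \<circ> f) (\<Lambda> \<circ> f))"
    if pN: "p \<in> {..<N} \<times> {..<N}" for p
  proof -
    from pN obtain i j where p: "p = (i, j)" "i < N" "j < N" by auto
    have "\<Gamma> p (\<Lambda> (f c) \<otimes>\<^bsub>A\<^esub> a) = \<Lambda> (f c) \<otimes>\<^bsub>A\<^esub> \<Gamma> p a" if "c \<in> carrier C" "a \<in> carrier A" for c a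
    proof -
      have "e \<otimes>\<^bsub>A\<^esub> (\<Lambda> (f c) \<otimes>\<^bsub>A\<^esub> \<gamma> i a) = \<Lambda> (f c) \<otimes>\<^bsub>A\<^esub> (e \<otimes>\<^bsub>A\<^esub> \<gamma> i a)"
        using that p e_commutes[of c] by (simp add: \<gamma> flip: A.m_assoc)
      then show ?thesis using that p by (simp add: \<Gamma>_def \<gamma>)
    qed
    moreover have "\<Gamma> p (a \<otimes>\<^bsub>A\<^esub> \<Lambda> (f c)) = \<Gamma> p a \<otimes>\<^bsub>A\<^esub> \<Lambda> (f c)" if "c \<in> carrier C" "a \<in> carrier A" for c a
    proof -
      have "e \<otimes>\<^bsub>A\<^esub> (\<gamma> i a \<otimes>\<^bsub>A\<^esub> \<Lambda> (f c)) = (e \<otimes>\<^bsub>A\<^esub> \<gamma> i a) \<otimes>\<^bsub>A\<^esub> \<Lambda> (f c)"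
        using that p by (simp add: \<gamma> A.m_assoc)
      then show ?thesis using that p by (simp add: \<Gamma>_def \<gamma>)
    qed
    ultimately show ?thesis
      using p by (simp add: bimodule_hom_def \<Gamma>_def \<gamma> A.r_distr)
  qed
  have W: "W p \<in> centralizing C (\<Lambda> \<circ> f) CA.AA" "W p \<in> carrier CA.AA" if "p \<in> {..<N} \<times> {..<N}" for p
  proof -
    show "W p \<in> centralizing C (\<Lambda> \<circ> f) CA.AA" using that \<tau> u by (auto simp: W_def)
    then show "W p \<in> carrier CA.AA" by (simp add: centralizing_def)
  qed
  have "(\<Oplus>\<^bsub>CA.AA\<^esub>p\<in>{..<N} \<times> {..<N}. lact CA.AA (\<Gamma> p a) (W p)) = CA.T \<one>\<^bsub>A\<^esub> a" if a: "a \<in> carrier A" for a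
  proof -
    have \<Gamma>c: "\<gamma> j (e \<otimes>\<^bsub>A\<^esub> \<gamma> i a) \<in> carrier A" if "i < N" "j < N" for i j
      using that a by (simp add: \<gamma>)
    have Wc: "\<tau> i (u j) \<in> carrier CA.AA" if "i < N" "j < N" for i j
      using W(2)[of "(i, j)"] that by (simp add: W_def)
    have "(\<Oplus>\<^bsub>CA.AA\<^esub>p\<in>{..<N} \<times> {..<N}. lact CA.AA (\<Gamma> p a) (W p))
        = (\<Oplus>\<^bsub>CA.AA\<^esub>i\<in>{..<N}. \<Oplus>\<^bsub>CA.AA\<^esub>j\<in>{..<N}. lact CA.AA (\<gamma> j (e \<otimes>\<^bsub>A\<^esub> \<gamma> i a)) (\<tau> i (u j)))"
      unfolding \<Gamma>_def W_def
      by (rule CA.AA.M.finsum_product[symmetric]) (auto simp: \<Gamma>c Wc CA.AA.lact_closed)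
    also have "\<dots> = (\<Oplus>\<^bsub>CA.AA\<^esub>i\<in>{..<N}. \<sigma> (lact BA.AA e (lact BA.AA (\<gamma> i a) (u i))))"
    proof (intro CA.AA.M.finsum_cong' refl)
      fix i assume "i \<in> {..<N}"
      then have i: "i < N" by simp
      interpret \<tau>: abelian_group_hom BA.AA CA.AA "\<tau> i" using \<tau>[OF i] by simp
      have "(\<Oplus>\<^bsub>CA.AA\<^esub>j\<in>{..<N}. lact CA.AA (\<gamma> j (e \<otimes>\<^bsub>A\<^esub> \<gamma> i a)) (\<tau> i (u j)))
          = (\<Oplus>\<^bsub>CA.AA\<^esub>j\<in>{..<N}. \<tau> i (lact BA.AA (\<gamma> j (e \<otimes>\<^bsub>A\<^esub> \<gamma> i a)) (u j)))"
        using \<tau>[OF i] i u by (intro CA.AA.M.finsum_cong') (auto simp: \<Gamma>c BA.AA.lact_closed)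
      also have "\<dots> = \<tau> i (BA.T \<one>\<^bsub>A\<^esub> (e \<otimes>\<^bsub>A\<^esub> \<gamma> i a))"
        using \<tau>.hom_finsum[of "\<lambda>j. lact BA.AA (\<gamma> j (e \<otimes>\<^bsub>A\<^esub> \<gamma> i a)) (u j)" "{..<N}"]
          sum[OF e\<gamma>[OF i a]] i u by (simp add: \<Gamma>c BA.AA.lact_closed)
      also have "\<dots> = \<sigma> (lact BA.AA e (lact BA.AA (\<gamma> i a) (u i)))"
        using \<tau>[OF i] e\<gamma>[OF i a] i a u
        by (simp add: \<gamma> CA.AA.one_lact BA.AA.lact_closed BA.AA.mult_lact)
      finally show "(\<Oplus>\<^bsub>CA.AA\<^esub>j\<in>{..<N}. lact CA.AA (\<gamma> j (e \<otimes>\<^bsub>A\<^esub> \<gamma> i a)) (\<tau> i (u j)))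
          = \<sigma> (lact BA.AA e (lact BA.AA (\<gamma> i a) (u i)))" .
    qed (use a u in \<open>auto simp: \<gamma> BA.AA.lact_closed del: o_apply\<close>)
    also have "\<dots> = \<sigma> (\<Oplus>\<^bsub>BA.AA\<^esub>i\<in>{..<N}. lact BA.AA e (lact BA.AA (\<gamma> i a) (u i)))"
      using a u by (intro \<sigma>.hom_finsum[symmetric]) (auto simp: \<gamma> BA.AA.lact_closed)
    also have "(\<Oplus>\<^bsub>BA.AA\<^esub>i\<in>{..<N}. lact BA.AA e (lact BA.AA (\<gamma> i a) (u i))) = lact BA.AA e (BA.T \<one>\<^bsub>A\<^esub> a)"
      unfolding sum[OF a, symmetric] using a u
      by (intro abelian_group_hom.hom_finsum[OF BA.AA.lact_hom, symmetric]) (auto simp: \<gamma> BA.AA.lact_closed)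
    finally show ?thesis using a by (simp add: \<sigma>T tensor_of_End_e del: o_apply)
  qed
  then have "rD3_quasibase C C A id (\<Lambda> \<circ> f) ({..<N} \<times> {..<N}) \<Gamma> W"
    using \<Gamma> W(1) by (simp add: rD3_quasibase_def del: o_apply)
  then show ?thesis
    unfolding CA.right_D2_eq_tower_rD3
    by (rule CA.tower_rD3_if_quasibase[rotated -1]) (use N in \<open>auto intro: ring_hom_ring_id f.R.ring_axioms\<close>)
qed

end

theorem theorem2p5:
  fixes C :: "('c, 'x) ring_scheme" and B :: "('b, 'y) ring_scheme" and f :: "'c \<Rightarrow> 'b"
  assumes "frobenius_extension C B f"
    and "extension_rD3 C B f"
  shows "depth_two C (right_End C B f) (left_regular B \<circ> f)"
proof -
  from assms(1) obtain E n x y where "frobenius_system C B f E n x y"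
    unfolding frobenius_extension_iff_system by blast
  then interpret frobenius_system C B f E n x y .
  show ?thesis
    unfolding depth_two_def
    using left_D2_if_right_D2[OF frobenius_right_End] right_D2_if_rD3[OF assms(2)] by blast
qed

end
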